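(* Let $\mathcal T$ be a regular rooted tree with branching numbers $b_0,\dots,b_{N_{\mathcal T}}$, let $m_\infty=b_0b_1\cdots b_{N_{\mathcal T}}$, and let $\mathcal A^{\mathrm D},\mathcal A^{\mathrm N}$ be the Dirichlet and Neumann realisations of the Ornstein–Uhlenbeck operator on $L^2_\mu(\mathcal T)$ (see context). Enumerate the eigenvalues of $\mathcal A^{\mathrm D}$ and $\mathcal A^{\mathrm N}$, repeated according to multiplicity, as $0<\lambda_1^{\mathrm D}\le\lambda_2^{\mathrm D}\le\dots$ and $0=\lambda_1^{\mathrm N}<\lambda_2^{\mathrm N}\le\lambda_3^{\mathrm N}\le\dots$, respectively. For each $q\in\mathbb N_0$, $$\lambda^{\mathrm D}_{(q+1)m_\infty}\ge\dots\ge\lambda^{\mathrm D}_{q\,m_\infty+1}\ge\frac{(2q+1)b_0}{m_\infty}$$ as well as $$\lambda^{\mathrm N}_{q\,m_\infty+1}\ge\frac{2q\,b_0}{m_\infty}\quad\text{and}\quad\lambda^{\mathrm N}_{(q+1)m_\infty}\ge\dots\ge\lambda^{\mathrm N}_{q\,m_\infty+2}\ge\frac{(2q+1)b_0}{m_\infty},$$ where the last chain of inequalities is void when $m_\infty=1$.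
   Context: Regular rooted tree. Let $\widetilde{\mathcal T}$ be a compact rooted metric tree (finite tree, edges of finite positive length) with vertex set $\mathsf V$, root $\mathsf o$, and nonempty set $\mathsf L\subset\mathsf V\setminus\{\mathsf o\}$ of leaves (degree-one vertices other than the root); $\mathcal T$ is obtained by attaching to each vertex of $\mathsf L$ a finite non-zero number of half-lines. $|x|$ is the path distance of $x\in\mathcal T$ to $\mathsf o$; edges are oriented and parametrised by arc length away from the root, with $f'$ the weak derivative in this coordinate. $\mathcal T$ is regular if there are $N_{\mathcal T}\in\mathbb N$, levels $0=t_0<t_1<\dots<t_{N_{\mathcal T}}$ and positive integers (branching numbers) $b_0,\dots,b_{N_{\mathcal T}}$ such that: $\mathsf V=\bigsqcup_{k=0}^{N_{\mathcal T}}\mathsf V_k$ with $\mathsf V_k=\{\mathsf v\in\mathsf V:|\mathsf v|=t_k\}$; every $\mathsf v\in\mathsf V_k$ has exactly $b_k$ outgoing edges (edges emanating away from the root); and $\mathsf V_{N_{\mathcal T}}=\mathsf L$ (so each such vertex carries $b_{N_{\mathcal T}}$ half-lines). $m_\infty$ is the total number of half-lines. Operators. $\mu(\mathrm dx)=\frac2{\sqrt\pi}e^{-|x|^2}\,\mathrm dx$ on $\mathcal T$. $H^1_\mu(\mathcal T)$: continuous functions on $\mathcal T$ lying in $H^1_\mu(\mathsf e)$ on each edge $\mathsf e$; $H^1_{0,\mu}(\mathcal T)$: those vanishing at $\mathsf o$. $\mathcal A^{\mathrm D}$ (resp. $\mathcal A^{\mathrm N}$) is the self-adjoint operator on $L^2_\mu(\mathcal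 T)$ associated with the closed form $\frac12\int_{\mathcal T}f'\,\overline{h'}\,\mathrm d\mu$ on $H^1_{0,\mu}(\mathcal T)$ (resp. $H^1_\mu(\mathcal T)$). Equivalently: $-\frac12f''+|x|f'$ on edges with $f$ edgewise in $H^2_\mu$, continuous at vertices, zero sum of derivatives pointing away from the vertex at every vertex $\ne\mathsf o$, and at $\mathsf o$ the condition $f(\mathsf o)=0$ (resp. the same zero-sum condition). Both have compact resolvent. *)

theory Defs
  imports "HOL-Analysis.Analysis" "HOL-Library.Function_Algebras"
begin

section \<open>Rooted metric trees with half-lines\<close>

text \<open>The finite tree is given by its arcs, oriented away from the root; \<open>rays T v\<close> is the number
  of half-lines attached to \<open>v\<close>.\<close>

record 'v rooted_tree =
  verts :: "'v set"
  origin :: 'v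
  arcs :: "('v \<times> 'v) set"
  len :: "'v \<times> 'v \<Rightarrow> real"
  rays :: "'v \<Rightarrow> nat"

text \<open>The degree is taken in the compact tree, i.e. without the half-lines.\<close>

definition tree_degree :: "('v, 'z) rooted_tree_scheme \<Rightarrow> 'v \<Rightarrow> nat" where
  "tree_degree T v = card {a \<in> arcs T. fst a = v \<or> snd a = v}"

definition leaves :: "('v, 'z) rooted_tree_scheme \<Rightarrow> 'v set" where
  "leaves T = {v \<in> verts T - {origin T}. tree_degree T v = 1}"

definition metric_tree :: "('v, 'z) rooted_tree_scheme \<Rightarrow> bool" where
  "metric_tree T \<longleftrightarrow>
     finite (verts T) \<and> origin T \<in> verts T \<and> arcs T \<subseteq> verts T \<times> verts T \<and>
     (\<forall>u. (u, origin T) \<notin> arcs T) \<and>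
     (\<forall>v \<in> verts T - {origin T}. \<exists>!u. (u, v) \<in> arcs T) \<and>
     (\<forall>v \<in> verts T. (origin T, v) \<in> (arcs T)\<^sup>*) \<and>
     (\<forall>a \<in> arcs T. 0 < len T a) \<and>
     leaves T \<noteq> {} \<and>
     (\<forall>v \<in> verts T. 0 < rays T v \<longleftrightarrow> v \<in> leaves T)"

inductive path_length :: "('v, 'z) rooted_tree_scheme \<Rightarrow> 'v \<Rightarrow> real \<Rightarrow> bool"
  for T :: "('v, 'z) rooted_tree_scheme" where
  root: "path_length T (origin T) 0"
| step: "path_length T u d \<Longrightarrow> (u, v) \<in> arcs T \<Longrightarrow> path_length T v (d + len T (u, v))"

text \<open>The distance of a vertex to the root: the length of the unique path joining them.\<close>

definition depth :: "('v, 'z) rooted_tree_scheme \<Rightarrow> 'v \<Rightarrow> real" where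
  "depth T v = (THE d. path_length T v d)"

definition out_edges :: "('v, 'z) rooted_tree_scheme \<Rightarrow> 'v \<Rightarrow> nat" where
  "out_edges T v = card {w. (v, w) \<in> arcs T} + rays T v"

definition level :: "('v, 'z) rooted_tree_scheme \<Rightarrow> real \<Rightarrow> 'v set" where
  "level T r = {v \<in> verts T. depth T v = r}"

text \<open>As \<open>t\<close> is strictly increasing, the levels are disjoint. Nothing requires an arc to join consecutive
  levels; if all do, the number of half-lines is \<open>\<Prod>k\<le>N. b k\<close>.\<close>

definition regular_tree ::
  "('v, 'z) rooted_tree_scheme \<Rightarrow> nat \<Rightarrow> (nat \<Rightarrow> real) \<Rightarrow> (nat \<Rightarrow> nat) \<Rightarrow> bool" where
  "regular_tree T N t b \<longleftrightarrow>
     metric_tree T \<and>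
     t 0 = 0 \<and> (\<forall>k<N. t k < t (Suc k)) \<and> (\<forall>k\<le>N. 0 < b k) \<and>
     verts T = (\<Union>k\<le>N. level T (t k)) \<and>
     (\<forall>k\<le>N. \<forall>v \<in> level T (t k). out_edges T v = b k) \<and>
     level T (t N) = leaves T"

section \<open>Points of the tree\<close>

datatype 'v edge = Bond 'v 'v | Ray 'v nat

text \<open>Points at a vertex are represented by \<open>Vert\<close>, so that the ends of different edges at a common
  vertex are the same point; the other points are \<open>Inner e s\<close> with \<open>s\<close> the distance to the root.\<close>

datatype 'v point = Vert 'v | Inner "'v edge" real

definition edges :: "('v, 'z) rooted_tree_scheme \<Rightarrow> 'v edge set" where
  "edges T = {Bond u v | u v. (u, v) \<in> arcs T} \<union> {Ray v i | v i. v \<in> verts T \<and> i < rays T v}"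

text \<open>Each edge is parametrised by the distance to the root, which is an arc length parameter
  (shifted by the distance of the initial vertex) pointing away from the root.\<close>

fun edge_ivl :: "('v, 'z) rooted_tree_scheme \<Rightarrow> 'v edge \<Rightarrow> real set" where
  "edge_ivl T (Bond u v) = {depth T u .. depth T v}"
| "edge_ivl T (Ray v i) = {depth T v ..}"

fun chart :: "('v, 'z) rooted_tree_scheme \<Rightarrow> 'v edge \<Rightarrow> real \<Rightarrow> 'v point" where
  "chart T (Bond u v) s =
     (if s = depth T u then Vert u else if s = depth T v then Vert v else Inner (Bond u v) s)"
| "chart T (Ray v i) s = (if s = depth T v then Vert v else Inner (Ray v i) s)"

definition points :: "('v, 'z) rooted_tree_scheme \<Rightarrow> 'v point set" where
  "points T = (\<Union>e \<in> edges T. chart T e ` edge_ivl T e)"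

section \<open>Function spaces\<close>

text \<open>A function on the tree is a function on \<open>'v point\<close> that vanishes off \<open>points T\<close>, so that
  it is determined by its values on the tree. Elements of \<open>L2 T\<close> are functions, not classes modulo
  null sets.\<close>

definition tree_fun :: "('v, 'z) rooted_tree_scheme \<Rightarrow> ('v point \<Rightarrow> complex) \<Rightarrow> bool" where
  "tree_fun T f \<longleftrightarrow> (\<forall>x. x \<notin> points T \<longrightarrow> f x = 0)"

definition edge_measure :: "('v, 'z) rooted_tree_scheme \<Rightarrow> 'v edge \<Rightarrow> real measure" where
  "edge_measure T e =
     density lborel (\<lambda>s. ennreal (2 / sqrt pi * exp (- (s\<^sup>2))) * indicator (edge_ivl T e) s)"

definition square_integrable :: "real measure \<Rightarrow> (real \<Rightarrow> complex) \<Rightarrow> bool" where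
  "square_integrable M g \<longleftrightarrow> g \<in> borel_measurable M \<and> integrable M (\<lambda>s. (cmod (g s))\<^sup>2)"

definition L2 :: "('v, 'z) rooted_tree_scheme \<Rightarrow> ('v point \<Rightarrow> complex) set" where
  "L2 T = {f. tree_fun T f \<and>
     (\<forall>e \<in> edges T. square_integrable (edge_measure T e) (f \<circ> chart T e))}"

definition L2_inner ::
  "('v, 'z) rooted_tree_scheme \<Rightarrow> ('v point \<Rightarrow> complex) \<Rightarrow> ('v point \<Rightarrow> complex) \<Rightarrow> complex" where
  "L2_inner T f h =
     (\<Sum>e \<in> edges T. LINT s|edge_measure T e. f (chart T e s) * cnj (h (chart T e s)))"

definition test_functions :: "real set \<Rightarrow> (real \<Rightarrow> real) set" where
  "test_functions J = {\<phi>. \<phi> differentiable_on UNIV \<and> continuous_on UNIV (deriv \<phi>) \<and>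
     (\<exists>K. compact K \<and> K \<subseteq> J \<and> (\<forall>s. s \<notin> K \<longrightarrow> \<phi> s = 0))}"

text \<open>\<open>g\<close> is the weak derivative of \<open>f\<close> on the open interval \<open>J\<close>, tested against compactly supported
  continuously differentiable functions. This is only used for \<open>f\<close>, \<open>g\<close> square integrable with
  respect to the Gaussian measure, so that both are locally integrable.\<close>

definition weak_deriv_on :: "real set \<Rightarrow> (real \<Rightarrow> complex) \<Rightarrow> (real \<Rightarrow> complex) \<Rightarrow> bool" where
  "weak_deriv_on J f g \<longleftrightarrow>
     (\<forall>\<phi> \<in> test_functions J.
        (LINT s:J|lborel. deriv \<phi> s *\<^sub>R f s) = - (LINT s:J|lborel. \<phi> s *\<^sub>R g s))"

definition is_edge_deriv ::
  "('v, 'z) rooted_tree_scheme \<Rightarrow> 'v edge \<Rightarrow> ('v point \<Rightarrow> complex) \<Rightarrow> (real \<Rightarrow> complex) \<Rightarrow> bool" where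
  "is_edge_deriv T e f g \<longleftrightarrow>
     square_integrable (edge_measure T e) g \<and>
     weak_deriv_on (interior (edge_ivl T e)) (f \<circ> chart T e) g"

text \<open>A representative of the weak derivative, which is unique almost everywhere on the edge.\<close>

definition edge_deriv ::
  "('v, 'z) rooted_tree_scheme \<Rightarrow> 'v edge \<Rightarrow> ('v point \<Rightarrow> complex) \<Rightarrow> real \<Rightarrow> complex" where
  "edge_deriv T e f = (SOME g. is_edge_deriv T e f g)"

text \<open>Since the tree is a finite union of closed edges glued at their ends, continuity amounts to
  continuity along each closed edge; agreement at the vertices is built into \<open>'v point\<close>.\<close>

definition tree_continuous ::
  "('v, 'z) rooted_tree_scheme \<Rightarrow> ('v point \<Rightarrow> complex) \<Rightarrow> bool" where
  "tree_continuous T f \<longleftrightarrow> (\<forall>e \<in> edges T. continuous_on (edge_ivl T e) (f \<circ> chart T e))"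

definition H1 :: "('v, 'z) rooted_tree_scheme \<Rightarrow> ('v point \<Rightarrow> complex) set" where
  "H1 T = {f \<in> L2 T. tree_continuous T f \<and> (\<forall>e \<in> edges T. \<exists>g. is_edge_deriv T e f g)}"

definition H1_0 :: "('v, 'z) rooted_tree_scheme \<Rightarrow> ('v point \<Rightarrow> complex) set" where
  "H1_0 T = {f \<in> H1 T. f (Vert (origin T)) = 0}"

section \<open>The Ornstein-Uhlenbeck operators\<close>

definition OU_form ::
  "('v, 'z) rooted_tree_scheme \<Rightarrow> ('v point \<Rightarrow> complex) \<Rightarrow> ('v point \<Rightarrow> complex) \<Rightarrow> complex" where
  "OU_form T f h =
     1 / 2 * (\<Sum>e \<in> edges T. LINT s|edge_measure T e. edge_deriv T e f s * cnj (edge_deriv T e h s))"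

text \<open>The graph of the operator associated with the form on the form domain \<open>D\<close>. It contains
  every representative \<open>g\<close> of the image of \<open>f\<close>.\<close>

definition form_operator ::
  "('v, 'z) rooted_tree_scheme \<Rightarrow> ('v point \<Rightarrow> complex) set
     \<Rightarrow> (('v point \<Rightarrow> complex) \<times> ('v point \<Rightarrow> complex)) set" where
  "form_operator T D =
     {(f, g). f \<in> D \<and> g \<in> L2 T \<and> (\<forall>h \<in> D. OU_form T f h = L2_inner T g h)}"

definition OU_Dirichlet ::
  "('v, 'z) rooted_tree_scheme \<Rightarrow> (('v point \<Rightarrow> complex) \<times> ('v point \<Rightarrow> complex)) set" where
  "OU_Dirichlet T = form_operator T (H1_0 T)"

definition OU_Neumann ::
  "('v, 'z) rooted_tree_scheme \<Rightarrow> (('v point \<Rightarrow> complex) \<times> ('v point \<Rightarrow> complex)) set" where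
  "OU_Neumann T = form_operator T (H1 T)"

section \<open>Eigenvalues counted with multiplicity\<close>

definition fscale :: "complex \<Rightarrow> ('a \<Rightarrow> complex) \<Rightarrow> 'a \<Rightarrow> complex" where
  "fscale c f = (\<lambda>x. c * f x)"

global_interpretation cfun: vector_space "fscale :: complex \<Rightarrow> ('a \<Rightarrow> complex) \<Rightarrow> 'a \<Rightarrow> complex"
  by unfold_locales (auto simp: fscale_def fun_eq_iff algebra_simps)

text \<open>For the operators above, eigenfunctions lie in the form domain, hence are continuous: each
  eigenvector of the operator on the space of classes has exactly one representative here.\<close>

definition eigenspace ::
  "(('a \<Rightarrow> complex) \<times> ('a \<Rightarrow> complex)) set \<Rightarrow> complex \<Rightarrow> ('a \<Rightarrow> complex) set" where
  "eigenspace A c = {f. (f, fscale c f) \<in> A}"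

text \<open>\<open>lam 1 \<le> lam 2 \<le> \<dots>\<close> lists all eigenvalues, each as often as its (finite) multiplicity; the value
  \<open>lam 0\<close> is irrelevant. A number that is not an eigenvalue has an eigenspace of dimension 0.\<close>

definition eigenvalue_enumeration ::
  "(('a \<Rightarrow> complex) \<times> ('a \<Rightarrow> complex)) set \<Rightarrow> (nat \<Rightarrow> real) \<Rightarrow> bool" where
  "eigenvalue_enumeration A lam \<longleftrightarrow>
     (\<forall>i j. 1 \<le> i \<longrightarrow> i \<le> j \<longrightarrow> lam i \<le> lam j) \<and>
     (\<forall>c. finite {n. 1 \<le> n \<and> complex_of_real (lam n) = c} \<and>
          (\<exists>B. finite B \<and> eigenspace A c \<subseteq> cfun.span B) \<and>
          card {n. 1 \<le> n \<and> complex_of_real (lam n) = c} = cfun.dim (eigenspace A c))"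

end

theory Submission
  imports Defs "HOL-Computational_Algebra.Polynomial"
begin

text \<open>The Hermite polynomial \<open>H\<^sub>n\<close> is an eigenfunction of the Ornstein-Uhlenbeck operator with
  eigenvalue \<open>n\<close>, and it has at most \<open>n div 2\<close> positive zeros. Picone's inequality with the comparison
  function \<open>H\<^sub>n(|x|)\<close> bounds \<open>\<integral>|f'|\<^sup>2 - 2n|f|\<^sup>2\<close> on each edge from below by a difference of boundary
  terms, provided \<open>f\<close> vanishes wherever \<open>H\<^sub>n(|x|)\<close> does. If each edge is weighted with the number of
  half-lines beyond it, the boundary terms cancel at every vertex but the root. The weights lie between
  \<open>1\<close> and \<open>m / b\<^sub>0\<close>, so the form dominates \<open>n b\<^sub>0 / m\<close> times the squared norm on the functions
  that vanish at the points whose distance to the root is a zero of \<open>H\<^sub>n\<close>. At most \<open>m\<close> points have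
  a given distance to the root; hence the eigenvalue bounds follow by counting dimensions, with
  \<open>n = 2q + 1\<close> (in the Neumann case with the additional constraint \<open>f(o) = 0\<close>) or \<open>n = 2q\<close>.\<close>

section \<open>Weak derivatives and the fundamental theorem of calculus\<close>

text \<open>Since \<open>H_n(|x|)\<close> depends on the distance alone, it violates the zero-sum
  condition at a branching vertex in general. The weights turn its flux into a conserved flow; the
  price is the ratio of the extreme weights, which is exactly the factor lost in the bound. The
  parity of n decides what happens at the root: for even n the derivative of H_n vanishes at 0, and
  so does the boundary term there; for odd n the polynomial itself vanishes at 0, and the functions
  have to vanish at the root. Either way at most \<open>n div 2 = q\<close> positive zeros remain,
  so \<open>q * m\<close> point conditions suffice. Picone's inequality completes a square with
  \<open>H'/H * gauss\<close>, which solves a Riccati equation but has poles at the zeros of H_n. If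
  g vanishes at such a zero z, then \<open>g(s)^2 = o(|s - z|)\<close>, so the boundary term stays
  continuous and an edge need not be cut there. As functions in the form domain are only weakly
  differentiable, their weak derivatives are first turned into integral representations by explicit
  C^1 test functions.\<close>

lemma has_real_derivative_max_0_power2:
  "((\<lambda>u. (max 0 u)\<^sup>2) has_real_derivative 2 * max 0 u) (at u)" for u :: real
proof (cases "u = 0")
  case True
  have "(\<lambda>h::real. (max 0 h)\<^sup>2 / h) = (\<lambda>h. max 0 h)"
    by (auto simp: fun_eq_iff max_def power2_eq_square)
  moreover have "((\<lambda>h::real. max 0 h) \<longlongrightarrow> max 0 0) (at 0)"
    by (intro tendsto_intros)
  ultimately show ?thesis
    using True by (simp add: DERIV_def)
next
  case False
  then consider "u > 0" | "u < 0" by linarith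
  then show ?thesis
  proof cases
    case 1
    have "((\<lambda>u. u\<^sup>2) has_real_derivative 2 * max 0 u) (at u)"
      using 1 by (auto intro!: derivative_eq_intros)
    then show ?thesis
      by (rule has_field_derivative_transform_within_open[of _ _ _ "{0<..}"]) (use 1 in auto)
  next
    case 2
    have "((\<lambda>u. 0) has_real_derivative 2 * max 0 u) (at u)"
      using 2 by (auto intro!: derivative_eq_intros)
    then show ?thesis
      by (rule has_field_derivative_transform_within_open[of _ _ _ "{..<0}"]) (use 2 in auto)
  qed
qed

text \<open>A quadratic spline with knots 0, 1/2 and 1. Members of \<open>test_functions\<close>
  only have to be C^1, so a primitive of a hat function can replace a smooth mollifier.\<close>

definition smooth_step :: "real \<Rightarrow> real" where
  "smooth_step u = 2 * (max 0 u)\<^sup>2 - 4 * (max 0 (u - 1/2))\<^sup>2 + 2 * (max 0 (u - 1))\<^sup>2"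

text \<open>The hat over [0, 1] of height 2, hence of mass 1; its slopes 4, -4, 0 explain the
  coefficients at the kinks.\<close>

definition tent :: "real \<Rightarrow> real" where
  "tent u = 4 * max 0 u - 8 * max 0 (u - 1/2) + 4 * max 0 (u - 1)"

lemma smooth_step_deriv: "(smooth_step has_real_derivative tent u) (at u)"
proof -
  have *: "((\<lambda>u. k * (max 0 (u - c))\<^sup>2) has_real_derivative k * (2 * max 0 (u - c))) (at u)" for k c
    using DERIV_shift[of "\<lambda>u. (max 0 u)\<^sup>2" "2 * max 0 (u - c)" u "-c"]
      has_real_derivative_max_0_power2[of "u - c"] by (intro DERIV_cmult) simp
  show ?thesis
    using DERIV_add[OF DERIV_diff[OF *[of 2 0] *[of 4 "1/2"]] *[of 2 1]]
    by (simp add: smooth_step_def[abs_def] tent_def)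
qed

lemma smooth_step_eq_0: "u \<le> 0 \<Longrightarrow> smooth_step u = 0"
  by (simp add: smooth_step_def)

lemma smooth_step_eq_1: "1 \<le> u \<Longrightarrow> smooth_step u = 1"
  by (simp add: smooth_step_def power2_eq_square algebra_simps)

lemma tent_eq_0: "u \<le> 0 \<or> 1 \<le> u \<Longrightarrow> tent u = 0"
  by (auto simp: tent_def)

lemma tent_bounds: "0 \<le> tent u" "tent u \<le> 2"
  by (auto simp: tent_def max_def)

lemma continuous_on_tent: "continuous_on A tent"
  unfolding tent_def by (intro continuous_intros)

lemma smooth_step_bounds: "0 \<le> smooth_step u" "smooth_step u \<le> 1"
proof -
  have mono: "smooth_step u \<le> smooth_step v" if "u \<le> v" for u v
    by (rule DERIV_nonneg_imp_nondecreasing[OF that]) (use smooth_step_deriv tent_bounds in blast)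
  show "0 \<le> smooth_step u"
    using mono[of 0 u] smooth_step_eq_0[of u] smooth_step_eq_0[of 0] by (cases "u \<le> 0") auto
  show "smooth_step u \<le> 1"
    using mono[of u 1] smooth_step_eq_1[of u] smooth_step_eq_1[of 1] by (cases "u \<le> 1") auto
qed

lemma integral_tent: "has_bochner_integral lborel tent 1"
proof -
  have "has_bochner_integral lborel (\<lambda>x. tent x * indicator {0..1} x)
      (smooth_step 1 - smooth_step 0)"
    by (rule has_bochner_integral_FTC_Icc_real)
      (use smooth_step_deriv continuous_on_tent[of UNIV] in \<open>auto simp: continuous_on_eq_continuous_at\<close>)
  moreover have "(\<lambda>x. tent x * indicator {0..1} x) = tent"
  proof
    show "tent x * indicator {0..1} x = tent x" for x
      using tent_eq_0[of x] by (cases "x \<in> {0..1}") auto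
  qed
  ultimately show ?thesis
    by (simp add: smooth_step_eq_0 smooth_step_eq_1)
qed

text \<open>A one-sided approximate identity: after \<open>s = c + \<delta> n * u\<close> the weight
  is the fixed function \<open>tent\<close>, and dominated convergence applies. The mass lies to the
  right of \<open>c\<close>, so continuity on \<open>{c..c + d}\<close> is enough.\<close>

lemma tent_approximates_point_evaluation:
  fixes f :: "real \<Rightarrow> complex"
  assumes d: "0 < d" and J: "{c..c + d} \<subseteq> J"
    and cont: "continuous_on {c..c + d} f" and \<delta>: "\<And>n::nat. 0 < \<delta> n" "\<And>n. \<delta> n \<le> d" "\<delta> \<longlonglongrightarrow> 0"
  shows "set_integrable lborel J (\<lambda>s. (tent ((s - c) / \<delta> n) / \<delta> n) *\<^sub>R f s)"
    and "(\<lambda>n. LINT s:J|lborel. (tent ((s - c) / \<delta> n) / \<delta> n) *\<^sub>R f s) \<longlonglongrightarrow> f c"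
proof -
  \<comment> \<open>Cut off to the compact interval, \<open>f\<close> becomes measurable and bounded
    on the whole line, whatever it does elsewhere on \<open>J\<close>.\<close>
  define F where "F s = indicator {c..c + d} s *\<^sub>R f s" for s
  have Fm [measurable]: "F \<in> borel_measurable borel"
    unfolding F_def by (rule borel_measurable_continuous_on_indicator[OF _ cont]) auto
  have tm [measurable]: "tent \<in> borel_measurable borel"
    by (rule borel_measurable_continuous_onI[OF continuous_on_tent])
  obtain B where B: "B \<ge> 0" "\<And>s. s \<in> {c..c + d} \<Longrightarrow> cmod (f s) \<le> B"
  proof -
    have "bounded (f ` {c..c + d})"
      by (intro compact_imp_bounded compact_continuous_image cont) auto
    then obtain B where "\<forall>x\<in>f ` {c..c + d}. cmod x \<le> B" unfolding bounded_iff by blast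
    then show thesis by (intro that[of "max B 0"]) force+
  qed
  have FB: "cmod (F s) \<le> B" for s
    using B by (simp add: F_def indicator_def)
  have eq: "indicator J s *\<^sub>R (tent ((s - c) / \<delta> n) / \<delta> n) *\<^sub>R f s
      = (tent ((s - c) / \<delta> n) / \<delta> n) *\<^sub>R F s" for s n
  proof (cases "s \<in> {c..c + d}")
    case False
    then have "(s - c) / \<delta> n \<le> 0 \<or> 1 \<le> (s - c) / \<delta> n"
      using \<delta>(1,2)[of n] by (auto simp: divide_le_0_iff le_divide_eq)
    then show ?thesis using tent_eq_0 by simp
  qed (use J in \<open>auto simp: F_def indicator_def\<close>)
  have bound: "AE u in lborel. norm (tent u *\<^sub>R F (c + \<delta> n * u)) \<le> B * tent u" for n
    using FB tent_bounds by (intro AE_I2) (simp add: mult.commute[of B] mult_left_mono)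
  have lim: "AE u in lborel. (\<lambda>n. tent u *\<^sub>R F (c + \<delta> n * u)) \<longlonglongrightarrow> tent u *\<^sub>R f c"
  proof (rule AE_I2)
    fix u
    show "(\<lambda>n. tent u *\<^sub>R F (c + \<delta> n * u)) \<longlonglongrightarrow> tent u *\<^sub>R f c"
    proof (cases "u \<in> {0..1}")
      case True
      have in_ivl: "c + \<delta> n * u \<in> {c..c + d}" for n
        using True \<delta>(1,2)[of n] mult_left_le[of u "\<delta> n"] by (auto intro: order_trans[of _ "\<delta> n"])
      have "(\<lambda>n. c + \<delta> n * u) \<longlonglongrightarrow> c + 0 * u"
        by (intro tendsto_intros \<delta>)
      then have "(\<lambda>n. f (c + \<delta> n * u)) \<longlonglongrightarrow> f c"
        using in_ivl d by (intro continuous_on_tendsto_compose[OF cont]) auto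
      moreover have "F (c + \<delta> n * u) = f (c + \<delta> n * u)" for n
        using in_ivl[of n] by (simp add: F_def)
      ultimately show ?thesis by (intro tendsto_intros) simp
    qed (use tent_eq_0 in auto)
  qed
  have int_tent: "integrable lborel tent" "integral\<^sup>L lborel tent = 1"
    using integral_tent by (auto simp: has_bochner_integral_iff)
  have int: "integrable lborel (\<lambda>u. tent u *\<^sub>R F (c + \<delta> n * u))" for n
    by (rule Bochner_Integration.integrable_bound[of _ "\<lambda>u. B * tent u"])
      (use bound[of n] int_tent(1) B(1) tent_bounds in \<open>auto simp: abs_mult\<close>)
  have "(\<lambda>n. LINT u|lborel. tent u *\<^sub>R F (c + \<delta> n * u)) \<longlonglongrightarrow> (LINT u|lborel. tent u *\<^sub>R f c)"
    by (rule integral_dominated_convergence[where w = "\<lambda>u. B * tent u"])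
      (use lim bound int_tent(1) in auto)
  moreover have "(LINT s:J|lborel. (tent ((s - c) / \<delta> n) / \<delta> n) *\<^sub>R f s)
      = (LINT u|lborel. tent u *\<^sub>R F (c + \<delta> n * u))" for n
    unfolding set_lebesgue_integral_def eq
  proof -
    have "(LINT s|lborel. (tent ((s - c) / \<delta> n) / \<delta> n) *\<^sub>R F s)
        = \<delta> n *\<^sub>R (LINT u|lborel. (1 / \<delta> n) *\<^sub>R (tent u *\<^sub>R F (c + \<delta> n * u)))"
      using \<delta>(1)[of n] by (subst lborel_integral_real_affine[where c = "\<delta> n" and t = c]) simp_all
    then show "(LINT s|lborel. (tent ((s - c) / \<delta> n) / \<delta> n) *\<^sub>R F s)
        = (LINT u|lborel. tent u *\<^sub>R F (c + \<delta> n * u))"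
      unfolding integral_scaleR_right using \<delta>(1)[of n] by simp
  qed
  moreover have "(LINT u|lborel. tent u *\<^sub>R f c) = f c"
    using int_tent by simp
  ultimately show "(\<lambda>n. LINT s:J|lborel. (tent ((s - c) / \<delta> n) / \<delta> n) *\<^sub>R f s) \<longlonglongrightarrow> f c"
    by simp
  have "integrable lborel (\<lambda>u. (tent ((c + \<delta> n * u - c) / \<delta> n) / \<delta> n) *\<^sub>R F (c + \<delta> n * u))"
    using integrable_scaleR_right[of "1 / \<delta> n", OF int[of n]] \<delta>(1)[of n] by simp
  then show "set_integrable lborel J (\<lambda>s. (tent ((s - c) / \<delta> n) / \<delta> n) *\<^sub>R f s)"
    unfolding set_integrable_def eq
    by (subst (asm) lborel_integrable_real_affine_iff) (use \<delta>(1)[of n] in auto)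
qed

text \<open>The test functions rise to 1 just after \<open>x\<close> and fall back to 0 just after
  \<open>y\<close>. Their derivatives tend to evaluation at \<open>x\<close> minus evaluation at
  \<open>y\<close>, while they themselves tend to the indicator of the interval in between.\<close>

lemma weak_deriv_on_imp_FTC:
  fixes f g :: "real \<Rightarrow> complex"
  assumes wd: "weak_deriv_on J f g" and J: "open J" "{x..y} \<subseteq> J" and xy: "x < y"
    and cont: "continuous_on J f"
    and int: "\<And>c d. {c..d} \<subseteq> J \<Longrightarrow> set_integrable lborel {c..d} g"
  shows "f y - f x = (LINT s:{x..y}|lborel. g s)"
proof -
  \<comment> \<open>Room to the right of \<open>y\<close>: the descending ramps end only at
    \<open>y + \<delta> n\<close>.\<close>
  obtain d where d: "d > 0" "{x..y + d} \<subseteq> J"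
  proof -
    from J xy obtain e where e: "e > 0" "cball y e \<subseteq> J"
      using open_contains_cball by (metis atLeastAtMost_iff less_imp_le order_refl subsetD)
    have "{x..y + e} \<subseteq> {x..y} \<union> cball y e"
      by (auto simp: cball_def dist_real_def)
    with e J show thesis by (intro that[of e]) auto
  qed
  define \<delta> where "\<delta> n = d / real (Suc n)" for n
  have \<delta>: "0 < \<delta> n" "\<delta> n \<le> d" for n
    using d by (auto simp: \<delta>_def field_simps)
  have \<delta>0: "\<delta> \<longlonglongrightarrow> 0"
    unfolding \<delta>_def using tendsto_mult_right_zero[OF LIMSEQ_inverse_real_of_nat, of d]
    by (simp add: divide_inverse mult.commute)
  define \<phi> where "\<phi> n s = smooth_step ((s - x) / \<delta> n) - smooth_step ((s - y) / \<delta> n)" for n s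
  define \<psi> where "\<psi> c n s = tent ((s - c) / \<delta> n) / \<delta> n" for c n s
  have step_deriv: "((\<lambda>s. smooth_step ((s - c) / \<delta> n)) has_real_derivative \<psi> c n s) (at s)" for c n s
  proof -
    have "((\<lambda>s. (s - c) / \<delta> n) has_real_derivative 1 / \<delta> n) (at s)"
      using \<delta>(1)[of n] by (auto intro!: derivative_eq_intros)
    from DERIV_chain2[OF smooth_step_deriv this] show ?thesis
      by (simp add: \<psi>_def)
  qed
  have \<phi>_deriv: "(\<phi> n has_real_derivative \<psi> x n s - \<psi> y n s) (at s)" for n s
    unfolding \<phi>_def by (intro derivative_intros step_deriv)
  then have deriv_\<phi>: "deriv (\<phi> n) = (\<lambda>s. \<psi> x n s - \<psi> y n s)" for n
    by (intro ext DERIV_imp_deriv)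
  have \<phi>_0: "\<phi> n s = 0" if "s \<notin> {x..y + \<delta> n}" for n s
  proof (cases "s < x")
    case True
    then show ?thesis
      unfolding \<phi>_def using \<delta>(1)[of n] xy
      by (subst (1 2) smooth_step_eq_0) (auto simp: divide_le_0_iff)
  next
    case False
    then show ?thesis
      unfolding \<phi>_def using \<delta>(1)[of n] xy that
      by (subst (1 2) smooth_step_eq_1) (auto simp: le_divide_eq)
  qed
  have test: "\<phi> n \<in> test_functions J" for n
  proof -
    have "continuous_on UNIV (\<lambda>s. \<psi> x n s - \<psi> y n s)"
      unfolding \<psi>_def using \<delta>(1)[of n]
      by (intro continuous_intros continuous_on_compose2[OF continuous_on_tent[of UNIV]]) auto
    moreover have "\<phi> n differentiable_on UNIV"
      using \<phi>_deriv by (intro differentiable_at_imp_differentiable_on)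
        (metis real_differentiable_def)
    moreover have "{x..y + \<delta> n} \<subseteq> J" using \<delta>(2)[of n] d(2) by auto
    ultimately show ?thesis
      unfolding test_functions_def deriv_\<phi> using \<phi>_0 by (auto simp: deriv_\<phi> intro!: exI[of _ "{x..y + \<delta> n}"])
  qed
  have cx: "{x..x + d} \<subseteq> J" and cy: "{y..y + d} \<subseteq> J"
    using d xy by auto
  note px = tent_approximates_point_evaluation[OF d(1) cx continuous_on_subset[OF cont cx] \<delta> \<delta>0]
    and py = tent_approximates_point_evaluation[OF d(1) cy continuous_on_subset[OF cont cy] \<delta> \<delta>0]
  have "(LINT s:J|lborel. deriv (\<phi> n) s *\<^sub>R f s)
      = (LINT s:J|lborel. \<psi> x n s *\<^sub>R f s) - (LINT s:J|lborel. \<psi> y n s *\<^sub>R f s)" for n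
    unfolding deriv_\<phi> \<psi>_def scaleR_left_diff_distrib
    by (rule set_integral_diff(2)) (rule px py)+
  then have lim1: "(\<lambda>n. LINT s:J|lborel. deriv (\<phi> n) s *\<^sub>R f s) \<longlonglongrightarrow> f x - f y"
    using tendsto_diff[OF px(2) py(2)] by (simp add: \<psi>_def)
  have g_int: "set_integrable lborel {x..y + d} g" by (rule int[OF d(2)])
  have smm [measurable]: "smooth_step \<in> borel_measurable borel"
    using smooth_step_deriv by (intro borel_measurable_continuous_onI)
      (meson DERIV_isCont continuous_at_imp_continuous_on)
  have \<phi>b: "\<bar>\<phi> n s\<bar> \<le> 1" for n s
    using smooth_step_bounds[of "(s - x) / \<delta> n"] smooth_step_bounds[of "(s - y) / \<delta> n"]
    by (auto simp: \<phi>_def)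
  have eq: "indicator J s *\<^sub>R \<phi> n s *\<^sub>R g s = \<phi> n s *\<^sub>R (indicator {x..y + d} s *\<^sub>R g s)" for n s
    using \<phi>_0[of s n] \<delta>(2)[of n] d(2) by (cases "s \<in> {x..y + d}") (auto simp: indicator_def)
  have limstep: "(\<lambda>n. smooth_step ((s - c) / \<delta> n)) \<longlonglongrightarrow> indicator {c<..} s" for s c
  proof (cases "s \<le> c")
    case True
    then show ?thesis using \<delta> smooth_step_eq_0 by (simp add: divide_le_0_iff less_imp_le)
  next
    case False
    then have "eventually (\<lambda>n. \<delta> n < s - c) sequentially"
      using \<delta>0 by (intro order_tendstoD(2)) auto
    then have "eventually (\<lambda>n. smooth_step ((s - c) / \<delta> n) = indicator {c<..} s) sequentially"
      by eventually_elim (use False \<delta> in \<open>auto simp: le_divide_eq intro!: smooth_step_eq_1\<close>)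
    then show ?thesis by (rule tendsto_eventually)
  qed
  have "(\<lambda>n. LINT s|lborel. \<phi> n s *\<^sub>R (indicator {x..y + d} s *\<^sub>R g s))
      \<longlonglongrightarrow> (LINT s|lborel. (indicator {x<..} s - indicator {y<..} s) *\<^sub>R (indicator {x..y + d} s *\<^sub>R g s))"
  proof (rule integral_dominated_convergence[where w = "\<lambda>s. norm (indicator {x..y + d} s *\<^sub>R g s)"])
    have gm: "(\<lambda>s. indicator {x..y + d} s *\<^sub>R g s) \<in> borel_measurable lborel"
      using g_int unfolding set_integrable_def by (rule borel_measurable_integrable)
    show "(\<lambda>s. \<phi> n s *\<^sub>R (indicator {x..y + d} s *\<^sub>R g s)) \<in> borel_measurable lborel" for n
      unfolding \<phi>_def using gm by measurable
    show "(\<lambda>s. (indicator {x<..} s - indicator {y<..} s) *\<^sub>R (indicator {x..y + d} s *\<^sub>R g s))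
        \<in> borel_measurable lborel"
      using gm by measurable
    show "integrable lborel (\<lambda>s. norm (indicator {x..y + d} s *\<^sub>R g s))"
      using g_int unfolding set_integrable_def by (rule integrable_norm)
    show "AE s in lborel. (\<lambda>n. \<phi> n s *\<^sub>R (indicator {x..y + d} s *\<^sub>R g s))
        \<longlonglongrightarrow> (indicator {x<..} s - indicator {y<..} s) *\<^sub>R (indicator {x..y + d} s *\<^sub>R g s)"
      unfolding \<phi>_def by (intro AE_I2 tendsto_intros limstep)
    show "AE s in lborel. norm (\<phi> n s *\<^sub>R (indicator {x..y + d} s *\<^sub>R g s))
        \<le> norm (indicator {x..y + d} s *\<^sub>R g s)" for n
      using \<phi>b[of n] by (intro AE_I2, subst norm_scaleR) (simp only: mult_left_le_one_le abs_ge_zero norm_ge_zero real_norm_def)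
  qed
  moreover have "(LINT s|lborel. (indicator {x<..} s - indicator {y<..} s) *\<^sub>R (indicator {x..y + d} s *\<^sub>R g s))
      = (LINT s:{x..y}|lborel. g s)"
    unfolding set_lebesgue_integral_def
  proof (rule integral_cong_AE)
    show "(\<lambda>s. indicator {x..y} s *\<^sub>R g s) \<in> borel_measurable lborel"
      using int[OF J(2)] unfolding set_integrable_def by (rule borel_measurable_integrable)
    show "(\<lambda>s. (indicator {x<..} s - indicator {y<..} s) *\<^sub>R indicator {x..y + d} s *\<^sub>R g s)
        \<in> borel_measurable lborel"
      using borel_measurable_integrable[OF g_int[unfolded set_integrable_def]] by measurable
    \<comment> \<open>The limit is the indicator of the half-open interval, which misses only the
      point \<open>x\<close>.\<close>
    show "AE s in lborel. (indicator {x<..} s - indicator {y<..} s) *\<^sub>R indicator {x..y + d} s *\<^sub>R g s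
        = indicator {x..y} s *\<^sub>R g s"
      using AE_lborel_singleton[of x]
      by eventually_elim (use d(1) xy in \<open>auto simp: indicator_def\<close>)
  qed
  ultimately have lim2: "(\<lambda>n. LINT s:J|lborel. \<phi> n s *\<^sub>R g s) \<longlonglongrightarrow> (LINT s:{x..y}|lborel. g s)"
    unfolding set_lebesgue_integral_def eq by simp
  have "(LINT s:J|lborel. deriv (\<phi> n) s *\<^sub>R f s) = - (LINT s:J|lborel. \<phi> n s *\<^sub>R g s)" for n
    using wd test unfolding weak_deriv_on_def by blast
  then have "(\<lambda>n. LINT s:J|lborel. deriv (\<phi> n) s *\<^sub>R f s) \<longlonglongrightarrow> - (LINT s:{x..y}|lborel. g s)"
    using tendsto_minus[OF lim2] by simp
  from LIMSEQ_unique[OF lim1 this] show ?thesis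
    by (simp add: algebra_simps minus_equation_iff)
qed

section \<open>Absolutely continuous functions\<close>

text \<open>Absolute continuity in integral form, \<open>f\<close> being the density of
  \<open>F\<close>; this avoids differentiation almost everywhere. Integrability is Lebesgue's,
  while the value is a gauge integral, which gives access to the calculus on intervals.\<close>

definition primitive_on :: "real \<Rightarrow> real \<Rightarrow> (real \<Rightarrow> real) \<Rightarrow> (real \<Rightarrow> real) \<Rightarrow> bool" where
  "primitive_on a b F f \<longleftrightarrow> set_integrable lborel {a..b} f \<and>
     (\<forall>x\<in>{a..b}. F x - F a = integral {a..x} f)"

lemma primitive_on_D:
  assumes "primitive_on a b F f" "a \<le> x" "x \<le> y" "y \<le> b"
  shows "set_integrable lborel {x..y} f" "f integrable_on {x..y}" "F y - F x = integral {x..y} f"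
proof -
  have f: "set_integrable lborel {a..b} f" and eq: "\<And>x. x \<in> {a..b} \<Longrightarrow> F x - F a = integral {a..x} f"
    using assms(1) unfolding primitive_on_def by blast+
  have *: "set_integrable lborel {c..d} f" if "a \<le> c" "d \<le> b" for c d
    by (rule set_integrable_subset[OF f]) (use that in auto)
  show "set_integrable lborel {x..y} f"
    by (rule *) (use assms(2-4) in auto)
  then show "f integrable_on {x..y}"
    by (rule set_borel_integral_eq_integral)
  have "f integrable_on {a..y}"
    by (intro set_borel_integral_eq_integral(1) *) (use assms(2-4) in auto)
  then have "integral {a..x} f + integral {x..y} f = integral {a..y} f"
    by (rule Henstock_Kurzweil_Integration.integral_combine[OF assms(2,3)])
  moreover have "F x - F a = integral {a..x} f" "F y - F a = integral {a..y} f"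
    by (rule eq, use assms(2-4) in auto)+
  ultimately show "F y - F x = integral {x..y} f"
    by linarith
qed

lemma primitive_on_subset:
  assumes "primitive_on a b F f" "a \<le> c" "d \<le> b"
  shows "primitive_on c d F f"
proof (cases "c \<le> d")
  case True
  then show ?thesis
    unfolding primitive_on_def[of c d] using assms(2,3)
    by (intro conjI ballI primitive_on_D[OF assms(1)]) auto
next
  case False
  then show ?thesis by (simp add: primitive_on_def set_integrable_def)
qed

lemma primitive_on_continuous:
  assumes "primitive_on a b F f"
  shows "continuous_on {a..b} F"
proof -
  have "f integrable_on {a..b}"
    using assms unfolding primitive_on_def by (blast intro: set_borel_integral_eq_integral)
  then have "continuous_on {a..b} (\<lambda>x. F a + integral {a..x} f)"
    by (intro continuous_intros indefinite_integral_continuous_1)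
  moreover have "F a + integral {a..x} f = F x" if "x \<in> {a..b}" for x
    using assms that unfolding primitive_on_def by (metis add.commute diff_add_cancel)
  ultimately show ?thesis
    by (rule continuous_on_eq)
qed

lemma primitive_on_C1:
  assumes "\<And>x. x \<in> {a..b} \<Longrightarrow> (F has_real_derivative f x) (at x)" and "continuous_on {a..b} f"
  shows "primitive_on a b F f"
  unfolding primitive_on_def
proof (intro conjI ballI)
  show "set_integrable lborel {a..b} f"
    by (rule borel_integrable_atLeastAtMost'[OF assms(2)])
  show "F x - F a = integral {a..x} f" if x: "x \<in> {a..b}" for x
  proof -
    have "(f has_integral (F x - F a)) {a..x}"
      using x assms(1) by (intro fundamental_theorem_of_calculus)
        (auto simp flip: has_real_derivative_iff_has_vector_derivative
          intro: has_field_derivative_at_within)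
    then show ?thesis by (simp add: integral_unique)
  qed
qed

lemma set_integrable_mult_continuous:
  fixes f g :: "real \<Rightarrow> real"
  assumes "set_integrable lborel {a..b} f" "continuous_on {a..b} g"
  shows "set_integrable lborel {a..b} (\<lambda>x. f x * g x)"
proof -
  have "bounded (g ` {a..b})"
    by (intro compact_imp_bounded compact_continuous_image assms) auto
  then obtain B where "\<forall>x\<in>g ` {a..b}. norm x \<le> B"
    unfolding bounded_iff by blast
  then have B: "\<bar>g x\<bar> \<le> B" if "x \<in> {a..b}" for x
    using that by (simp add: real_norm_def)
  have f: "integrable lborel (\<lambda>x. indicator {a..b} x *\<^sub>R f x)"
    using assms(1) unfolding set_integrable_def .
  have g: "(\<lambda>x. indicator {a..b} x *\<^sub>R g x) \<in> borel_measurable borel"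
    by (rule borel_measurable_continuous_on_indicator[OF _ assms(2)]) auto
  have "integrable lborel (\<lambda>x. (indicator {a..b} x *\<^sub>R f x) * (indicator {a..b} x *\<^sub>R g x))"
  proof (rule Bochner_Integration.integrable_bound[OF integrable_mult_right[OF f, of "B"]])
    show "(\<lambda>x. indicat_real {a..b} x *\<^sub>R f x * (indicat_real {a..b} x *\<^sub>R g x)) \<in> borel_measurable lborel"
      using borel_measurable_integrable[OF f] g by simp
    show "AE x in lborel. norm (indicat_real {a..b} x *\<^sub>R f x * (indicat_real {a..b} x *\<^sub>R g x))
       \<le> norm (B * (indicat_real {a..b} x *\<^sub>R f x))"
    proof (rule AE_I2)
      fix x show "norm (indicat_real {a..b} x *\<^sub>R f x * (indicat_real {a..b} x *\<^sub>R g x))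
       \<le> norm (B * (indicat_real {a..b} x *\<^sub>R f x))"
      proof (cases "x \<in> {a..b}")
        case True
        have "\<bar>f x\<bar> * \<bar>g x\<bar> \<le> \<bar>B\<bar> * \<bar>f x\<bar>"
          using B[OF True] by (simp add: mult.commute[of "\<bar>f x\<bar>"] mult_right_mono)
        then show ?thesis using True by (simp add: abs_mult)
      qed simp
    qed
  qed
  moreover have "(\<lambda>x. (indicator {a..b} x *\<^sub>R f x) * (indicator {a..b} x *\<^sub>R g x))
     = (\<lambda>x. indicator {a..b} x *\<^sub>R (f x * g x))"
    by (auto simp: indicator_def)
  ultimately show ?thesis unfolding set_integrable_def by simp
qed

text \<open>Fubini on the square, which the diagonal cuts into two triangles.\<close>

lemma primitive_on_integration_by_parts:
  assumes F: "primitive_on a b F f" and G: "primitive_on a b G g" and ab: "a \<le> b"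
  shows "integral {a..b} (\<lambda>s. f s * G s + F s * g s) = F b * G b - F a * G a"
proof -
  define K where "K s = indicator {a..b} s *\<^sub>R f s" for s
  define L where "L s = indicator {a..b} s *\<^sub>R g s" for s
  have K: "integrable lborel K" and L: "integrable lborel L"
    using F G unfolding primitive_on_def K_def L_def set_integrable_def by auto
  have Km [measurable]: "K \<in> borel_measurable borel" and Lm [measurable]: "L \<in> borel_measurable borel"
    using K L by auto
  have triangle: "(LINT s|lborel. (if s \<le> x then 1 else 0) * (indicator {a..b} s *\<^sub>R h s)) = H x - H a"
    if "primitive_on a b H h" "x \<in> {a..b}" for H h :: "real \<Rightarrow> real" and x
  proof -
    have *: "set_integrable lborel {a..x} h" "H x - H a = integral {a..x} h"
      using that primitive_on_D[OF that(1), of a x] by auto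
    have "(LINT s|lborel. (if s \<le> x then 1 else 0) * (indicator {a..b} s *\<^sub>R h s)) = (LINT s:{a..x}|lborel. h s)"
      unfolding set_lebesgue_integral_def
      by (rule Bochner_Integration.integral_cong) (use that(2) in \<open>auto simp: indicator_def\<close>)
    with * show ?thesis using set_borel_integral_eq_integral(2)[OF *(1)] by simp
  qed
  have KL: "integrable (lborel \<Otimes>\<^sub>M lborel) (\<lambda>(x, y). K x * L y)"
  proof (rule lborel_pair.Fubini_integrable)
    show "(\<lambda>(x, y). K x * L y) \<in> borel_measurable (lborel \<Otimes>\<^sub>M lborel)" by measurable
    show "integrable lborel (\<lambda>x. LINT y|lborel. norm (case (x, y) of (x, y) \<Rightarrow> K x * L y))"
      using K L by (simp add: abs_mult)
    show "AE x in lborel. integrable lborel (\<lambda>y. case (x, y) of (x, y) \<Rightarrow> K x * L y)"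
      using L by simp
  qed
  have P: "integrable (lborel \<Otimes>\<^sub>M lborel) (\<lambda>(x, y). (if y \<le> x then 1 else 0) * (K x * L y))"
    by (rule Bochner_Integration.integrable_bound[OF KL]) (auto simp: indicator_def)
  have Q: "integrable (lborel \<Otimes>\<^sub>M lborel) (\<lambda>(x, y). (1 - (if y \<le> x then 1 else 0)) * (K x * L y))"
    by (rule Bochner_Integration.integrable_bound[OF KL]) (auto simp: indicator_def)
  have "(LINT y|lborel. (if y \<le> x then 1 else 0) * (K x * L y)) = K x * (G x - G a)" for x
  proof (cases "x \<in> {a..b}")
    case True
    have "(LINT y|lborel. (if y \<le> x then 1 else 0) * (K x * L y)) = (LINT y|lborel. K x * ((if y \<le> x then 1 else 0) * L y))"
      by (simp add: mult_ac)
    also have "\<dots> = K x * (G x - G a)"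
      using triangle[OF G True] unfolding L_def by simp
    finally show ?thesis .
  qed (simp add: K_def)
  then have intP: "(LINT x|lborel. LINT y|lborel. (if y \<le> x then 1 else 0) * (K x * L y))
      = (LINT x|lborel. K x * (G x - G a))" by simp
  \<comment> \<open>On this triangle \<open>x\<close> is integrated first. Replacing
    \<open>x < y\<close> by \<open>x \<le> y\<close> costs a null set and makes the inner integral
    an increment of \<open>F\<close>.\<close>
  have "(LINT x|lborel. (1 - (if y \<le> x then 1 else 0)) * (K x * L y)) = L y * (F y - F a)" for y
  proof (cases "y \<in> {a..b}")
    case True
    have "(LINT x|lborel. (1 - (if y \<le> x then 1 else 0)) * (K x * L y)) = (LINT x|lborel. L y * ((if x \<le> y then 1 else 0) * K x))"
    proof (rule integral_cong_AE)
      show "AE x in lborel. (1 - (if y \<le> x then 1 else 0)) * (K x * L y) = L y * ((if x \<le> y then 1 else 0) * K x)"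
        using AE_lborel_singleton[of y] by eventually_elim (auto simp: indicator_def)
    qed measurable
    also have "\<dots> = L y * (F y - F a)"
      using triangle[OF F True] unfolding K_def by simp
    finally show ?thesis .
  qed (simp add: L_def)
  then have intQ: "(LINT y|lborel. LINT x|lborel. (1 - (if y \<le> x then 1 else 0)) * (K x * L y))
      = (LINT y|lborel. L y * (F y - F a))" by simp
  have "integral\<^sup>L (lborel \<Otimes>\<^sub>M lborel) (\<lambda>(x, y). K x * L y)
      = integral\<^sup>L (lborel \<Otimes>\<^sub>M lborel) (\<lambda>(x, y). (if y \<le> x then 1 else 0) * (K x * L y))
      + integral\<^sup>L (lborel \<Otimes>\<^sub>M lborel) (\<lambda>(x, y). (1 - (if y \<le> x then 1 else 0)) * (K x * L y))"
    by (subst Bochner_Integration.integral_add[OF P Q, symmetric])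
      (auto intro!: Bochner_Integration.integral_cong simp: algebra_simps)
  also have "integral\<^sup>L (lborel \<Otimes>\<^sub>M lborel) (\<lambda>(x, y). (if y \<le> x then 1 else 0) * (K x * L y))
      = (LINT x|lborel. K x * (G x - G a))"
    using lborel_pair.integral_fst'[OF P] intP by simp
  also have "integral\<^sup>L (lborel \<Otimes>\<^sub>M lborel) (\<lambda>(x, y). (1 - (if y \<le> x then 1 else 0)) * (K x * L y))
      = (LINT y|lborel. L y * (F y - F a))"
    using lborel_pair.integral_snd[OF Q] intQ by simp
  also have "integral\<^sup>L (lborel \<Otimes>\<^sub>M lborel) (\<lambda>(x, y). K x * L y)
      = (LINT x|lborel. K x) * (LINT y|lborel. L y)"
    using lborel_pair.integral_fst'[OF KL] by simp
  also have "(LINT x|lborel. K x) = F b - F a"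
    using primitive_on_D[OF F, of a b] ab set_borel_integral_eq_integral(2)[of "{a..b}" f]
    by (simp add: K_def[abs_def] set_lebesgue_integral_def)
  also have "(LINT x|lborel. L x) = G b - G a"
    using primitive_on_D[OF G, of a b] ab set_borel_integral_eq_integral(2)[of "{a..b}" g]
    by (simp add: L_def[abs_def] set_lebesgue_integral_def)
  finally have main: "(F b - F a) * (G b - G a)
      = (LINT x|lborel. K x * (G x - G a)) + (LINT y|lborel. L y * (F y - F a))" .
  have conv: "(LINT x|lborel. indicator {a..b} x *\<^sub>R h x * (H x - H a))
      = integral {a..b} (\<lambda>s. h s * H s) - integral {a..b} h * H a"
    if h: "set_integrable lborel {a..b} h" and H: "continuous_on {a..b} H" for h H :: "real \<Rightarrow> real"
  proof -
    have "(LINT x|lborel. indicator {a..b} x *\<^sub>R h x * (H x - H a)) = (LINT s:{a..b}|lborel. h s * (H s - H a))"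
      unfolding set_lebesgue_integral_def by (simp add: mult.assoc)
    also have "\<dots> = integral {a..b} (\<lambda>s. h s * (H s - H a))"
      by (intro set_borel_integral_eq_integral set_integrable_mult_continuous h continuous_intros H)
    also have "\<dots> = integral {a..b} (\<lambda>s. h s * H s - h s * H a)"
      by (simp add: algebra_simps)
    also have "\<dots> = integral {a..b} (\<lambda>s. h s * H s) - integral {a..b} (\<lambda>s. h s * H a)"
      by (intro Henstock_Kurzweil_Integration.integral_diff
          set_borel_integral_eq_integral set_integrable_mult_continuous h continuous_intros H)
    finally show ?thesis by simp
  qed
  have f: "set_integrable lborel {a..b} f" and g: "set_integrable lborel {a..b} g"
    using F G unfolding primitive_on_def by auto
  note Fc = primitive_on_continuous[OF F] and Gc = primitive_on_continuous[OF G]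
  have sum: "integral {a..b} (\<lambda>s. f s * G s + F s * g s)
      = integral {a..b} (\<lambda>s. f s * G s) + integral {a..b} (\<lambda>s. g s * F s)"
    unfolding mult.commute[of "F _"]
    by (rule Henstock_Kurzweil_Integration.integral_add;
        rule set_borel_integral_eq_integral(1)[OF set_integrable_mult_continuous])
      (fact f g Fc Gc)+
  have fa: "integral {a..b} f = F b - F a" and ga: "integral {a..b} g = G b - G a"
    using primitive_on_D(3)[OF F order_refl ab order_refl] primitive_on_D(3)[OF G order_refl ab order_refl]
    by simp_all
  have "integral {a..b} (\<lambda>s. f s * G s + F s * g s)
      = (F b - F a) * (G b - G a) + (F b - F a) * G a + (G b - G a) * F a"
    using main conv[OF f Gc, unfolded fa] conv[OF g Fc, unfolded ga] sum unfolding K_def L_def by linarith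
  also have "\<dots> = F b * G b - F a * G a"
    by (simp add: algebra_simps)
  finally show ?thesis .
qed

lemma primitive_on_mult:
  assumes F: "primitive_on a b F f" and G: "primitive_on a b G g"
  shows "primitive_on a b (\<lambda>s. F s * G s) (\<lambda>s. f s * G s + F s * g s)"
  unfolding primitive_on_def
proof (intro conjI ballI)
  have "set_integrable lborel {a..b} (\<lambda>s. f s * G s)" "set_integrable lborel {a..b} (\<lambda>s. g s * F s)"
    using F G primitive_on_continuous[OF F] primitive_on_continuous[OF G]
    unfolding primitive_on_def by (auto intro: set_integrable_mult_continuous)
  then show "set_integrable lborel {a..b} (\<lambda>s. f s * G s + F s * g s)"
    by (simp add: mult.commute[of "F _"] set_integral_add(1))
  show "F x * G x - F a * G a = integral {a..x} (\<lambda>s. f s * G s + F s * g s)" if "x \<in> {a..b}" for x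
    using that by (intro primitive_on_integration_by_parts[symmetric]
        primitive_on_subset[OF F] primitive_on_subset[OF G]) auto
qed

text \<open>Cauchy-Schwarz against the constant 1: with \<open>c\<close> the mean of
  \<open>f\<close>, the integral of \<open>(f - c)^2\<close> is nonnegative.\<close>

lemma integral_power2_le:
  fixes f :: "real \<Rightarrow> real"
  assumes "f integrable_on {a..b}" "(\<lambda>s. (f s)\<^sup>2) integrable_on {a..b}" "a \<le> b"
  shows "(integral {a..b} f)\<^sup>2 \<le> (b - a) * integral {a..b} (\<lambda>s. (f s)\<^sup>2)"
proof (cases "a = b")
  case False
  define c where "c = integral {a..b} f / (b - a)"
  have "((\<lambda>s. (f s)\<^sup>2 - 2 * c * f s + c\<^sup>2) has_integral
      integral {a..b} (\<lambda>s. (f s)\<^sup>2) - 2 * c * integral {a..b} f + c\<^sup>2 * (b - a)) {a..b}"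
    using assms has_integral_const_real[of "c\<^sup>2" a b]
    by (intro has_integral_add has_integral_diff has_integral_mult_right integrable_integral)
      (auto simp: mult.commute)
  moreover have "0 \<le> (f s)\<^sup>2 - 2 * c * f s + c\<^sup>2" for s
    using zero_le_power2[of "f s - c"] by (simp add: power2_diff algebra_simps)
  ultimately have "0 \<le> integral {a..b} (\<lambda>s. (f s)\<^sup>2) - 2 * c * integral {a..b} f + c\<^sup>2 * (b - a)"
    by (rule has_integral_nonneg)
  also have "\<dots> = integral {a..b} (\<lambda>s. (f s)\<^sup>2) - (integral {a..b} f)\<^sup>2 / (b - a)"
  proof -
    have "c * (b - a) = integral {a..b} f" using False by (simp add: c_def)
    then have "c\<^sup>2 * (b - a) = c * integral {a..b} f" "(integral {a..b} f)\<^sup>2 / (b - a) = c * integral {a..b} f"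
      using False by (simp_all add: power2_eq_square mult.assoc c_def)
    then show ?thesis by simp
  qed
  finally show ?thesis
    using False assms(3) by (simp add: field_simps)
qed simp

section \<open>Hermite polynomials and Picone's inequality\<close>

text \<open>The physicists' normalisation. The recursion by \<open>2 x - d/dx\<close> is preferred
  to the three-term one because differentiating it yields both the derivative rule and the
  differential equation.\<close>

primrec hermite :: "nat \<Rightarrow> real poly" where
  "hermite 0 = 1"
| "hermite (Suc n) = [:0, 2:] * hermite n - pderiv (hermite n)"

text \<open>The differentiated recursion contains \<open>2 x p - p'\<close> with \<open>p\<close>
  the derivative of \<open>hermite (Suc n)\<close>. By induction \<open>p\<close> is a multiple of
  \<open>hermite n\<close>, so the recursion itself evaluates this expression.\<close>

lemma pderiv_hermite_Suc: "pderiv (hermite (Suc n)) = smult (2 * real (Suc n)) (hermite n)"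
proof (induction n)
  case 0
  then show ?case by (simp add: pderiv_pCons pderiv_mult)
next
  case (Suc n)
  have "pderiv (hermite (Suc (Suc n)))
      = smult 2 (hermite (Suc n)) + ([:0, 2:] * pderiv (hermite (Suc n)) - pderiv (pderiv (hermite (Suc n))))"
    by (simp add: hermite.simps(2)[of "Suc n"] pderiv_diff pderiv_mult pderiv_pCons pderiv_smult del: hermite.simps)
  also have "[:0, 2:] * pderiv (hermite (Suc n)) - pderiv (pderiv (hermite (Suc n)))
      = smult (2 * real (Suc n)) (hermite (Suc n))"
    unfolding Suc.IH by (simp add: pderiv_smult smult_diff_right algebra_simps)
  finally have "pderiv (hermite (Suc (Suc n))) = smult (2 + 2 * real (Suc n)) (hermite (Suc n))"
    by (simp only: smult_add_left)
  then show ?case by (simp only: of_nat_Suc distrib_left mult_1_right add_ac)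
qed

text \<open>The derivative rule is compared with the differentiated recursion for
  \<open>hermite (Suc n)\<close>. Division by -2 gives \<open>- H''/2 + x H' = n H\<close>, the
  eigenvalue equation of the Ornstein-Uhlenbeck operator.\<close>

lemma hermite_ode:
  "pderiv (pderiv (hermite n)) = [:0, 2:] * pderiv (hermite n) - smult (2 * real n) (hermite n)"
proof -
  have "smult (2 * real (Suc n)) (hermite n)
      = smult 2 (hermite n) + ([:0, 2:] * pderiv (hermite n) - pderiv (pderiv (hermite n)))"
    unfolding pderiv_hermite_Suc[symmetric] by (simp add: pderiv_diff pderiv_mult pderiv_pCons pderiv_smult)
  moreover have "smult (2 * real (Suc n)) (hermite n) = smult 2 (hermite n) + smult (2 * real n) (hermite n)"
    by (simp only: of_nat_Suc distrib_left mult_1_right smult_add_left)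
  ultimately show ?thesis by simp
qed

lemma degree_hermite_le: "degree (hermite n) \<le> n"
proof (induction n)
  case (Suc n)
  have "degree ([:0, 2:] * hermite n) \<le> Suc n"
    using degree_mult_le[of "[:0, 2:]" "hermite n"] Suc by simp
  moreover have "degree (pderiv (hermite n)) \<le> Suc n"
    using Suc degree_pderiv[of "hermite n"] by simp
  ultimately show ?case by (simp add: degree_diff_le)
qed simp

lemma coeff_hermite: "coeff (hermite n) n = 2 ^ n"
proof (induction n)
  case (Suc n)
  have "coeff (pderiv (hermite n)) (Suc n) = 0"
    using degree_hermite_le[of n] by (simp add: coeff_pderiv coeff_eq_0)
  then show ?case using Suc by simp
qed simp

lemma lead_coeff_hermite: "degree (hermite n) = n" "lead_coeff (hermite n) > 0"
proof -
  show *: "degree (hermite n) = n"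
    using degree_hermite_le[of n] le_degree[of "hermite n" n] coeff_hermite[of n] by simp
  show "lead_coeff (hermite n) > 0" using coeff_hermite[of n] by (simp add: *)
qed

lemma hermite_neq_0: "hermite n \<noteq> 0"
  using lead_coeff_hermite(2)[of n] by auto

lemma poly_hermite_minus: "poly (hermite n) (- x) = (- 1) ^ n * poly (hermite n) x"
proof (induction n arbitrary: x)
  case (Suc n)
  \<comment> \<open>The induction hypothesis holds for all \<open>x\<close>, so its two sides have
    the same derivative.\<close>
  have "((\<lambda>x. poly (hermite n) (- x)) has_real_derivative - poly (pderiv (hermite n)) (- x)) (at x)"
    using DERIV_chain2[where f = "poly (hermite n)" and g = uminus and x = x and s = UNIV,
        OF poly_DERIV DERIV_minus[OF DERIV_ident]] by simp
  moreover have "((\<lambda>x. (- 1) ^ n * poly (hermite n) x) has_real_derivative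
      (- 1) ^ n * poly (pderiv (hermite n)) x) (at x)"
    by (intro DERIV_cmult poly_DERIV)
  ultimately have "- poly (pderiv (hermite n)) (- x) = (- 1) ^ n * poly (pderiv (hermite n)) x"
    unfolding Suc.IH by (rule DERIV_unique)
  then have "poly (pderiv (hermite n)) (- x) = - ((- 1) ^ n * poly (pderiv (hermite n)) x)"
    by simp
  then show ?case using Suc.IH[of x] by (simp add: algebra_simps)
qed simp

text \<open>Zeros are simple: a common zero of \<open>hermite (Suc n)\<close> and its derivative is
  a zero of \<open>hermite n\<close> by the derivative rule, then of its derivative by the
  recursion, and the descent ends at the constant 1.\<close>

lemma pderiv_hermite_neq_0:
  assumes "poly (hermite n) x = 0"
  shows "poly (pderiv (hermite n)) x \<noteq> 0"
proof
  assume "poly (pderiv (hermite n)) x = 0"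
  with assms show False
  proof (induction n)
    case (Suc n)
    have "poly (hermite n) x = 0"
      using Suc.prems(2) unfolding pderiv_hermite_Suc by simp
    moreover from this have "poly (pderiv (hermite n)) x = 0"
      using Suc.prems(1) by simp
    ultimately show False by (rule Suc.IH)
  qed simp
qed

text \<open>By parity the zeros are symmetric, so the positive ones and their negatives together
  number at most the degree.\<close>

lemma card_hermite_pos_zeros:
  "finite {z. 0 < z \<and> poly (hermite n) z = 0}" "card {z. 0 < z \<and> poly (hermite n) z = 0} \<le> n div 2"
proof -
  let ?Z = "{z. 0 < z \<and> poly (hermite n) z = 0}"
  have fin: "finite {z. poly (hermite n) z = 0}"
    by (rule poly_roots_finite[OF hermite_neq_0])
  then show finZ: "finite ?Z" by (rule rev_finite_subset) auto
  have "card (?Z \<union> uminus ` ?Z) = card ?Z + card (uminus ` ?Z)"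
    by (rule card_Un_disjoint) (use finZ in auto)
  also have "card (uminus ` ?Z) = card ?Z"
    by (rule card_image) (simp add: inj_on_def)
  finally have "2 * card ?Z = card (?Z \<union> uminus ` ?Z)" by simp
  also have "\<dots> \<le> card {z. poly (hermite n) z = 0}"
    by (rule card_mono[OF fin]) (auto simp: poly_hermite_minus)
  also have "\<dots> \<le> n"
    using card_poly_roots_bound[OF hermite_neq_0[of n]] lead_coeff_hermite(1) by simp
  finally show "card ?Z \<le> n div 2" by simp
qed

lemma hermite_eventually_pos: "\<exists>R. \<forall>x\<ge>R. poly (hermite n) x > 0"
proof -
  obtain R where "\<forall>x\<ge>R. lead_coeff (hermite n) \<le> poly (hermite n) x"
    using poly_pinfty_gt_lc[OF lead_coeff_hermite(2)] by auto
  then show ?thesis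
    using lead_coeff_hermite(2)[of n] by (intro exI[of _ R]) (auto intro: less_le_trans)
qed

section \<open>The Gaussian weight and the comparison quotient\<close>

definition gauss :: "real \<Rightarrow> real" where
  "gauss s = 2 / sqrt pi * exp (- (s\<^sup>2))"

lemma gauss_pos: "gauss s > 0"
  by (simp add: gauss_def)

lemma continuous_on_gauss: "continuous_on A gauss"
  unfolding gauss_def by (intro continuous_intros) auto

lemma gauss_deriv: "(gauss has_real_derivative - 2 * s * gauss s) (at s)"
proof -
  have "((\<lambda>s. exp (- (s\<^sup>2))) has_real_derivative - 2 * s * exp (- (s\<^sup>2))) (at s)"
    by (auto intro!: derivative_eq_intros)
  from DERIV_cmult[OF this, of "2 / sqrt pi"] show ?thesis
    unfolding gauss_def by (simp add: mult_ac)
qed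

text \<open>At a zero of the Hermite polynomial the value is \<open>0\<close> (division by zero). This is the right value for
  the boundary term \<open>g\<^sup>2 * log_slope n\<close> below, whose limit there is \<open>0\<close> when \<open>g\<close> vanishes.\<close>

definition log_slope :: "nat \<Rightarrow> real \<Rightarrow> real" where
  "log_slope n s = poly (pderiv (hermite n)) s / poly (hermite n) s * gauss s"

text \<open>A Riccati equation: by \<open>hermite_ode\<close>,
  \<open>H''/H = 2 s H'/H - 2 n\<close>, and the term with \<open>2 s\<close> cancels against the
  derivative of \<open>gauss\<close>.\<close>

lemma log_slope_deriv:
  assumes "poly (hermite n) s \<noteq> 0"
  shows "(log_slope n has_real_derivative - 2 * real n * gauss s - (log_slope n s)\<^sup>2 / gauss s) (at s)"
proof -
  let ?H = "poly (hermite n) s" and ?H' = "poly (pderiv (hermite n)) s"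
  have "(log_slope n has_real_derivative
      (poly (pderiv (pderiv (hermite n))) s * ?H - ?H' * ?H') / (?H * ?H) * gauss s
      + - 2 * s * gauss s * (?H' / ?H)) (at s)"
    unfolding log_slope_def by (intro DERIV_mult DERIV_divide poly_DERIV gauss_deriv assms)
  also have "(poly (pderiv (pderiv (hermite n))) s * ?H - ?H' * ?H') / (?H * ?H) * gauss s
      + - 2 * s * gauss s * (?H' / ?H) = - 2 * real n * gauss s - (log_slope n s)\<^sup>2 / gauss s"
  proof -
    define q where "q = ?H' / ?H"
    have "(poly (pderiv (pderiv (hermite n))) s * ?H - ?H' * ?H') / (?H * ?H)
        = poly (pderiv (pderiv (hermite n))) s / ?H - q\<^sup>2"
      using assms by (simp add: q_def diff_divide_distrib power2_eq_square)
    also have "poly (pderiv (pderiv (hermite n))) s / ?H = 2 * s * q - 2 * real n"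
      using assms by (simp add: q_def hermite_ode diff_divide_distrib)
    finally have 1: "(poly (pderiv (pderiv (hermite n))) s * ?H - ?H' * ?H') / (?H * ?H)
        = 2 * s * q - 2 * real n - q\<^sup>2" .
    have 2: "(log_slope n s)\<^sup>2 / gauss s = q\<^sup>2 * gauss s"
      using gauss_pos[of s] by (simp add: log_slope_def q_def power2_eq_square)
    show ?thesis
      unfolding 1 2 q_def[symmetric] by (simp add: algebra_simps)
  qed
  finally show ?thesis .
qed

text \<open>Gives the boundary term far out on a half-line a sign that allows dropping it without
  any decay estimate. For positive \<open>n\<close> the derivative is a positive multiple of the
  previous Hermite polynomial.\<close>

lemma log_slope_eventually_nonneg: "\<exists>R. \<forall>x\<ge>R. log_slope n x \<ge> 0"
proof (cases n)
  case 0
  then show ?thesis by (simp add: log_slope_def)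
next
  case (Suc k)
  obtain R R' where R: "\<forall>x\<ge>R. poly (hermite n) x > 0" "\<forall>x\<ge>R'. poly (hermite k) x > 0"
    using hermite_eventually_pos by metis
  have "log_slope n x \<ge> 0" if "x \<ge> max R R'" for x
    using that R gauss_pos[of x] unfolding log_slope_def Suc pderiv_hermite_Suc
    by (auto simp: less_imp_le simp del: hermite.simps)
  then show ?thesis by blast
qed

text \<open>Induction removes the exceptional points one at a time: split at \<open>z\<close>, use
  the hypothesis on intervals stopping short of \<open>z\<close>, and pass to the limit by
  continuity.\<close>

lemma le_of_mono_off_finite:
  fixes E :: "real \<Rightarrow> real"
  assumes "finite Z" "a \<le> b" "continuous_on {a..b} E"
    and "\<And>x y. a \<le> x \<Longrightarrow> x \<le> y \<Longrightarrow> y \<le> b \<Longrightarrow> {x..y} \<inter> Z = {} \<Longrightarrow> E x \<le> E y"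
  shows "E a \<le> E b"
  using assms
proof (induction Z arbitrary: a b rule: finite_induct)
  case empty
  then show ?case by simp
next
  case (insert z Z)
  show ?case
  proof (cases "z \<in> {a..b}")
    case False
    show ?thesis
    proof (rule insert.IH[OF insert.prems(1,2)])
      fix x y assume "a \<le> x" "x \<le> y" "y \<le> b" "{x..y} \<inter> Z = {}"
      with False show "E x \<le> E y" by (intro insert.prems(3)) auto
    qed
  next
    case True
    have "E a \<le> E z"
    proof (cases "a = z")
      case False
      with True have az: "a < z" by auto
      have "E a \<le> E s" if "s \<in> {a..<z}" for s
      proof (rule insert.IH)
        show "continuous_on {a..s} E"
          using that True by (intro continuous_on_subset[OF insert.prems(2)]) auto
        show "E x \<le> E y" if "a \<le> x" "x \<le> y" "y \<le> s" "{x..y} \<inter> Z = {}" for x y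
          using that True \<open>s \<in> {a..<z}\<close> by (intro insert.prems(3)) auto
      qed (use that in auto)
      moreover have "continuous_on (closure {a..<z}) E"
        using az True by (auto intro: continuous_on_subset[OF insert.prems(2)])
      ultimately show ?thesis
        using az by (intro continuous_ge_on_closure[of "{a..<z}" E z "E a"]) auto
    qed simp
    moreover have "E z \<le> E b"
    proof (cases "b = z")
      case False
      with True have zb: "z < b" by auto
      have "E s \<le> E b" if "s \<in> {z<..b}" for s
      proof (rule insert.IH)
        show "continuous_on {s..b} E"
          using that True by (intro continuous_on_subset[OF insert.prems(2)]) auto
        show "E x \<le> E y" if "s \<le> x" "x \<le> y" "y \<le> b" "{x..y} \<inter> Z = {}" for x y
          using that True \<open>s \<in> {z<..b}\<close> by (intro insert.prems(3)) auto
      qed (use that in auto)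
      moreover have "continuous_on (closure {z<..b}) E"
        using zb True by (auto intro: continuous_on_subset[OF insert.prems(2)])
      ultimately show ?thesis
        using zb by (intro continuous_le_on_closure[of "{z<..b}" E z "E b"]) auto
    qed simp
    ultimately show ?thesis by simp
  qed
qed

text \<open>By the Riccati equation, the integrand minus the derivative of
  \<open>g^2 * log_slope\<close> is the square
  \<open>(k * gauss - g * log_slope)^2 / gauss\<close>.\<close>

lemma picone_off_zeros:
  assumes g: "primitive_on a b g k" and k2: "set_integrable lborel {a..b} (\<lambda>s. (k s)\<^sup>2)"
    and ab: "a \<le> b" and nz: "\<And>s. s \<in> {a..b} \<Longrightarrow> poly (hermite n) s \<noteq> 0"
  shows "(g b)\<^sup>2 * log_slope n b - (g a)\<^sup>2 * log_slope n a
    \<le> integral {a..b} (\<lambda>s. ((k s)\<^sup>2 - 2 * real n * (g s)\<^sup>2) * gauss s)"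
proof -
  define r where "r s = - 2 * real n * gauss s - (log_slope n s)\<^sup>2 / gauss s" for s
  have rho_c: "continuous_on {a..b} (log_slope n)"
    unfolding log_slope_def using nz by (intro continuous_intros continuous_on_gauss) auto
  have g_c: "continuous_on {a..b} g" by (rule primitive_on_continuous[OF g])
  have gauss_nz: "gauss s \<noteq> 0" for s using gauss_pos[of s] by simp
  have "primitive_on a b (log_slope n) r"
    unfolding r_def using nz gauss_nz
    by (intro primitive_on_C1 log_slope_deriv continuous_intros continuous_on_gauss rho_c) auto
  from primitive_on_mult[OF primitive_on_mult[OF g g] this]
  have P: "primitive_on a b (\<lambda>s. g s * g s * log_slope n s)
      (\<lambda>s. (k s * g s + g s * k s) * log_slope n s + g s * g s * r s)" (is "primitive_on _ _ _ ?d") .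
  have "(g b)\<^sup>2 * log_slope n b - (g a)\<^sup>2 * log_slope n a = integral {a..b} ?d"
    using primitive_on_D(3)[OF P order_refl ab order_refl] by (simp add: power2_eq_square)
  also have "\<dots> \<le> integral {a..b} (\<lambda>s. ((k s)\<^sup>2 - 2 * real n * (g s)\<^sup>2) * gauss s)"
  proof (rule integral_le)
    show "?d integrable_on {a..b}"
      by (rule primitive_on_D(2)[OF P order_refl ab order_refl])
    have "set_integrable lborel {a..b} (\<lambda>s. (k s)\<^sup>2 - 2 * real n * (g s)\<^sup>2)"
      by (intro set_integral_diff(1) k2 borel_integrable_atLeastAtMost' continuous_intros g_c)
    then show "(\<lambda>s. ((k s)\<^sup>2 - 2 * real n * (g s)\<^sup>2) * gauss s) integrable_on {a..b}"
      by (intro set_borel_integral_eq_integral set_integrable_mult_continuous continuous_on_gauss)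
    fix s
    have "0 \<le> (k s * gauss s - g s * log_slope n s)\<^sup>2 / gauss s"
      using gauss_pos[of s] by simp
    also have "\<dots> = ((k s)\<^sup>2 - 2 * real n * (g s)\<^sup>2) * gauss s - ?d s"
      using gauss_nz[of s] by (simp add: r_def field_simps power2_eq_square)
    finally show "?d s \<le> ((k s)\<^sup>2 - 2 * real n * (g s)\<^sup>2) * gauss s" by simp
  qed
  finally show ?thesis .
qed

text \<open>Cauchy-Schwarz on \<open>{x..y}\<close>. The second factor is an increment of a
  continuous function and thus tends to 0 as the points merge, so the left side is
  \<open>o(y - x)\<close>.\<close>

lemma primitive_on_power2_diff_le:
  assumes g: "primitive_on a b g k" and k2: "set_integrable lborel {a..b} (\<lambda>s. (k s)\<^sup>2)"
    and "a \<le> x" "x \<le> y" "y \<le> b"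
  shows "(g y - g x)\<^sup>2 \<le> (y - x) * (integral {a..y} (\<lambda>s. (k s)\<^sup>2) - integral {a..x} (\<lambda>s. (k s)\<^sup>2))"
proof -
  have sub: "(\<lambda>s. (k s)\<^sup>2) integrable_on {c..d}" if "a \<le> c" "d \<le> b" for c d
    by (rule set_borel_integral_eq_integral(1), rule set_integrable_subset[OF k2]) (use that in auto)
  have "(g y - g x)\<^sup>2 \<le> (y - x) * integral {x..y} (\<lambda>s. (k s)\<^sup>2)"
    unfolding primitive_on_D(3)[OF g assms(3-5)]
    by (intro integral_power2_le primitive_on_D(2)[OF g] sub) (use assms in auto)
  also have "integral {x..y} (\<lambda>s. (k s)\<^sup>2) = integral {a..y} (\<lambda>s. (k s)\<^sup>2) - integral {a..x} (\<lambda>s. (k s)\<^sup>2)"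
    using Henstock_Kurzweil_Integration.integral_combine[OF assms(3,4) sub] assms(5) by simp
  finally show ?thesis .
qed

text \<open>At a zero \<open>z\<close> of the Hermite polynomial \<open>log_slope\<close> has a
  simple pole, whereas \<open>(g s)^2 = o(|s - z|)\<close> because \<open>g z = 0\<close> and
  \<open>k\<close> is square integrable; hence the product tends to 0.\<close>

lemma continuous_on_picone_boundary_term:
  assumes g: "primitive_on a b g k" and k2: "set_integrable lborel {a..b} (\<lambda>s. (k s)\<^sup>2)"
    and zero: "\<And>s. s \<in> {a..b} \<Longrightarrow> poly (hermite n) s = 0 \<Longrightarrow> g s = 0"
  shows "continuous_on {a..b} (\<lambda>s. (g s)\<^sup>2 * log_slope n s)"
  unfolding continuous_on_def
proof
  fix z assume z: "z \<in> {a..b}"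
  have g_c: "(g \<longlongrightarrow> g z) (at z within {a..b})"
    using primitive_on_continuous[OF g] z unfolding continuous_on_def by blast
  have H_c: "(poly p \<longlongrightarrow> poly p z) (at z within {a..b})" for p :: "real poly"
    using continuous_on_poly[OF continuous_on_id, of "{a..b}" p] z unfolding continuous_on_def by auto
  have w_c: "(gauss \<longlongrightarrow> gauss z) (at z within {a..b})"
    using continuous_on_gauss z unfolding continuous_on_def by blast
  show "((\<lambda>s. (g s)\<^sup>2 * log_slope n s) \<longlongrightarrow> (g z)\<^sup>2 * log_slope n z) (at z within {a..b})"
  proof (cases "poly (hermite n) z = 0")
    case False
    then show ?thesis unfolding log_slope_def by (intro tendsto_intros g_c H_c w_c)
  next
    case True
    define K where "K x = integral {a..x} (\<lambda>s. (k s)\<^sup>2)" for x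
    have "(\<lambda>s. (k s)\<^sup>2) integrable_on {a..b}"
      using k2 by (rule set_borel_integral_eq_integral)
    then have "continuous_on {a..b} K"
      unfolding K_def by (rule indefinite_integral_continuous_1)
    then have K_c: "(K \<longlongrightarrow> K z) (at z within {a..b})"
      using z unfolding continuous_on_def by blast
    have gz: "g z = 0" using zero[OF z True] .
    have bound: "\<bar>(g s)\<^sup>2 / (s - z)\<bar> \<le> \<bar>K s - K z\<bar>" if "s \<in> {a..b}" "s \<noteq> z" for s
    proof -
      have "(g s)\<^sup>2 \<le> \<bar>s - z\<bar> * \<bar>K s - K z\<bar>"
      proof (cases "s \<le> z")
        case True
        have "(g z - g s)\<^sup>2 \<le> (z - s) * (K z - K s)"
          unfolding K_def by (rule primitive_on_power2_diff_le[OF g k2]) (use True that z in auto)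
        also have "\<dots> \<le> \<bar>(z - s) * (K z - K s)\<bar>" by simp
        finally show ?thesis by (simp add: gz abs_mult abs_minus_commute)
      next
        case False
        have "(g s - g z)\<^sup>2 \<le> (s - z) * (K s - K z)"
          unfolding K_def by (rule primitive_on_power2_diff_le[OF g k2]) (use False that z in auto)
        also have "\<dots> \<le> \<bar>(s - z) * (K s - K z)\<bar>" by simp
        finally show ?thesis by (simp add: gz abs_mult)
      qed
      then show ?thesis using that(2) by (simp add: abs_divide divide_le_eq mult.commute)
    qed
    have "((\<lambda>s. \<bar>K s - K z\<bar>) \<longlongrightarrow> \<bar>K z - K z\<bar>) (at z within {a..b})"
      by (intro tendsto_intros K_c)
    then have "((\<lambda>s. \<bar>K s - K z\<bar>) \<longlongrightarrow> 0) (at z within {a..b})" by simp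
    moreover have "\<forall>\<^sub>F s in at z within {a..b}. norm ((g s)\<^sup>2 / (s - z)) \<le> \<bar>K s - K z\<bar>"
      unfolding eventually_at_filter using bound by (intro always_eventually) (simp only: real_norm_def, blast)
    ultimately have "((\<lambda>s. (g s)\<^sup>2 / (s - z)) \<longlongrightarrow> 0) (at z within {a..b})"
      by (rule Lim_null_comparison[rotated])
    moreover have "((\<lambda>s. poly (hermite n) s / (s - z)) \<longlongrightarrow> poly (pderiv (hermite n)) z) (at z within {a..b})"
      using has_field_derivative_at_within[OF poly_DERIV[of "hermite n" z], of "{a..b}"] True
      by (simp add: has_field_derivative_iff)
    moreover have "poly (pderiv (hermite n)) z \<noteq> 0" by (rule pderiv_hermite_neq_0[OF True])
    \<comment> \<open>Numerator and denominator are both divided by \<open>s - z\<close>: the first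
      quotient tends to 0, the second to the nonzero derivative of the polynomial.\<close>
    ultimately have "((\<lambda>s. (g s)\<^sup>2 / (s - z) / (poly (hermite n) s / (s - z))
        * (poly (pderiv (hermite n)) s * gauss s)) \<longlongrightarrow>
        0 / poly (pderiv (hermite n)) z * (poly (pderiv (hermite n)) z * gauss z)) (at z within {a..b})"
      by (intro tendsto_intros H_c w_c)
    then have "((\<lambda>s. (g s)\<^sup>2 / (s - z) / (poly (hermite n) s / (s - z))
        * (poly (pderiv (hermite n)) s * gauss s)) \<longlongrightarrow> (g z)\<^sup>2 * log_slope n z) (at z within {a..b})"
      by (simp add: gz)
    moreover have "\<forall>\<^sub>F s in at z within {a..b}. (g s)\<^sup>2 / (s - z) / (poly (hermite n) s / (s - z))
        * (poly (pderiv (hermite n)) s * gauss s) = (g s)\<^sup>2 * log_slope n s"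
      unfolding eventually_at_filter by (intro always_eventually) (simp add: log_slope_def)
    ultimately show ?thesis
      by (rule Lim_transform_eventually)
  qed
qed

lemma picone:
  assumes g: "primitive_on a b g k" and k2: "set_integrable lborel {a..b} (\<lambda>s. (k s)\<^sup>2)"
    and ab: "a \<le> b" and zero: "\<And>s. s \<in> {a..b} \<Longrightarrow> poly (hermite n) s = 0 \<Longrightarrow> g s = 0"
  shows "(g b)\<^sup>2 * log_slope n b - (g a)\<^sup>2 * log_slope n a
    \<le> integral {a..b} (\<lambda>s. ((k s)\<^sup>2 - 2 * real n * (g s)\<^sup>2) * gauss s)"
proof -
  define e where "e s = ((k s)\<^sup>2 - 2 * real n * (g s)\<^sup>2) * gauss s" for s
  \<comment> \<open>\<open>E\<close> increases between the zeros by \<open>picone_off_zeros\<close>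
    and is continuous across them, although \<open>log_slope\<close> is unbounded there.\<close>
  define E where "E s = integral {a..s} e - (g s)\<^sup>2 * log_slope n s" for s
  have "set_integrable lborel {a..b} (\<lambda>s. (k s)\<^sup>2 - 2 * real n * (g s)\<^sup>2)"
    by (intro set_integral_diff(1) k2 borel_integrable_atLeastAtMost' continuous_intros
        primitive_on_continuous[OF g])
  then have "set_integrable lborel {a..b} e"
    unfolding e_def by (intro set_integrable_mult_continuous continuous_on_gauss)
  then have e_int: "e integrable_on {a..b}"
    by (rule set_borel_integral_eq_integral)
  have "E a \<le> E b"
  proof (rule le_of_mono_off_finite[OF poly_roots_finite[OF hermite_neq_0[of n]] ab])
    show "continuous_on {a..b} E"
      unfolding E_def
      by (intro continuous_intros indefinite_integral_continuous_1 e_int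
          continuous_on_picone_boundary_term[OF g k2 zero])
    fix x y assume xy: "a \<le> x" "x \<le> y" "y \<le> b" "{x..y} \<inter> {z. poly (hermite n) z = 0} = {}"
    have "(g y)\<^sup>2 * log_slope n y - (g x)\<^sup>2 * log_slope n x \<le> integral {x..y} e"
      unfolding e_def
      by (rule picone_off_zeros[OF primitive_on_subset[OF g xy(1,3)] set_integrable_subset[OF k2] xy(2)])
        (use xy in auto)
    moreover have "integral {a..x} e + integral {x..y} e = integral {a..y} e"
      by (rule Henstock_Kurzweil_Integration.integral_combine[OF xy(1,2)])
        (rule integrable_on_subinterval[OF e_int], use xy in auto)
    ultimately show "E x \<le> E y" by (simp add: E_def)
  qed
  then have "(g b)\<^sup>2 * log_slope n b - (g a)\<^sup>2 * log_slope n a \<le> integral {a..b} e"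
    by (simp add: E_def)
  then show ?thesis unfolding e_def[abs_def] .
qed

section \<open>Picone's inequality for complex functions on a single edge\<close>

definition gauss_on :: "real set \<Rightarrow> real measure" where
  "gauss_on I = density lborel (\<lambda>s. ennreal (gauss s) * indicator I s)"

lemma edge_measure_eq_gauss_on: "edge_measure T e = gauss_on (edge_ivl T e)"
  by (simp add: edge_measure_def gauss_on_def gauss_def)

lemma borel_measurable_gauss [measurable]: "gauss \<in> borel_measurable borel"
  by (rule borel_measurable_continuous_onI[OF continuous_on_gauss])

lemma gauss_on_integral:
  fixes h :: "real \<Rightarrow> 'a :: {banach, second_countable_topology}"
  assumes I: "I \<in> sets borel" and h: "h \<in> borel_measurable borel"
  shows "integrable (gauss_on I) h \<longleftrightarrow> set_integrable lborel I (\<lambda>s. gauss s *\<^sub>R h s)"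
    and "integral\<^sup>L (gauss_on I) h = (LINT s:I|lborel. gauss s *\<^sub>R h s)"
proof -
  note [measurable] = I h
  have *: "gauss_on I = density lborel (\<lambda>s. ennreal (indicator I s * gauss s))"
    unfolding gauss_on_def by (intro arg_cong[where f = "density lborel"])
      (auto simp: indicator_def fun_eq_iff)
  have nn: "AE s in lborel. 0 \<le> indicator I s * gauss s"
    using gauss_pos by (auto simp: less_imp_le)
  show "integrable (gauss_on I) h \<longleftrightarrow> set_integrable lborel I (\<lambda>s. gauss s *\<^sub>R h s)"
    unfolding * by (subst integrable_density) (use nn in \<open>auto simp: set_integrable_def\<close>)
  show "integral\<^sup>L (gauss_on I) h = (LINT s:I|lborel. gauss s *\<^sub>R h s)"
    unfolding * by (subst integral_density) (use nn in \<open>auto simp: set_lebesgue_integral_def\<close>)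
qed

lemma square_integrable_gauss_on_borel:
  "square_integrable (gauss_on I) h \<Longrightarrow> h \<in> borel_measurable borel"
  by (simp add: square_integrable_def gauss_on_def)

text \<open>\<open>1 / gauss\<close> is continuous, hence bounded on a compact interval, so the
  weight can be divided out; integrability of \<open>h\<close> itself follows from
  \<open>x \<le> 1 + x^2\<close>.\<close>

lemma square_integrable_gauss_on_compact:
  assumes "square_integrable (gauss_on I) h" "I \<in> sets borel" "{c..d} \<subseteq> I"
  shows "set_integrable lborel {c..d} (\<lambda>s. (cmod (h s))\<^sup>2)" "set_integrable lborel {c..d} h"
proof -
  have hm [measurable]: "h \<in> borel_measurable borel"
    by (rule square_integrable_gauss_on_borel[OF assms(1)])
  have "set_integrable lborel I (\<lambda>s. gauss s *\<^sub>R (cmod (h s))\<^sup>2)"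
    using assms(1) by (subst gauss_on_integral(1)[symmetric])
      (auto simp: square_integrable_def assms(2))
  then have "set_integrable lborel {c..d} (\<lambda>s. gauss s *\<^sub>R (cmod (h s))\<^sup>2)"
    by (rule set_integrable_subset) (use assms(3) in auto)
  then have "set_integrable lborel {c..d} (\<lambda>s. (gauss s *\<^sub>R (cmod (h s))\<^sup>2) * (1 / gauss s))"
    using gauss_pos by (intro set_integrable_mult_continuous continuous_intros continuous_on_gauss)
      (auto simp: less_imp_neq[symmetric])
  moreover have "(gauss s *\<^sub>R (cmod (h s))\<^sup>2) * (1 / gauss s) = (cmod (h s))\<^sup>2" for s
    using gauss_pos[of s] by simp
  ultimately show h2: "set_integrable lborel {c..d} (\<lambda>s. (cmod (h s))\<^sup>2)" by simp
  have "set_integrable lborel {c..d} (\<lambda>s. 1 + (cmod (h s))\<^sup>2)"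
    by (intro set_integral_add(1) h2 borel_integrable_atLeastAtMost' continuous_intros)
  then show "set_integrable lborel {c..d} h"
    unfolding set_integrable_def
  proof (rule Bochner_Integration.integrable_bound)
    have "x \<le> 1 + x\<^sup>2" for x :: real
      using zero_le_power2[of "x - 1/2"] by (simp add: power2_eq_square algebra_simps)
    then show "AE s in lborel. norm (indicat_real {c..d} s *\<^sub>R h s)
        \<le> norm (indicat_real {c..d} s *\<^sub>R (1 + (cmod (h s))\<^sup>2))"
      by (intro AE_I2) (simp add: indicator_def)
  qed auto
qed

text \<open>Weak derivatives are tested in the open interior, so the increment formula first comes
  without the end points. \<open>F\<close> minus the integral of \<open>f\<close> is constant inside
  and continuous up to the ends, hence constant on the closed interval.\<close>

lemma primitive_on_of_interior:
  fixes F f :: "real \<Rightarrow> real"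
  assumes f: "set_integrable lborel {a..b} f" and F: "continuous_on {a..b} F" and ab: "a < b"
    and inner: "\<And>x y. a < x \<Longrightarrow> x < y \<Longrightarrow> y < b \<Longrightarrow> F y - F x = (LINT s:{x..y}|lborel. f s)"
  shows "primitive_on a b F f"
proof -
  have int: "set_integrable lborel {x..y} f" if "a \<le> x" "y \<le> b" for x y
    by (rule set_integrable_subset[OF f]) (use that in auto)
  have f_on: "f integrable_on {a..b}" by (rule set_borel_integral_eq_integral(1)[OF f])
  define D where "D x = F x - integral {a..x} f" for x
  have D_c: "continuous_on {a..b} D"
    unfolding D_def by (intro continuous_intros F indefinite_integral_continuous_1 f_on)
  define m where "m = (a + b) / 2"
  have m: "a < m" "m < b" using ab by (auto simp: m_def)
  have D_eq: "D x = D y" if "a < x" "x < y" "y < b" for x y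
  proof -
    have "F y - F x = integral {x..y} f"
      using inner[OF that] set_borel_integral_eq_integral(2)[OF int[of x y]] that by simp
    moreover have "integral {a..x} f + integral {x..y} f = integral {a..y} f"
      by (rule Henstock_Kurzweil_Integration.integral_combine,
          use that in simp, use that in simp, rule integrable_on_subinterval[OF f_on])
        (use that in auto)
    ultimately show ?thesis by (simp add: D_def)
  qed
  have D_open: "D x = D m" if "x \<in> {a<..<b}" for x
  proof (cases x m rule: linorder_cases)
    case less
    with that m show ?thesis by (intro D_eq) auto
  next
    case greater
    with that m show ?thesis by (intro D_eq[symmetric]) auto
  qed simp
  have closure: "closure {a<..<b} = {a..b}" using ab by simp
  have D_const: "D x = D m" if "x \<in> {a..b}" for x
  proof (rule continuous_constant_on_closure[of "{a<..<b}" D])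
    show "continuous_on (closure {a<..<b}) D" using D_c closure by simp
    show "x \<in> closure {a<..<b}" using that closure by simp
  qed (rule D_open)
  have "D a = F a" by (simp add: D_def)
  have "F x - F a = integral {a..x} f" if "x \<in> {a..b}" for x
  proof -
    have "D a = D m" by (rule D_const) (use ab in auto)
    then have "D x = F a" using D_const[OF that] \<open>D a = F a\<close> by metis
    then show ?thesis by (simp add: D_def)
  qed
  with f show ?thesis by (simp add: primitive_on_def)
qed

text \<open>Real and imaginary parts are separated because the square completion is done for real
  functions.\<close>

lemma weak_deriv_primitive_on:
  assumes sq: "square_integrable (gauss_on I) G" and I: "I \<in> sets borel" and sub: "{a..b} \<subseteq> I" and ab: "a < b"
    and cont: "continuous_on I u" and wd: "weak_deriv_on (interior I) u G"
  shows "primitive_on a b (\<lambda>s. Re (u s)) (\<lambda>s. Re (G s))" "primitive_on a b (\<lambda>s. Im (u s)) (\<lambda>s. Im (G s))"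
proof -
  note compact = square_integrable_gauss_on_compact[OF sq I]
  have inner: "{x..y} \<subseteq> interior I" if "a < x" "y < b" for x y
  proof -
    have "{a<..<b} \<subseteq> interior I"
      by (rule interior_maximal) (use sub in auto)
    then show ?thesis using that by auto
  qed
  have FTC: "u y - u x = (LINT s:{x..y}|lborel. G s)" if "a < x" "x < y" "y < b" for x y
  proof (rule weak_deriv_on_imp_FTC[OF wd open_interior inner[OF that(1,3)] that(2)])
    show "continuous_on (interior I) u"
      by (rule continuous_on_subset[OF cont interior_subset])
    show "set_integrable lborel {c..d} G" if "{c..d} \<subseteq> interior I" for c d
      by (rule compact(2)) (use that interior_subset in auto)
  qed
  have G: "set_integrable lborel {x..y} G" if "a \<le> x" "y \<le> b" for x y
    by (rule compact(2)) (use that sub in auto)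
  have G': "integrable lborel (\<lambda>s. indicator {x..y} s *\<^sub>R G s)" if "a \<le> x" "y \<le> b" for x y
    using G[OF that] by (simp add: set_integrable_def)
  have Re_int: "set_integrable lborel {x..y} (\<lambda>s. Re (G s))" and Im_int: "set_integrable lborel {x..y} (\<lambda>s. Im (G s))"
    if "a \<le> x" "y \<le> b" for x y
    using integrable_Re[OF G'[OF that]] integrable_Im[OF G'[OF that]] by (auto simp: set_integrable_def)
  have u_c: "continuous_on {a..b} u" by (rule continuous_on_subset[OF cont sub])
  show "primitive_on a b (\<lambda>s. Re (u s)) (\<lambda>s. Re (G s))"
  proof (rule primitive_on_of_interior[OF Re_int _ ab])
    fix x y assume xy: "a < x" "x < y" "y < b"
    have "Re (u y) - Re (u x) = Re (LINT s:{x..y}|lborel. G s)"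
      by (simp flip: FTC[OF xy])
    also have "\<dots> = (LINT s:{x..y}|lborel. Re (G s))"
      using integral_Re[OF G'[of x y]] xy by (simp add: set_lebesgue_integral_def)
    finally show "Re (u y) - Re (u x) = (LINT s:{x..y}|lborel. Re (G s))" .
  qed (auto intro: continuous_intros u_c)
  show "primitive_on a b (\<lambda>s. Im (u s)) (\<lambda>s. Im (G s))"
  proof (rule primitive_on_of_interior[OF Im_int _ ab])
    fix x y assume xy: "a < x" "x < y" "y < b"
    have "Im (u y) - Im (u x) = Im (LINT s:{x..y}|lborel. G s)"
      by (simp flip: FTC[OF xy])
    also have "\<dots> = (LINT s:{x..y}|lborel. Im (G s))"
      using integral_Im[OF G'[of x y]] xy by (simp add: set_lebesgue_integral_def)
    finally show "Im (u y) - Im (u x) = (LINT s:{x..y}|lborel. Im (G s))" .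
  qed (auto intro: continuous_intros u_c)
qed

context
  fixes I :: "real set" and u G :: "real \<Rightarrow> complex" and n :: nat
  assumes G: "square_integrable (gauss_on I) G" and u: "square_integrable (gauss_on I) u"
    and I: "I \<in> sets borel" and cont: "continuous_on I u" and wd: "weak_deriv_on (interior I) u G"
    and zero: "\<And>s. s \<in> I \<Longrightarrow> poly (hermite n) s = 0 \<Longrightarrow> u s = 0"
begin

private lemma energy_eq:
  "set_integrable lborel I (\<lambda>s. ((cmod (G s))\<^sup>2 - 2 * real n * (cmod (u s))\<^sup>2) * gauss s)"
  "(LINT s|gauss_on I. (cmod (G s))\<^sup>2) - 2 * real n * (LINT s|gauss_on I. (cmod (u s))\<^sup>2)
    = (LINT s:I|lborel. ((cmod (G s))\<^sup>2 - 2 * real n * (cmod (u s))\<^sup>2) * gauss s)"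
proof -
  have [measurable]: "G \<in> borel_measurable borel" "u \<in> borel_measurable borel"
    using G u by (auto intro: square_integrable_gauss_on_borel)
  have int: "integrable (gauss_on I) (\<lambda>s. (cmod (G s))\<^sup>2)" "integrable (gauss_on I) (\<lambda>s. (cmod (u s))\<^sup>2)"
    using G u by (auto simp: square_integrable_def)
  have "integrable (gauss_on I) (\<lambda>s. (cmod (G s))\<^sup>2 - 2 * real n * (cmod (u s))\<^sup>2)"
    using int by auto
  then show "set_integrable lborel I (\<lambda>s. ((cmod (G s))\<^sup>2 - 2 * real n * (cmod (u s))\<^sup>2) * gauss s)"
    by (subst (asm) gauss_on_integral(1)[OF I]) (auto simp: mult.commute[of "gauss _"])
  have "(LINT s|gauss_on I. (cmod (G s))\<^sup>2) - 2 * real n * (LINT s|gauss_on I. (cmod (u s))\<^sup>2)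
    = (LINT s|gauss_on I. (cmod (G s))\<^sup>2 - 2 * real n * (cmod (u s))\<^sup>2)"
    using int by simp
  also have "\<dots> = (LINT s:I|lborel. ((cmod (G s))\<^sup>2 - 2 * real n * (cmod (u s))\<^sup>2) * gauss s)"
    by (subst gauss_on_integral(2)[OF I]) (auto simp: mult.commute[of "gauss _"])
  finally show "(LINT s|gauss_on I. (cmod (G s))\<^sup>2) - 2 * real n * (LINT s|gauss_on I. (cmod (u s))\<^sup>2)
    = (LINT s:I|lborel. ((cmod (G s))\<^sup>2 - 2 * real n * (cmod (u s))\<^sup>2) * gauss s)" .
qed

text \<open>Both parts of \<open>u\<close> vanish wherever \<open>u\<close> does, and
  \<open>cmod^2\<close> is the sum of their squares, so the two real inequalities add up.\<close>

lemma picone_compact: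
  assumes sub: "{a..b} \<subseteq> I" and ab: "a < b"
  shows "(cmod (u b))\<^sup>2 * log_slope n b - (cmod (u a))\<^sup>2 * log_slope n a
    \<le> (LINT s:{a..b}|lborel. ((cmod (G s))\<^sup>2 - 2 * real n * (cmod (u s))\<^sup>2) * gauss s)"
proof -
  note prim = weak_deriv_primitive_on[OF G I sub ab cont wd]
  have [measurable]: "G \<in> borel_measurable borel"
    by (rule square_integrable_gauss_on_borel[OF G])
  have G2: "set_integrable lborel {a..b} (\<lambda>s. (cmod (G s))\<^sup>2)"
    by (rule square_integrable_gauss_on_compact(1)[OF G I sub])
  have Re2: "set_integrable lborel {a..b} (\<lambda>s. (Re (G s))\<^sup>2)"
    by (rule set_integrable_bound[OF G2]) (auto simp: set_borel_measurable_def cmod_power2)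
  have Im2: "set_integrable lborel {a..b} (\<lambda>s. (Im (G s))\<^sup>2)"
    by (rule set_integrable_bound[OF G2]) (auto simp: set_borel_measurable_def cmod_power2)
  define e where "e f h s = ((f s)\<^sup>2 - 2 * real n * (h s)\<^sup>2) * gauss s" for f h :: "real \<Rightarrow> real" and s
  have e_int: "e f h integrable_on {a..b}"
    if "set_integrable lborel {a..b} (\<lambda>s. (f s)\<^sup>2)" "primitive_on a b h f" for f h
    unfolding e_def
    by (intro set_borel_integral_eq_integral(1) set_integrable_mult_continuous continuous_on_gauss
        set_integral_diff(1) that(1) borel_integrable_atLeastAtMost' continuous_intros
        primitive_on_continuous[OF that(2)])
  have "(Re (u b))\<^sup>2 * log_slope n b - (Re (u a))\<^sup>2 * log_slope n a \<le> integral {a..b} (e (\<lambda>s. Re (G s)) (\<lambda>s. Re (u s)))"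
    unfolding e_def by (rule picone[OF prim(1) Re2]) (use ab sub zero in auto)
  moreover have "(Im (u b))\<^sup>2 * log_slope n b - (Im (u a))\<^sup>2 * log_slope n a \<le> integral {a..b} (e (\<lambda>s. Im (G s)) (\<lambda>s. Im (u s)))"
    unfolding e_def by (rule picone[OF prim(2) Im2]) (use ab sub zero in auto)
  moreover have "integral {a..b} (e (\<lambda>s. Re (G s)) (\<lambda>s. Re (u s))) + integral {a..b} (e (\<lambda>s. Im (G s)) (\<lambda>s. Im (u s)))
      = integral {a..b} (\<lambda>s. e (\<lambda>s. Re (G s)) (\<lambda>s. Re (u s)) s + e (\<lambda>s. Im (G s)) (\<lambda>s. Im (u s)) s)"
    by (intro Henstock_Kurzweil_Integration.integral_add[symmetric] e_int Re2 Im2 prim)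
  moreover have "(\<lambda>s. e (\<lambda>s. Re (G s)) (\<lambda>s. Re (u s)) s + e (\<lambda>s. Im (G s)) (\<lambda>s. Im (u s)) s)
      = (\<lambda>s. ((cmod (G s))\<^sup>2 - 2 * real n * (cmod (u s))\<^sup>2) * gauss s)"
    by (simp add: e_def cmod_power2 algebra_simps)
  moreover have "integral {a..b} (\<lambda>s. ((cmod (G s))\<^sup>2 - 2 * real n * (cmod (u s))\<^sup>2) * gauss s)
      = (LINT s:{a..b}|lborel. ((cmod (G s))\<^sup>2 - 2 * real n * (cmod (u s))\<^sup>2) * gauss s)"
    by (rule set_borel_integral_eq_integral(2)[symmetric], rule set_integrable_subset[OF energy_eq(1)])
      (use sub in auto)
  ultimately show ?thesis by (simp add: cmod_power2 distrib_right)
qed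

lemma picone_bounded_edge:
  assumes "I = {a..b}" "a < b"
  shows "(cmod (u b))\<^sup>2 * log_slope n b - (cmod (u a))\<^sup>2 * log_slope n a
    \<le> (LINT s|gauss_on I. (cmod (G s))\<^sup>2) - 2 * real n * (LINT s|gauss_on I. (cmod (u s))\<^sup>2)"
  using picone_compact[of a b] assms unfolding energy_eq(2) by simp

text \<open>Truncate at a far \<open>b\<close>, drop the outer boundary term because
  \<open>log_slope n b\<close> is nonnegative there, and let \<open>b\<close> grow.\<close>

lemma picone_unbounded_edge:
  assumes "I = {a..}"
  shows "- (cmod (u a))\<^sup>2 * log_slope n a
    \<le> (LINT s|gauss_on I. (cmod (G s))\<^sup>2) - 2 * real n * (LINT s|gauss_on I. (cmod (u s))\<^sup>2)"
proof -
  obtain R where R: "\<forall>x\<ge>R. log_slope n x \<ge> 0"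
    using log_slope_eventually_nonneg by blast
  have "((\<lambda>b. LINT s:{a..b}|lborel. ((cmod (G s))\<^sup>2 - 2 * real n * (cmod (u s))\<^sup>2) * gauss s)
      \<longlongrightarrow> (LINT s:{a..}|lborel. ((cmod (G s))\<^sup>2 - 2 * real n * (cmod (u s))\<^sup>2) * gauss s)) at_top"
    by (rule tendsto_set_lebesgue_integral_at_top) (use energy_eq(1) assms in auto)
  moreover have "\<forall>\<^sub>F b in at_top. - (cmod (u a))\<^sup>2 * log_slope n a
      \<le> (LINT s:{a..b}|lborel. ((cmod (G s))\<^sup>2 - 2 * real n * (cmod (u s))\<^sup>2) * gauss s)"
  proof (rule eventually_at_top_linorderI)
    fix b assume b: "b \<ge> max R (a + 1)"
    have "(cmod (u b))\<^sup>2 * log_slope n b - (cmod (u a))\<^sup>2 * log_slope n a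
      \<le> (LINT s:{a..b}|lborel. ((cmod (G s))\<^sup>2 - 2 * real n * (cmod (u s))\<^sup>2) * gauss s)"
      by (rule picone_compact) (use assms b in auto)
    moreover have "(cmod (u b))\<^sup>2 * log_slope n b \<ge> 0" using R b by simp
    ultimately show "- (cmod (u a))\<^sup>2 * log_slope n a
      \<le> (LINT s:{a..b}|lborel. ((cmod (G s))\<^sup>2 - 2 * real n * (cmod (u s))\<^sup>2) * gauss s)" by simp
  qed
  ultimately have "- (cmod (u a))\<^sup>2 * log_slope n a
      \<le> (LINT s:{a..}|lborel. ((cmod (G s))\<^sup>2 - 2 * real n * (cmod (u s))\<^sup>2) * gauss s)"
    by (rule tendsto_lowerbound) simp
  then show ?thesis
    using energy_eq(2) unfolding assms by (simp only:)
qed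

end

section \<open>Dimension counting and linearity\<close>

text \<open>Gaussian elimination by induction on the equations. The unknowns will be coefficients of
  eigenfunctions, the equations their values at prescribed points.\<close>

lemma homogeneous_system_nontrivial_solution:
  fixes A :: "'k \<Rightarrow> 'b \<Rightarrow> 'a::field"
  assumes "finite K" "finite B" "card K < card B"
  shows "\<exists>\<alpha>. (\<exists>b\<in>B. \<alpha> b \<noteq> 0) \<and> (\<forall>i\<in>K. (\<Sum>b\<in>B. \<alpha> b * A i b) = 0)"
  using assms
proof (induction K arbitrary: B A rule: finite_induct)
  case empty
  then have "B \<noteq> {}" by auto
  then show ?case by (intro exI[of _ "\<lambda>_. 1"]) auto
next
  case (insert k K)
  show ?case
  proof (cases "\<forall>b\<in>B. A k b = 0")
    case True
    obtain \<alpha> where "\<exists>b\<in>B. \<alpha> b \<noteq> 0" "\<forall>i\<in>K. (\<Sum>b\<in>B. \<alpha> b * A i b) = 0"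
      using insert.IH[of B A] insert.prems insert.hyps by auto
    with True show ?thesis by (intro exI[of _ \<alpha>]) auto
  next
    case False
    then obtain b0 where b0: "b0 \<in> B" "A k b0 \<noteq> 0" by blast
    define B' where "B' = B - {b0}"
    \<comment> \<open>The system left after eliminating the pivot unknown \<open>b0\<close> with
      equation \<open>k\<close>; \<open>x\<close> below is the back-substituted value.\<close>
    define A' where "A' i b = A i b - A i b0 * A k b / A k b0" for i b
    have B': "finite B'" "card K < card B'"
      using insert.prems insert.hyps b0 by (auto simp: B'_def)
    obtain \<beta> where \<beta>: "\<exists>b\<in>B'. \<beta> b \<noteq> 0" "\<And>i. i \<in> K \<Longrightarrow> (\<Sum>b\<in>B'. \<beta> b * A' i b) = 0"
      using insert.IH[OF B', of A'] by blast
    define x where "x = - (\<Sum>b\<in>B'. \<beta> b * A k b) / A k b0"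
    define \<alpha> where "\<alpha> = \<beta>(b0 := x)"
    have sum: "(\<Sum>b\<in>B. \<alpha> b * A i b) = x * A i b0 + (\<Sum>b\<in>B'. \<beta> b * A i b)" for i
    proof -
      have "(\<Sum>b\<in>B'. \<alpha> b * A i b) = (\<Sum>b\<in>B'. \<beta> b * A i b)"
        by (intro sum.cong) (auto simp: \<alpha>_def B'_def)
      then show ?thesis
        using sum.remove[OF insert.prems(1) b0(1), of "\<lambda>b. \<alpha> b * A i b"] by (simp add: B'_def \<alpha>_def)
    qed
    have "(\<Sum>b\<in>B. \<alpha> b * A i b) = 0" if "i \<in> insert k K" for i
    proof (cases "i = k")
      case True
      then show ?thesis using b0(2) by (simp add: sum x_def)
    next
      case False
      with that \<beta>(2) have "(\<Sum>b\<in>B'. \<beta> b * A' i b) = 0" by simp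
      also have "(\<Sum>b\<in>B'. \<beta> b * A' i b)
          = (\<Sum>b\<in>B'. \<beta> b * A i b) - (A i b0 / A k b0) * (\<Sum>b\<in>B'. \<beta> b * A k b)"
        unfolding A'_def sum_distrib_left sum_subtractf[symmetric]
        by (intro sum.cong) (auto simp: algebra_simps)
      finally show ?thesis by (simp add: sum x_def mult.commute)
    qed
    moreover have "\<exists>b\<in>B. \<alpha> b \<noteq> 0"
      using \<beta>(1) by (auto simp: \<alpha>_def B'_def)
    ultimately show ?thesis by blast
  qed
qed

section \<open>Linear combinations of square integrable functions and of weak derivatives\<close>

lemma borel_measurable_cnj [measurable]: "cnj \<in> borel_measurable borel"
  by (intro borel_measurable_continuous_onI continuous_intros)

lemma integrable_mult_cnj:
  assumes "square_integrable M f" "square_integrable M g"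
  shows "integrable M (\<lambda>s. f s * cnj (g s))"
proof (rule Bochner_Integration.integrable_bound)
  show "integrable M (\<lambda>s. (cmod (f s))\<^sup>2 + (cmod (g s))\<^sup>2)"
    using assms by (auto simp: square_integrable_def)
  have [measurable]: "f \<in> borel_measurable M" "g \<in> borel_measurable M"
    using assms by (auto simp: square_integrable_def)
  show "(\<lambda>s. f s * cnj (g s)) \<in> borel_measurable M"
    by measurable
  have "a * c \<le> a\<^sup>2 + c\<^sup>2" if "0 \<le> a" "0 \<le> c" for a c :: real
  proof -
    have "0 \<le> (a - c)\<^sup>2" by simp
    then have "2 * (a * c) \<le> a\<^sup>2 + c\<^sup>2" by (simp add: power2_diff)
    moreover have "0 \<le> a * c" using that by simp
    ultimately show ?thesis by linarith
  qed
  then show "AE s in M. norm (f s * cnj (g s)) \<le> norm ((cmod (f s))\<^sup>2 + (cmod (g s))\<^sup>2)"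
    by (intro AE_I2) (simp add: norm_mult)
qed

lemma square_integrable_sum:
  assumes "\<And>j. j \<in> J \<Longrightarrow> square_integrable M (h j)"
  shows "square_integrable M (\<lambda>s. \<Sum>j\<in>J. \<alpha> j * h j s)"
  using assms
proof (induction J rule: infinite_finite_induct)
  case (insert j J)
  let ?f = "\<lambda>s. \<alpha> j * h j s" and ?g = "\<lambda>s. \<Sum>j\<in>J. \<alpha> j * h j s"
  have [measurable]: "h j \<in> borel_measurable M" "?g \<in> borel_measurable M"
    using insert by (auto simp: square_integrable_def)
  have int: "integrable M (\<lambda>s. 2 * (cmod (\<alpha> j))\<^sup>2 * (cmod (h j s))\<^sup>2 + 2 * (cmod (?g s))\<^sup>2)"
    using insert by (auto simp: square_integrable_def)
  have bound: "(cmod (x + y))\<^sup>2 \<le> 2 * (cmod x)\<^sup>2 + 2 * (cmod y)\<^sup>2" for x y :: complex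
  proof -
    have "(cmod (x + y))\<^sup>2 \<le> (cmod x + cmod y)\<^sup>2"
      by (intro power_mono norm_triangle_ineq) simp
    also have "\<dots> \<le> 2 * (cmod x)\<^sup>2 + 2 * (cmod y)\<^sup>2"
      using zero_le_power2[of "cmod x - cmod y"] by (simp add: power2_sum power2_diff)
    finally show ?thesis .
  qed
  have "integrable M (\<lambda>s. (cmod (?f s + ?g s))\<^sup>2)"
  proof (rule Bochner_Integration.integrable_bound[OF int])
    show "AE s in M. norm ((cmod (?f s + ?g s))\<^sup>2)
        \<le> norm (2 * (cmod (\<alpha> j))\<^sup>2 * (cmod (h j s))\<^sup>2 + 2 * (cmod (?g s))\<^sup>2)"
    proof (rule AE_I2)
      fix s
      show "norm ((cmod (?f s + ?g s))\<^sup>2)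
          \<le> norm (2 * (cmod (\<alpha> j))\<^sup>2 * (cmod (h j s))\<^sup>2 + 2 * (cmod (?g s))\<^sup>2)"
        using bound[of "?f s" "?g s"] by (simp add: norm_mult power_mult_distrib mult.assoc)
    qed
  qed measurable
  moreover have "(\<lambda>s. ?f s + ?g s) \<in> borel_measurable M" by measurable
  ultimately show ?case using insert.hyps by (simp add: square_integrable_def)
qed (simp_all add: square_integrable_def)

lemma integral_cmod_sum_power2:
  assumes "\<And>j. j \<in> J \<Longrightarrow> square_integrable M (h j)"
  shows "complex_of_real (LINT s|M. (cmod (\<Sum>j\<in>J. \<alpha> j * h j s))\<^sup>2)
    = (\<Sum>i\<in>J. \<Sum>j\<in>J. \<alpha> i * cnj (\<alpha> j) * (LINT s|M. h i s * cnj (h j s)))"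
proof -
  have "complex_of_real ((cmod (\<Sum>j\<in>J. \<alpha> j * h j s))\<^sup>2)
      = (\<Sum>i\<in>J. \<Sum>j\<in>J. \<alpha> i * cnj (\<alpha> j) * (h i s * cnj (h j s)))" for s
    unfolding complex_norm_square cnj_sum sum_product by (simp add: algebra_simps)
  then have "complex_of_real (LINT s|M. (cmod (\<Sum>j\<in>J. \<alpha> j * h j s))\<^sup>2)
      = (LINT s|M. (\<Sum>i\<in>J. \<Sum>j\<in>J. \<alpha> i * cnj (\<alpha> j) * (h i s * cnj (h j s))))"
    by (simp flip: integral_complex_of_real)
  also have "\<dots> = (\<Sum>i\<in>J. \<Sum>j\<in>J. \<alpha> i * cnj (\<alpha> j) * (LINT s|M. h i s * cnj (h j s)))"
  proof -
    have int: "integrable M (\<lambda>s. \<alpha> i * cnj (\<alpha> j) * (h i s * cnj (h j s)))" if "i \<in> J" "j \<in> J" for i j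
      using assms that by (intro integrable_mult_right integrable_mult_cnj)
    have "(LINT s|M. (\<Sum>i\<in>J. \<Sum>j\<in>J. \<alpha> i * cnj (\<alpha> j) * (h i s * cnj (h j s))))
        = (\<Sum>i\<in>J. (LINT s|M. (\<Sum>j\<in>J. \<alpha> i * cnj (\<alpha> j) * (h i s * cnj (h j s)))))"
      by (intro Bochner_Integration.integral_sum Bochner_Integration.integrable_sum int)
    also have "\<dots> = (\<Sum>i\<in>J. \<Sum>j\<in>J. (LINT s|M. \<alpha> i * cnj (\<alpha> j) * (h i s * cnj (h j s))))"
      by (intro sum.cong refl Bochner_Integration.integral_sum int)
    finally show ?thesis by simp
  qed
  finally show ?thesis .
qed

text \<open>The support is widened to its interval hull, which stays in \<open>J\<close> because
  \<open>J\<close> is an interval; \<open>\<phi>\<close> vanishes on the open complement, hence so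
  does its derivative.\<close>

lemma test_function_D:
  assumes "\<phi> \<in> test_functions J" "is_interval J"
  obtains c d where "{c..d} \<subseteq> J" "\<And>s. s \<notin> {c..d} \<Longrightarrow> \<phi> s = 0" "\<And>s. s \<notin> {c..d} \<Longrightarrow> deriv \<phi> s = 0"
    "continuous_on UNIV \<phi>" "continuous_on UNIV (deriv \<phi>)" "\<And>s. (\<phi> has_real_derivative deriv \<phi> s) (at s)"
proof -
  from assms(1) obtain K where K: "compact K" "K \<subseteq> J" "\<And>s. s \<notin> K \<Longrightarrow> \<phi> s = 0"
    and diff: "\<phi> differentiable_on UNIV" and dc: "continuous_on UNIV (deriv \<phi>)"
    unfolding test_functions_def by blast
  have deriv: "(\<phi> has_real_derivative deriv \<phi> s) (at s)" for s
    using diff by (simp add: differentiable_on_def DERIV_deriv_iff_real_differentiable)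
  obtain c d where cd: "{c..d} \<subseteq> J" "K \<subseteq> {c..d}"
  proof (cases "K = {}")
    case True
    \<comment> \<open>\<open>{1..0}\<close> is the empty interval.\<close>
    then show thesis by (intro that[of 1 0]) auto
  next
    case False
    obtain c where c: "c \<in> K" "\<And>s. s \<in> K \<Longrightarrow> c \<le> s" using compact_attains_inf[OF K(1) False] by blast
    obtain d where d: "d \<in> K" "\<And>s. s \<in> K \<Longrightarrow> s \<le> d" using compact_attains_sup[OF K(1) False] by blast
    have "c \<in> J" "d \<in> J" using c(1) d(1) K(2) by blast+
    then have "{c..d} \<subseteq> J"
      using mem_is_interval_1_I[OF assms(2)] by (meson atLeastAtMost_iff subsetI)
    moreover have "K \<subseteq> {c..d}" using c(2) d(2) by auto
    ultimately show thesis by (rule that)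
  qed
  show thesis
  proof (rule that[OF cd(1)])
    show \<phi>_0: "\<phi> s = 0" if "s \<notin> {c..d}" for s using K(3) cd(2) that by blast
    show "deriv \<phi> s = 0" if "s \<notin> {c..d}" for s
    proof (rule DERIV_unique[OF deriv])
      show "(\<phi> has_real_derivative 0) (at s)"
      proof (rule has_field_derivative_transform_within_open)
        show "((\<lambda>_. 0) has_real_derivative 0) (at s)" by simp
        show "open (- {c..d})" by (intro open_Compl closed_atLeastAtMost)
        show "s \<in> - {c..d}" using that by simp
        show "0 = \<phi> x" if "x \<in> - {c..d}" for x using \<phi>_0[of x] that by simp
      qed
    qed
    show "continuous_on UNIV \<phi>"
      using deriv by (meson DERIV_isCont continuous_at_imp_continuous_on)
  qed (use dc deriv in auto)
qed

lemma set_integrable_mult_compact_support: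
  fixes f :: "real \<Rightarrow> complex"
  assumes \<psi>: "continuous_on UNIV \<psi>" "\<And>s. s \<notin> {c..d} \<Longrightarrow> \<psi> s = (0::real)" and f: "set_integrable lborel {c..d} f"
    and J: "J \<in> sets borel" "{c..d} \<subseteq> J"
  shows "set_integrable lborel J (\<lambda>s. \<psi> s *\<^sub>R f s)"
proof -
  have f': "integrable lborel (\<lambda>s. indicator {c..d} s *\<^sub>R f s)"
    using f unfolding set_integrable_def .
  have "bounded (\<psi> ` {c..d})"
    by (intro compact_imp_bounded compact_continuous_image continuous_on_subset[OF \<psi>(1)]) auto
  then obtain B where "\<forall>x\<in>\<psi> ` {c..d}. norm x \<le> B"
    unfolding bounded_iff by blast
  then have B: "\<bar>\<psi> s\<bar> \<le> \<bar>B\<bar>" for s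
  proof (cases "s \<in> {c..d}")
    case True
    with \<open>\<forall>x\<in>\<psi> ` {c..d}. norm x \<le> B\<close> have "norm (\<psi> s) \<le> B" by blast
    then show ?thesis by simp
  qed (simp add: \<psi>(2))
  have \<psi>m [measurable]: "\<psi> \<in> borel_measurable borel"
    by (rule borel_measurable_continuous_onI[OF \<psi>(1)])
  have "integrable lborel (\<lambda>s. \<psi> s *\<^sub>R (indicator {c..d} s *\<^sub>R f s))"
  proof (rule Bochner_Integration.integrable_bound[OF integrable_scaleR_right[of B, OF f']])
    show "(\<lambda>s. \<psi> s *\<^sub>R (indicator {c..d} s *\<^sub>R f s)) \<in> borel_measurable lborel"
      using borel_measurable_integrable[OF f'] by measurable
    show "AE s in lborel. norm (\<psi> s *\<^sub>R (indicator {c..d} s *\<^sub>R f s)) \<le> norm (B *\<^sub>R (indicator {c..d} s *\<^sub>R f s))"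
    proof (rule AE_I2)
      fix s show "norm (\<psi> s *\<^sub>R (indicator {c..d} s *\<^sub>R f s)) \<le> norm (B *\<^sub>R (indicator {c..d} s *\<^sub>R f s))"
        unfolding norm_scaleR[of "\<psi> s"] norm_scaleR[of B] by (intro mult_right_mono B) simp
    qed
  qed
  moreover have "\<psi> s *\<^sub>R (indicator {c..d} s *\<^sub>R f s) = indicator J s *\<^sub>R \<psi> s *\<^sub>R f s" for s
    using \<psi>(2)[of s] J(2) by (auto simp: indicator_def)
  ultimately show ?thesis unfolding set_integrable_def by (simp only:)
qed

text \<open>The summands are only locally integrable; the compact support of the test function makes
  each product integrable, so sum and integral may be exchanged.\<close>

lemma weak_deriv_on_sum:
  assumes J: "is_interval J" "J \<in> sets borel"
    and f: "\<And>j c d. j \<in> X \<Longrightarrow> {c..d} \<subseteq> J \<Longrightarrow> set_integrable lborel {c..d} (f j)"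
    and g: "\<And>j c d. j \<in> X \<Longrightarrow> {c..d} \<subseteq> J \<Longrightarrow> set_integrable lborel {c..d} (g j)"
    and wd: "\<And>j. j \<in> X \<Longrightarrow> weak_deriv_on J (f j) (g j)"
  shows "weak_deriv_on J (\<lambda>s. \<Sum>j\<in>X. \<alpha> j * f j s) (\<lambda>s. \<Sum>j\<in>X. \<alpha> j * g j s)"
  unfolding weak_deriv_on_def
proof
  fix \<phi> assume \<phi>: "\<phi> \<in> test_functions J"
  obtain c d where cd: "{c..d} \<subseteq> J" "\<And>s. s \<notin> {c..d} \<Longrightarrow> \<phi> s = 0" "\<And>s. s \<notin> {c..d} \<Longrightarrow> deriv \<phi> s = 0"
    "continuous_on UNIV \<phi>" "continuous_on UNIV (deriv \<phi>)" "\<And>s. (\<phi> has_real_derivative deriv \<phi> s) (at s)"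
    using test_function_D[OF \<phi> J(1)] by metis
  have sum: "(LINT s:J|lborel. \<psi> s *\<^sub>R (\<Sum>j\<in>X. \<alpha> j * h j s)) = (\<Sum>j\<in>X. \<alpha> j * (LINT s:J|lborel. \<psi> s *\<^sub>R h j s))"
    if \<psi>: "continuous_on UNIV \<psi>" "\<And>s. s \<notin> {c..d} \<Longrightarrow> \<psi> s = 0"
      and h: "\<And>j c d. j \<in> X \<Longrightarrow> {c..d} \<subseteq> J \<Longrightarrow> set_integrable lborel {c..d} (h j)" for \<psi> h
  proof -
    have int: "integrable lborel (\<lambda>s. indicator J s *\<^sub>R \<psi> s *\<^sub>R h j s)" if "j \<in> X" for j
      using set_integrable_mult_compact_support[OF \<psi> h[OF that cd(1)] J(2) cd(1)] unfolding set_integrable_def .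
    have "(LINT s:J|lborel. \<psi> s *\<^sub>R (\<Sum>j\<in>X. \<alpha> j * h j s))
        = (LINT s|lborel. (\<Sum>j\<in>X. \<alpha> j * (indicator J s *\<^sub>R \<psi> s *\<^sub>R h j s)))"
      unfolding set_lebesgue_integral_def by (simp add: scaleR_sum_right)
    also have "\<dots> = (\<Sum>j\<in>X. (LINT s|lborel. \<alpha> j * (indicator J s *\<^sub>R \<psi> s *\<^sub>R h j s)))"
      by (intro Bochner_Integration.integral_sum integrable_mult_right int)
    finally show ?thesis
      unfolding set_lebesgue_integral_def integral_mult_right_zero .
  qed
  have "(LINT s:J|lborel. deriv \<phi> s *\<^sub>R (\<Sum>j\<in>X. \<alpha> j * f j s)) = (\<Sum>j\<in>X. \<alpha> j * (LINT s:J|lborel. deriv \<phi> s *\<^sub>R f j s))"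
    by (rule sum) (use cd f in auto)
  also have "\<dots> = (\<Sum>j\<in>X. \<alpha> j * - (LINT s:J|lborel. \<phi> s *\<^sub>R g j s))"
    using wd \<phi> by (intro sum.cong) (auto simp: weak_deriv_on_def)
  also have "\<dots> = - (LINT s:J|lborel. \<phi> s *\<^sub>R (\<Sum>j\<in>X. \<alpha> j * g j s))"
    by (subst sum) (use cd g in \<open>auto simp: sum_negf\<close>)
  finally show "(LINT s:J|lborel. deriv \<phi> s *\<^sub>R (\<Sum>j\<in>X. \<alpha> j * f j s))
      = - (LINT s:J|lborel. \<phi> s *\<^sub>R (\<Sum>j\<in>X. \<alpha> j * g j s))" .
qed

section \<open>Half-lines beyond an edge\<close>

locale rooted_metric_tree =
  fixes T :: "('v, 'z) rooted_tree_scheme"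
  assumes metric_tree: "metric_tree T"
begin

abbreviation "r \<equiv> origin T"

lemma finite_verts: "finite (verts T)" and origin_in_verts: "r \<in> verts T"
  and arcs_verts: "arcs T \<subseteq> verts T \<times> verts T" and no_arc_to_origin: "(u, r) \<notin> arcs T"
  and len_pos: "a \<in> arcs T \<Longrightarrow> 0 < len T a" and reachable: "v \<in> verts T \<Longrightarrow> (r, v) \<in> (arcs T)\<^sup>*"
  and rays_pos_iff: "v \<in> verts T \<Longrightarrow> 0 < rays T v \<longleftrightarrow> v \<in> leaves T"
  and leaves_nonempty: "leaves T \<noteq> {}"
  using metric_tree unfolding metric_tree_def by auto

lemma parent_exists: "v \<in> verts T \<Longrightarrow> v \<noteq> r \<Longrightarrow> \<exists>u. (u, v) \<in> arcs T"
  using metric_tree unfolding metric_tree_def by blast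

lemma parent_unique:
  assumes "(u, v) \<in> arcs T" "(u', v) \<in> arcs T"
  shows "u = u'"
proof -
  have "v \<in> verts T - {r}"
    using assms arcs_verts no_arc_to_origin by blast
  then have "\<exists>!u. (u, v) \<in> arcs T"
    using metric_tree unfolding metric_tree_def by blast
  with assms show ?thesis by blast
qed

lemma finite_arcs: "finite (arcs T)"
  by (rule finite_subset[OF arcs_verts finite_cartesian_product[OF finite_verts finite_verts]])

lemma path_length_unique: "path_length T v d \<Longrightarrow> path_length T v d' \<Longrightarrow> d = d'"
proof (induction arbitrary: d' rule: path_length.induct)
  case root
  from root.prems show ?case
    by (cases rule: path_length.cases) (use no_arc_to_origin in auto)
next
  case (step u d v)
  from step.prems show ?case
  proof (cases rule: path_length.cases)
    case root
    then show ?thesis using step.hyps no_arc_to_origin by auto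
  next
    case (step u' d'')
    moreover from this have "u' = u" using \<open>(u, v) \<in> arcs T\<close> parent_unique by blast
    ultimately show ?thesis using step.IH by auto
  qed
qed

lemma path_length_depth:
  assumes "v \<in> verts T"
  shows "path_length T v (depth T v)"
proof -
  from reachable[OF assms] have "\<exists>d. path_length T v d"
    by (induction rule: rtrancl_induct) (auto intro: path_length.intros)
  then show ?thesis
    unfolding depth_def by (metis (mono_tags, lifting) path_length_unique theI)
qed

lemma depth_eq: "path_length T v d \<Longrightarrow> depth T v = d"
  unfolding depth_def using path_length_unique by blast

lemma depth_origin: "depth T r = 0"
  by (rule depth_eq) (rule path_length.root)

lemma depth_arc: "(u, v) \<in> arcs T \<Longrightarrow> depth T v = depth T u + len T (u, v)"
  using arcs_verts by (intro depth_eq path_length.step path_length_depth) auto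

lemma depth_arc_less: "(u, v) \<in> arcs T \<Longrightarrow> depth T u < depth T v"
  using depth_arc len_pos by force

lemma depth_mono: "(u, v) \<in> (arcs T)\<^sup>* \<Longrightarrow> depth T u \<le> depth T v"
  by (induction rule: rtrancl_induct) (auto dest: depth_arc_less)

lemma depth_nonneg: "v \<in> verts T \<Longrightarrow> 0 \<le> depth T v"
  using depth_mono[OF reachable] depth_origin by simp

lemma depth_pos: "v \<in> verts T \<Longrightarrow> v \<noteq> r \<Longrightarrow> 0 < depth T v"
  by (meson arcs_verts depth_arc_less depth_nonneg mem_Sigma_iff order_le_less_trans parent_exists subsetD)

text \<open>A vertex has at most one parent, so the way back from \<open>w\<close> is determined,
  and one of the two ancestors is met on the way to the other.\<close>

lemma ancestors_comparable:
  assumes "(x, w) \<in> (arcs T)\<^sup>*" "(y, w) \<in> (arcs T)\<^sup>*"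
  shows "(x, y) \<in> (arcs T)\<^sup>* \<or> (y, x) \<in> (arcs T)\<^sup>*"
proof -
  have "single_valued ((arcs T)\<inverse>)"
    using parent_unique by (auto simp: single_valued_def)
  from single_valued_confluent[OF this, of w x y] assms show ?thesis
    by (auto simp: rtrancl_converse)
qed

lemma ancestor_of_parent:
  assumes "(x, y) \<in> (arcs T)\<^sup>*" "x \<noteq> y" "(p, y) \<in> arcs T"
  shows "(x, p) \<in> (arcs T)\<^sup>*"
  using assms by (metis parent_unique rtranclE)

definition children :: "'v \<Rightarrow> 'v set" where
  "children v = {x. (v, x) \<in> arcs T}"

text \<open>A set rather than a number because half-lines are used twice: their count weights the
  edges, and they index the points at a given distance from the root.\<close>

definition rays_below :: "'v \<Rightarrow> 'v edge set" where
  "rays_below v = {Ray w i | w i. w \<in> verts T \<and> i < rays T w \<and> (v, w) \<in> (arcs T)\<^sup>*}"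

fun edge_rays :: "'v edge \<Rightarrow> 'v edge set" where
  "edge_rays (Bond u v) = rays_below v"
| "edge_rays (Ray w i) = {Ray w i}"

lemma edges_eq:
  "edges T = (\<lambda>(u, v). Bond u v) ` arcs T \<union> (\<lambda>(v, i). Ray v i) ` (SIGMA v:verts T. {..<rays T v})"
  by (auto simp: edges_def image_iff)

lemma finite_edges: "finite (edges T)"
  unfolding edges_eq using finite_arcs finite_verts by auto

lemma finite_children: "finite (children v)"
  using finite_arcs by (rule finite_surj[where f = snd]) (force simp: children_def)

lemma finite_rays_below: "finite (rays_below v)"
  by (rule finite_subset[OF _ finite_edges]) (auto simp: rays_below_def edges_def)

lemma rays_below_origin: "rays_below r = {e \<in> edges T. \<exists>w i. e = Ray w i}"
  using reachable by (auto simp: rays_below_def edges_def)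

lemma edge_rays_subset: "e \<in> edges T \<Longrightarrow> edge_rays e \<subseteq> rays_below r"
  unfolding rays_below_origin by (cases e) (auto simp: rays_below_def edges_def)

lemma rays_below_disjoint:
  assumes "x \<in> children v" "y \<in> children v" "x \<noteq> y"
  shows "rays_below x \<inter> rays_below y = {}"
proof (rule ccontr)
  have no: "(x, y) \<notin> (arcs T)\<^sup>*" if "x \<in> children v" "y \<in> children v" "x \<noteq> y" for x y
  proof
    assume "(x, y) \<in> (arcs T)\<^sup>*"
    moreover have vx: "(v, x) \<in> arcs T" and vy: "(v, y) \<in> arcs T"
      using that by (simp_all add: children_def)
    ultimately have "(x, v) \<in> (arcs T)\<^sup>*"
      using that(3) by (blast intro: ancestor_of_parent)
    then show False
      using depth_mono[of x v] depth_arc_less[OF vx] by simp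
  qed
  assume "rays_below x \<inter> rays_below y \<noteq> {}"
  then obtain w where "(x, w) \<in> (arcs T)\<^sup>*" "(y, w) \<in> (arcs T)\<^sup>*"
    by (auto simp: rays_below_def)
  then show False
    using no[OF assms] no[OF assms(2,1) assms(3)[symmetric]] ancestors_comparable by blast
qed

text \<open>Conservation of the flow: away from the root, the weight of the arc into
  \<open>v\<close> is the total weight of the edges leaving \<open>v\<close>, each half-line
  counting 1.\<close>

lemma card_rays_below:
  assumes v: "v \<in> verts T"
  shows "card (rays_below v) = (\<Sum>x\<in>children v. card (rays_below x)) + rays T v"
proof -
  have eq: "rays_below v = (\<Union>x\<in>children v. rays_below x) \<union> Ray v ` {..<rays T v}"
  proof (intro equalityI subsetI)
    fix e assume "e \<in> rays_below v"
    then obtain w i where e: "e = Ray w i" "w \<in> verts T" "i < rays T w" "(v, w) \<in> (arcs T)\<^sup>*"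
      by (auto simp: rays_below_def)
    from e(4) show "e \<in> (\<Union>x\<in>children v. rays_below x) \<union> Ray v ` {..<rays T v}"
      by (cases rule: converse_rtranclE) (use e in \<open>auto simp: rays_below_def children_def\<close>)
  qed (use v in \<open>auto simp: rays_below_def children_def intro: converse_rtrancl_into_rtrancl\<close>)
  have "(\<Union>x\<in>children v. rays_below x) \<inter> Ray v ` {..<rays T v} = {}"
  proof -
    have "(x, v) \<notin> (arcs T)\<^sup>*" if "x \<in> children v" for x
      using depth_mono[of x v] depth_arc_less[of v x] that by (auto simp: children_def)
    then show ?thesis by (auto simp: rays_below_def)
  qed
  then have "card (rays_below v) = card (\<Union>x\<in>children v. rays_below x) + card (Ray v ` {..<rays T v})"
    unfolding eq by (intro card_Un_disjoint) (auto simp: finite_children finite_rays_below)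
  also have "card (\<Union>x\<in>children v. rays_below x) = (\<Sum>x\<in>children v. card (rays_below x))"
    using rays_below_disjoint by (intro card_UN_disjoint) (auto simp: finite_children finite_rays_below)
  also have "card (Ray v ` {..<rays T v}) = rays T v"
    by (subst card_image) (auto simp: inj_on_def)
  finally show ?thesis .
qed

text \<open>The potential difference across a half-line is taken with value \<open>0\<close> at infinity.\<close>

fun potential_drop :: "('v \<Rightarrow> real) \<Rightarrow> 'v edge \<Rightarrow> real" where
  "potential_drop P (Bond u v) = P v - P u"
| "potential_drop P (Ray v i) = - P v"

text \<open>Summation by parts: what a vertex gains in the drop along its incoming arc it loses
  along its outgoing edges by \<open>card_rays_below\<close>. Only the root has no incoming
  arc.\<close>

lemma sum_edge_rays_potential_drop:
  "(\<Sum>e\<in>edges T. real (card (edge_rays e)) * potential_drop P e) = - real (card (rays_below r)) * P r"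
proof -
  define c where "c v = real (card (rays_below v))" for v
  have arcs_Sigma: "arcs T = (SIGMA u:verts T. children u)"
    using arcs_verts by (auto simp: children_def)
  have "(\<Sum>e\<in>edges T. real (card (edge_rays e)) * potential_drop P e)
      = (\<Sum>e\<in>(\<lambda>(u, v). Bond u v) ` arcs T. real (card (edge_rays e)) * potential_drop P e)
      + (\<Sum>e\<in>(\<lambda>(v, i). Ray v i) ` (SIGMA v:verts T. {..<rays T v}). real (card (edge_rays e)) * potential_drop P e)"
    unfolding edges_eq by (rule sum.union_disjoint) (auto simp: finite_arcs finite_verts)
  also have "(\<Sum>e\<in>(\<lambda>(u, v). Bond u v) ` arcs T. real (card (edge_rays e)) * potential_drop P e)
      = (\<Sum>(u, v)\<in>arcs T. c v * P v) - (\<Sum>(u, v)\<in>arcs T. c v * P u)"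
    by (subst sum.reindex) (auto simp: inj_on_def c_def case_prod_beta right_diff_distrib sum_subtractf)
  also have "(\<Sum>(u, v)\<in>arcs T. c v * P v) = (\<Sum>v\<in>verts T - {r}. c v * P v)"
  proof -
    have "bij_betw snd (arcs T) (verts T - {r})"
      unfolding bij_betw_def
    proof
      show "inj_on snd (arcs T)"
        using parent_unique by (auto simp: inj_on_def)
      show "snd ` arcs T = verts T - {r}"
        using arcs_verts no_arc_to_origin parent_exists by (force simp: image_iff)
    qed
    from sum.reindex_bij_betw[OF this, of "\<lambda>v. c v * P v"] show ?thesis
      by (simp add: case_prod_beta)
  qed
  also have "(\<Sum>(u, v)\<in>arcs T. c v * P u) = (\<Sum>u\<in>verts T. (\<Sum>x\<in>children u. c x) * P u)"
    unfolding arcs_Sigma sum_distrib_right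
    by (rule sum.Sigma[symmetric]) (auto simp: finite_verts finite_children)
  also have "(\<Sum>e\<in>(\<lambda>(v, i). Ray v i) ` (SIGMA v:verts T. {..<rays T v}). real (card (edge_rays e)) * potential_drop P e)
      = (\<Sum>v\<in>verts T. - (real (rays T v) * P v))"
  proof -
    have "(\<Sum>e\<in>(\<lambda>(v, i). Ray v i) ` (SIGMA v:verts T. {..<rays T v}). real (card (edge_rays e)) * potential_drop P e)
        = (\<Sum>(v, i)\<in>(SIGMA v:verts T. {..<rays T v}). - P v)"
      by (subst sum.reindex) (auto simp: inj_on_def case_prod_beta)
    also have "\<dots> = (\<Sum>v\<in>verts T. \<Sum>i<rays T v. - P v)"
      by (rule sum.Sigma[symmetric]) (auto simp: finite_verts)
    finally show ?thesis by simp
  qed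
  also have "(\<Sum>v\<in>verts T - {r}. c v * P v) - (\<Sum>u\<in>verts T. (\<Sum>x\<in>children u. c x) * P u)
      + (\<Sum>v\<in>verts T. - (real (rays T v) * P v))
      = (\<Sum>v\<in>verts T - {r}. c v * P v) - (\<Sum>v\<in>verts T. c v * P v)"
  proof -
    have "c v = (\<Sum>x\<in>children v. c x) + real (rays T v)" if "v \<in> verts T" for v
      using card_rays_below[OF that] by (simp add: c_def)
    then have "(\<Sum>v\<in>verts T. c v * P v) = (\<Sum>v\<in>verts T. (\<Sum>x\<in>children v. c x) * P v + real (rays T v) * P v)"
      by (intro sum.cong) (auto simp: distrib_right)
    then show ?thesis by (simp add: sum.distrib sum_negf)
  qed
  also have "\<dots> = - c r * P r"
    using sum.remove[OF finite_verts origin_in_verts, of "\<lambda>v. c v * P v"] by simp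
  finally show ?thesis by (simp add: c_def)
qed

text \<open>The initial vertex is left out, so that a vertex belongs to its incoming edge only and
  the pieces along a path from the root do not overlap.\<close>

fun edge_ivl_left_open :: "'v edge \<Rightarrow> real set" where
  "edge_ivl_left_open (Bond u v) = {depth T u<..depth T v}"
| "edge_ivl_left_open (Ray v i) = {depth T v<..}"

text \<open>Both edges lie on the path from the root into \<open>\<rho>\<close>. If they differed,
  one would end no farther from the root than the other starts, and no \<open>z\<close> would fit
  both.\<close>

lemma edge_through_ray_unique:
  assumes e: "e \<in> edges T" "\<rho> \<in> edge_rays e" "z \<in> edge_ivl_left_open e"
    and e': "e' \<in> edges T" "\<rho> \<in> edge_rays e'" "z \<in> edge_ivl_left_open e'"
  shows "e = e'"
proof -
  have bond_bond: "v = v'"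
    if "(v, w) \<in> (arcs T)\<^sup>*" "(v', w) \<in> (arcs T)\<^sup>*" "(u, v) \<in> arcs T" "(u', v') \<in> arcs T"
      "z \<in> {depth T u<..depth T v}" "z \<in> {depth T u'<..depth T v'}" for u v u' v' w
  proof (rule ccontr)
    have no: False if "(v, v') \<in> (arcs T)\<^sup>*" "v \<noteq> v'" "(u', v') \<in> arcs T"
      "z \<le> depth T v" "depth T u' < z" for v v' u'
      using depth_mono[OF ancestor_of_parent[OF that(1-3)]] that by simp
    assume "v \<noteq> v'"
    with ancestors_comparable[OF that(1,2)] show False
      using no[of v v' u'] no[of v' v u] that by auto
  qed
  have bond_ray: False
    if "(v, w) \<in> (arcs T)\<^sup>*" "z \<le> depth T v" "depth T w < z" for v w
    using depth_mono[OF that(1)] that by simp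
  show ?thesis
  proof (cases e)
    case [simp]: (Bond u v)
    show ?thesis
    proof (cases e')
      case [simp]: (Bond u' v')
      from e e' obtain w where "(v, w) \<in> (arcs T)\<^sup>*" "(v', w) \<in> (arcs T)\<^sup>*"
        by (auto simp: rays_below_def)
      moreover have arcs: "(u, v) \<in> arcs T" "(u', v') \<in> arcs T"
        using e e' by (auto simp: edges_def)
      ultimately have "v = v'"
        using e e' bond_bond[of v w v' u u'] by simp
      with arcs parent_unique show ?thesis by simp
    next
      case [simp]: (Ray w i)
      show ?thesis using e e' bond_ray[of v w] by (auto simp: rays_below_def)
    qed
  next
    case [simp]: (Ray w i)
    show ?thesis
    proof (cases e')
      case [simp]: (Bond u' v')
      show ?thesis using e e' bond_ray[of v' w] by (auto simp: rays_below_def)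
    next
      case (Ray w' i')
      then show ?thesis using e e' by simp
    qed
  qed
qed

text \<open>The point at distance \<open>z\<close> on the path from the root into
  \<open>\<rho>\<close>. Were there no such edge, the value would be unspecified, which could only
  add a harmless constraint later.\<close>

definition point_on_ray :: "'v edge \<Rightarrow> real \<Rightarrow> 'v point" where
  "point_on_ray \<rho> z = chart T (THE e. e \<in> edges T \<and> \<rho> \<in> edge_rays e \<and> z \<in> edge_ivl_left_open e) z"

lemma point_on_ray_eq:
  assumes "e \<in> edges T" "\<rho> \<in> edge_rays e" "z \<in> edge_ivl_left_open e"
  shows "point_on_ray \<rho> z = chart T e z"
proof -
  have "(THE e. e \<in> edges T \<and> \<rho> \<in> edge_rays e \<and> z \<in> edge_ivl_left_open e) = e"
    by (rule the_equality) (use assms edge_through_ray_unique in blast)+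
  then show ?thesis by (simp add: point_on_ray_def)
qed

text \<open>Choosing any half-line beyond the edge names the point. Thus no distance is attained at
  more points than there are half-lines.\<close>

lemma chart_is_point_on_ray:
  assumes nonempty: "\<And>e. e \<in> edges T \<Longrightarrow> edge_rays e \<noteq> {}"
    and e: "e \<in> edges T" "z \<in> edge_ivl T e" and z: "0 < z"
  shows "\<exists>\<rho>\<in>rays_below r. chart T e z = point_on_ray \<rho> z"
proof -
  have left_open: "\<exists>\<rho>\<in>rays_below r. chart T e z = point_on_ray \<rho> z"
    if "e \<in> edges T" "z \<in> edge_ivl_left_open e" for e
    using nonempty[OF that(1)] edge_rays_subset[OF that(1)] point_on_ray_eq[OF that(1) _ that(2)] by fastforce
  show ?thesis
  proof (cases "z \<in> edge_ivl_left_open e")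
    case False
    \<comment> \<open>What remains is the initial vertex of \<open>e\<close>. As \<open>z\<close> is
      positive it is not the root, so it is also the end of the arc from its parent.\<close>
    obtain v where v: "v \<in> verts T" "z = depth T v" "chart T e z = Vert v"
      using e False arcs_verts by (cases e) (auto simp: edges_def)
    then have "v \<noteq> r" using z depth_origin by auto
    with v parent_exists obtain u where u: "(u, v) \<in> arcs T" by blast
    have "\<exists>\<rho>\<in>rays_below r. chart T (Bond u v) z = point_on_ray \<rho> z"
      by (rule left_open) (use u v depth_arc_less[OF u] in \<open>auto simp: edges_def\<close>)
    moreover have "chart T (Bond u v) z = chart T e z"
      using v depth_arc_less[OF u] by simp
    ultimately show ?thesis by simp
  qed (use left_open e in blast)
qed

end

section \<open>Counting half-lines in a regular tree\<close>

locale regular_metric_tree =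
  fixes T :: "('v, 'z) rooted_tree_scheme" and N :: nat and t :: "nat \<Rightarrow> real" and b :: "nat \<Rightarrow> nat"
  assumes regular: "regular_tree T N t b"

sublocale regular_metric_tree \<subseteq> rooted_metric_tree
  using regular by unfold_locales (simp add: regular_tree_def)

context regular_metric_tree
begin

lemma t_0: "t 0 = 0" and t_Suc: "k < N \<Longrightarrow> t k < t (Suc k)" and b_pos: "k \<le> N \<Longrightarrow> 0 < b k"
  and verts_levels: "verts T = (\<Union>k\<le>N. level T (t k))"
  and out_edges: "k \<le> N \<Longrightarrow> v \<in> level T (t k) \<Longrightarrow> out_edges T v = b k"
  and last_level: "level T (t N) = leaves T"
  using regular unfolding regular_tree_def by auto

lemma t_less: "i < j \<Longrightarrow> j \<le> N \<Longrightarrow> t i < t j"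
proof (induction j)
  case (Suc j)
  then show ?case using t_Suc[of j] by (cases "i = j") auto
qed simp

lemma t_less_iff: "i \<le> N \<Longrightarrow> j \<le> N \<Longrightarrow> t i < t j \<longleftrightarrow> i < j"
  using t_less[of i j] t_less[of j i] by (cases i j rule: linorder_cases) auto

lemma obtain_level:
  assumes "v \<in> verts T"
  obtains k where "k \<le> N" "depth T v = t k"
  using assms unfolding verts_levels by (auto simp: level_def)

lemma leaf_iff: "v \<in> verts T \<Longrightarrow> v \<in> leaves T \<longleftrightarrow> depth T v = t N"
  unfolding last_level[symmetric] by (simp add: level_def)

lemma leaf_no_children:
  assumes "v \<in> leaves T"
  shows "children v = {}"
proof (rule ccontr)
  assume "children v \<noteq> {}"
  then obtain x where x: "(v, x) \<in> arcs T" by (auto simp: children_def)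
  have v: "v \<in> verts T" "v \<noteq> r" "tree_degree T v = 1"
    using assms by (auto simp: leaves_def)
  with parent_exists obtain u where u: "(u, v) \<in> arcs T" by blast
  have "(u, v) \<noteq> (v, x)" using depth_arc_less[OF u] by auto
  then have "card {(u, v), (v, x)} = 2" by simp
  moreover have "card {(u, v), (v, x)} \<le> tree_degree T v"
    unfolding tree_degree_def using finite_arcs u x by (intro card_mono) auto
  ultimately show False using v(3) by simp
qed

lemma prod_b_antimono: "k \<le> k' \<Longrightarrow> (\<Prod>j=k'..N. b j) \<le> (\<Prod>j=k..N. b j)"
proof -
  assume "k \<le> k'"
  then have "(\<Prod>j=k..N. b j) = (\<Prod>j\<in>{k..N} - {k'..N}. b j) * (\<Prod>j=k'..N. b j)"
    by (intro prod.subset_diff) auto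
  moreover have "1 \<le> (\<Prod>j\<in>{k..N} - {k'..N}. b j)"
    using b_pos by (intro prod_ge_1) (auto simp: Suc_le_eq)
  ultimately show ?thesis by simp
qed

text \<open>The product is only an upper bound because arcs may skip levels: a child on level
  \<open>k' > k\<close> has the factors from \<open>k'\<close> on, and inserting the skipped
  positive ones does not decrease the product.\<close>

lemma card_rays_below_bounds:
  assumes "v \<in> verts T" "depth T v = t k" "k \<le> N"
  shows "1 \<le> card (rays_below v)" "card (rays_below v) \<le> (\<Prod>j=k..N. b j)"
proof -
  have "1 \<le> card (rays_below v) \<and> card (rays_below v) \<le> (\<Prod>j=k..N. b j)"
    using assms
  proof (induction "N - k" arbitrary: k v rule: less_induct)
    case less
    have out: "card (children v) + rays T v = b k"
      using out_edges[of k v] less.prems by (simp add: level_def out_edges_def children_def)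
    note sum = card_rays_below[OF less.prems(1)]
    show ?case
    proof (cases "k = N")
      case True
      then have "children v = {}"
        using less.prems leaf_iff leaf_no_children by simp
      then show ?thesis
        using sum out b_pos[of N] True by simp
    next
      case False
      with less.prems have kN: "k < N" by simp
      have "v \<notin> leaves T"
        using less.prems t_less[OF kN] by (simp add: leaf_iff)
      then have "rays T v = 0" using rays_pos_iff[OF less.prems(1)] by simp
      then have children: "card (children v) = b k" using out by simp
      have child: "1 \<le> card (rays_below x) \<and> card (rays_below x) \<le> (\<Prod>j=Suc k..N. b j)"
        if x: "x \<in> children v" for x
      proof -
        have xv: "x \<in> verts T" "(v, x) \<in> arcs T" using x arcs_verts by (auto simp: children_def)
        obtain k' where k': "k' \<le> N" "depth T x = t k'" by (rule obtain_level[OF xv(1)])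
        have "k < k'"
          using depth_arc_less[OF xv(2)] k' less.prems t_less_iff by simp
        then have "1 \<le> card (rays_below x) \<and> card (rays_below x) \<le> (\<Prod>j=k'..N. b j)"
          using k' xv kN by (intro less.hyps) auto
        with prod_b_antimono[of "Suc k" k'] \<open>k < k'\<close> show ?thesis by simp
      qed
      have "card (rays_below v) \<le> card (children v) * (\<Prod>j=Suc k..N. b j)"
        unfolding sum \<open>rays T v = 0\<close> using child sum_bounded_above[of "children v" "\<lambda>x. card (rays_below x)"]
        by simp
      also have "\<dots> = (\<Prod>j=k..N. b j)"
        unfolding children using kN by (simp add: prod.atLeast_Suc_atMost)
      finally have upper: "card (rays_below v) \<le> (\<Prod>j=k..N. b j)" .
      have "b k \<le> card (rays_below v)"
        unfolding sum \<open>rays T v = 0\<close> children[symmetric]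
        using child sum_bounded_below[of "children v" 1 "\<lambda>x. card (rays_below x)"] by simp
      with b_pos[OF less.prems(3)] upper show ?thesis by linarith
    qed
  qed
  then show "1 \<le> card (rays_below v)" "card (rays_below v) \<le> (\<Prod>j=k..N. b j)" by auto
qed

text \<open>An arc ends at level 1 or later, so the product starts at 1. This is the origin of the
  factor \<open>b 0\<close> in the final bound.\<close>

lemma card_edge_rays_bounds:
  assumes e: "e \<in> edges T"
  shows "1 \<le> card (edge_rays e)" "card (edge_rays e) \<le> (\<Prod>j=1..N. b j)"
proof -
  have "1 \<le> card (edge_rays e) \<and> card (edge_rays e) \<le> (\<Prod>j=1..N. b j)"
  proof (cases e)
    case (Bond u v)
    with e have uv: "(u, v) \<in> arcs T" "u \<in> verts T" "v \<in> verts T"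
      using arcs_verts by (auto simp: edges_def)
    obtain k where k: "k \<le> N" "depth T v = t k" by (rule obtain_level[OF uv(3)])
    have "k \<noteq> 0"
      using depth_arc_less[OF uv(1)] depth_nonneg[OF uv(2)] k t_0 by (metis less_le_not_le)
    with card_rays_below_bounds[OF uv(3) k(2,1)] prod_b_antimono[of 1 k] Bond show ?thesis by simp
  next
    case (Ray w i)
    have "1 \<le> (\<Prod>j=1..N. b j)"
      using b_pos by (intro prod_ge_1) (auto simp: Suc_le_eq)
    with Ray show ?thesis by simp
  qed
  then show "1 \<le> card (edge_rays e)" "card (edge_rays e) \<le> (\<Prod>j=1..N. b j)" by auto
qed

lemma prod_b_atMost: "(\<Prod>k\<le>N. b k) = b 0 * (\<Prod>j=1..N. b j)"
  by (simp add: atMost_atLeast0 prod.atLeast_Suc_atMost)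

lemma card_rays_le: "card (rays_below r) \<le> (\<Prod>k\<le>N. b k)"
  using card_rays_below_bounds(2)[of r 0] origin_in_verts depth_origin t_0 by (simp add: atMost_atLeast0)

end

section \<open>Lower bounds for the eigenvalues\<close>

text \<open>Elements of \<open>L2 T\<close> are functions, not classes, so a nonzero one could have
  norm 0; continuity on a nondegenerate interval excludes this.\<close>

lemma integral_gauss_on_pos:
  assumes f: "square_integrable (gauss_on I) f" and I: "I \<in> sets borel" "{c..d} \<subseteq> I" "c < d"
    and cont: "continuous_on {c..d} f" and s: "s \<in> {c..d}" "f s \<noteq> 0"
  shows "0 < (LINT s|gauss_on I. (cmod (f s))\<^sup>2)"
proof -
  have [measurable]: "f \<in> borel_measurable borel"
    by (rule square_integrable_gauss_on_borel[OF f])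
  define h where "h s = gauss s * (cmod (f s))\<^sup>2" for s
  have h_nn: "0 \<le> h s" for s using gauss_pos[of s] by (simp add: h_def)
  have h_c: "continuous_on {c..d} h"
    unfolding h_def by (intro continuous_intros continuous_on_gauss cont)
  have h_I: "set_integrable lborel I h"
    using f I(1) gauss_on_integral(1)[of I "\<lambda>s. (cmod (f s))\<^sup>2"]
    by (simp add: square_integrable_def h_def[abs_def])
  have h_cd: "set_integrable lborel {c..d} h"
    by (rule set_integrable_subset[OF h_I]) (use I in auto)
  have "h s \<noteq> 0"
    using s(2) gauss_pos[of s] by (simp add: h_def)
  then have "integral {c..d} h \<noteq> 0"
    using integral_eq_0_iff[OF h_c I(3) h_nn] s(1) by blast
  moreover have "0 \<le> integral {c..d} h"
    by (intro Henstock_Kurzweil_Integration.integral_nonneg set_borel_integral_eq_integral(1) h_cd h_nn)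
  ultimately have "0 < (LINT s:{c..d}|lborel. h s)"
    using set_borel_integral_eq_integral(2)[OF h_cd] by simp
  also have "\<dots> \<le> (LINT s:I|lborel. h s)"
    unfolding set_lebesgue_integral_def
    by (rule integral_mono) (use h_cd h_I h_nn I in \<open>auto simp: set_integrable_def indicator_def\<close>)
  also have "\<dots> = (LINT s|gauss_on I. (cmod (f s))\<^sup>2)"
    using I(1) by (subst gauss_on_integral(2)) (simp_all add: h_def[abs_def])
  finally show ?thesis .
qed

lemma sum_fun_apply: "(\<Sum>j\<in>J. h j) x = (\<Sum>j\<in>J. h j x)"
  by (induction J rule: infinite_finite_induct) auto

text \<open>Orthogonality removes the terms across eigenspaces; the bases inside an eigenspace are
  not orthonormalised and keep their double sums.\<close>

lemma sum_Sigma_block_diagonal: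
  fixes F :: "'c \<times> 'b \<Rightarrow> 'c \<times> 'b \<Rightarrow> 'a::comm_monoid_add"
  assumes C: "finite C" "\<And>c. c \<in> C \<Longrightarrow> finite (B c)"
    and zero: "\<And>i j. i \<in> Sigma C B \<Longrightarrow> j \<in> Sigma C B \<Longrightarrow> fst i \<noteq> fst j \<Longrightarrow> F i j = 0"
  shows "(\<Sum>i\<in>Sigma C B. \<Sum>j\<in>Sigma C B. F i j) = (\<Sum>c\<in>C. \<Sum>f\<in>B c. \<Sum>g\<in>B c. F (c, f) (c, g))"
proof -
  have inner: "(\<Sum>j\<in>Sigma C B. F i j) = (\<Sum>g\<in>B (fst i). F i (fst i, g))" if i: "i \<in> Sigma C B" for i
  proof -
    have "(\<Sum>j\<in>Sigma C B. F i j) = (\<Sum>c\<in>C. \<Sum>g\<in>B c. F i (c, g))"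
      using sum.Sigma[of C B "\<lambda>c g. F i (c, g)"] C by (simp add: case_prod_beta)
    also have "\<dots> = (\<Sum>g\<in>B (fst i). F i (fst i, g)) + (\<Sum>c\<in>C - {fst i}. \<Sum>g\<in>B c. F i (c, g))"
      using i by (intro sum.remove C) auto
    also have "(\<Sum>c\<in>C - {fst i}. \<Sum>g\<in>B c. F i (c, g)) = 0"
      using i by (intro sum.neutral ballI zero) auto
    finally show ?thesis by simp
  qed
  have "(\<Sum>i\<in>Sigma C B. \<Sum>j\<in>Sigma C B. F i j) = (\<Sum>i\<in>Sigma C B. \<Sum>g\<in>B (fst i). F i (fst i, g))"
    by (rule sum.cong[OF refl inner])
  also have "\<dots> = (\<Sum>c\<in>C. \<Sum>f\<in>B c. \<Sum>g\<in>B c. F (c, f) (c, g))"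
    using sum.Sigma[of C B "\<lambda>c f. \<Sum>g\<in>B c. F (c, f) (c, g)"] C by (simp add: case_prod_beta)
  finally show ?thesis .
qed

lemma finite_dim_basis:
  assumes "finite B" "V \<subseteq> cfun.span B"
  obtains X where "finite X" "X \<subseteq> V" "cfun.independent X" "V \<subseteq> cfun.span X" "card X = cfun.dim V"
proof -
  obtain X where X: "X \<subseteq> V" "cfun.independent X" "V \<subseteq> cfun.span X" "card X = cfun.dim V"
    by (rule cfun.basis_exists)
  moreover have "finite X"
    using cfun.independent_span_bound[OF assms(1) X(2)] X(1) assms(2) by blast
  ultimately show thesis using that by blast
qed

section \<open>Norm and energy of combinations of eigenfunctions\<close>

context rooted_metric_tree
begin

lemma edge_ivl_borel: "edge_ivl T e \<in> sets borel"
  by (cases e) auto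

lemma is_interval_interior_edge_ivl: "is_interval (interior (edge_ivl T e))"
  by (cases e) (auto simp: is_interval_1)

lemma edge_ivl_contains:
  assumes "e \<in> edges T" "s \<in> edge_ivl T e"
  obtains c d where "c < d" "s \<in> {c..d}" "{c..d} \<subseteq> edge_ivl T e"
proof (cases e)
  case (Bond u v)
  with assms depth_arc_less[of u v] show thesis
    by (intro that[of "depth T u" "depth T v"]) (auto simp: edges_def)
next
  case (Ray v i)
  with assms show thesis
    by (intro that[of "depth T v" "s + 1"]) auto
qed

lemma L2_edge: "f \<in> L2 T \<Longrightarrow> e \<in> edges T \<Longrightarrow> square_integrable (edge_measure T e) (\<lambda>s. f (chart T e s))"
  by (simp add: L2_def comp_def)

lemma H1_L2: "f \<in> H1 T \<Longrightarrow> f \<in> L2 T"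
  by (simp add: H1_def)

lemma H1_continuous: "f \<in> H1 T \<Longrightarrow> e \<in> edges T \<Longrightarrow> continuous_on (edge_ivl T e) (\<lambda>s. f (chart T e s))"
  by (simp add: H1_def tree_continuous_def comp_def)

lemma H1_edge_deriv:
  assumes "f \<in> H1 T" "e \<in> edges T"
  shows "square_integrable (edge_measure T e) (edge_deriv T e f)"
    "weak_deriv_on (interior (edge_ivl T e)) (\<lambda>s. f (chart T e s)) (edge_deriv T e f)"
proof -
  have "\<exists>g. is_edge_deriv T e f g"
    using assms by (simp add: H1_def)
  then have "is_edge_deriv T e f (edge_deriv T e f)"
    unfolding edge_deriv_def by (rule someI_ex)
  then show "square_integrable (edge_measure T e) (edge_deriv T e f)"
    "weak_deriv_on (interior (edge_ivl T e)) (\<lambda>s. f (chart T e s)) (edge_deriv T e f)"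
    by (simp_all add: is_edge_deriv_def comp_def)
qed

lemma locally_integrable_edge:
  assumes "square_integrable (edge_measure T e) h" "{c..d} \<subseteq> interior (edge_ivl T e)"
  shows "set_integrable lborel {c..d} h"
  using assms(2) interior_subset[of "edge_ivl T e"]
  by (intro square_integrable_gauss_on_compact(2)[OF assms(1)[unfolded edge_measure_eq_gauss_on] edge_ivl_borel]) auto

lemma weak_deriv_combination:
  assumes f: "\<And>j. j \<in> J \<Longrightarrow> f j \<in> H1 T" and e: "e \<in> edges T"
  shows "weak_deriv_on (interior (edge_ivl T e)) (\<lambda>s. \<Sum>j\<in>J. \<alpha> j * f j (chart T e s))
    (\<lambda>s. \<Sum>j\<in>J. \<alpha> j * edge_deriv T e (f j) s)"
  by (rule weak_deriv_on_sum[OF is_interval_interior_edge_ivl])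
    (use f e in \<open>auto intro: H1_edge_deriv locally_integrable_edge[OF L2_edge[OF H1_L2]]
        locally_integrable_edge[OF H1_edge_deriv(1)]\<close>)

lemma L2_inner_fscale: "L2_inner T (fscale c f) h = c * L2_inner T f h"
  by (simp add: L2_inner_def fscale_def sum_distrib_left mult.assoc)

lemma L2_inner_cnj: "L2_inner T h f = cnj (L2_inner T f h)"
  unfolding L2_inner_def cnj_sum by (simp add: mult.commute flip: Bochner_Integration.integral_cnj)

lemma OU_form_cnj: "OU_form T h f = cnj (OU_form T f h)"
  unfolding OU_form_def by (simp add: mult.commute flip: Bochner_Integration.integral_cnj)

definition tree_norm2 :: "('v point \<Rightarrow> complex) \<Rightarrow> real" where
  "tree_norm2 u = (\<Sum>e\<in>edges T. LINT s|edge_measure T e. (cmod (u (chart T e s)))\<^sup>2)"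

definition tree_energy :: "('v edge \<Rightarrow> real \<Rightarrow> complex) \<Rightarrow> real" where
  "tree_energy G = 1 / 2 * (\<Sum>e\<in>edges T. LINT s|edge_measure T e. (cmod (G e s))\<^sup>2)"

definition weak_gradient :: "('v point \<Rightarrow> complex) \<Rightarrow> ('v edge \<Rightarrow> real \<Rightarrow> complex) \<Rightarrow> bool" where
  "weak_gradient u G \<longleftrightarrow> (\<forall>e\<in>edges T.
     square_integrable (edge_measure T e) (\<lambda>s. u (chart T e s)) \<and>
     continuous_on (edge_ivl T e) (\<lambda>s. u (chart T e s)) \<and>
     square_integrable (edge_measure T e) (G e) \<and>
     weak_deriv_on (interior (edge_ivl T e)) (\<lambda>s. u (chart T e s)) (G e))"

lemma tree_norm2_nonneg: "0 \<le> tree_norm2 u"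
  unfolding tree_norm2_def by (intro sum_nonneg Bochner_Integration.integral_nonneg) auto

lemma tree_norm2_combination:
  assumes "\<And>j. j \<in> J \<Longrightarrow> f j \<in> L2 T"
  shows "complex_of_real (tree_norm2 (\<lambda>x. \<Sum>j\<in>J. \<alpha> j * f j x))
    = (\<Sum>i\<in>J. \<Sum>j\<in>J. \<alpha> i * cnj (\<alpha> j) * L2_inner T (f i) (f j))"
proof -
  have "complex_of_real (tree_norm2 (\<lambda>x. \<Sum>j\<in>J. \<alpha> j * f j x))
      = (\<Sum>e\<in>edges T. \<Sum>i\<in>J. \<Sum>j\<in>J. \<alpha> i * cnj (\<alpha> j)
          * (LINT s|edge_measure T e. f i (chart T e s) * cnj (f j (chart T e s))))"
    unfolding tree_norm2_def of_real_sum
    by (intro sum.cong refl integral_cmod_sum_power2 L2_edge assms)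
  also have "\<dots> = (\<Sum>i\<in>J. \<Sum>e\<in>edges T. \<Sum>j\<in>J. \<alpha> i * cnj (\<alpha> j)
          * (LINT s|edge_measure T e. f i (chart T e s) * cnj (f j (chart T e s))))"
    by (rule sum.swap)
  also have "\<dots> = (\<Sum>i\<in>J. \<Sum>j\<in>J. \<Sum>e\<in>edges T. \<alpha> i * cnj (\<alpha> j)
          * (LINT s|edge_measure T e. f i (chart T e s) * cnj (f j (chart T e s))))"
    by (intro sum.cong refl sum.swap)
  finally show ?thesis by (simp add: L2_inner_def sum_distrib_left)
qed

lemma tree_energy_combination:
  assumes "\<And>j. j \<in> J \<Longrightarrow> f j \<in> H1 T"
  shows "complex_of_real (tree_energy (\<lambda>e s. \<Sum>j\<in>J. \<alpha> j * edge_deriv T e (f j) s))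
    = (\<Sum>i\<in>J. \<Sum>j\<in>J. \<alpha> i * cnj (\<alpha> j) * OU_form T (f i) (f j))"
proof -
  have "complex_of_real (tree_energy (\<lambda>e s. \<Sum>j\<in>J. \<alpha> j * edge_deriv T e (f j) s))
      = 1 / 2 * (\<Sum>e\<in>edges T. complex_of_real
          (LINT s|edge_measure T e. (cmod (\<Sum>j\<in>J. \<alpha> j * edge_deriv T e (f j) s))\<^sup>2))"
    by (simp add: tree_energy_def)
  also have "(\<Sum>e\<in>edges T. complex_of_real
          (LINT s|edge_measure T e. (cmod (\<Sum>j\<in>J. \<alpha> j * edge_deriv T e (f j) s))\<^sup>2))
      = (\<Sum>e\<in>edges T. \<Sum>i\<in>J. \<Sum>j\<in>J. \<alpha> i * cnj (\<alpha> j)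
          * (LINT s|edge_measure T e. edge_deriv T e (f i) s * cnj (edge_deriv T e (f j) s)))"
    by (intro sum.cong refl integral_cmod_sum_power2 H1_edge_deriv assms)
  also have "\<dots> = (\<Sum>i\<in>J. \<Sum>e\<in>edges T. \<Sum>j\<in>J. \<alpha> i * cnj (\<alpha> j)
          * (LINT s|edge_measure T e. edge_deriv T e (f i) s * cnj (edge_deriv T e (f j) s)))"
    by (rule sum.swap)
  also have "\<dots> = (\<Sum>i\<in>J. \<Sum>j\<in>J. \<Sum>e\<in>edges T. \<alpha> i * cnj (\<alpha> j)
          * (LINT s|edge_measure T e. edge_deriv T e (f i) s * cnj (edge_deriv T e (f j) s)))"
    by (intro sum.cong refl sum.swap)
  finally show ?thesis
    by (simp only: OU_form_def sum_distrib_left mult.left_commute[of _ "1 / 2"])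
qed

lemma tree_norm2_pos:
  assumes f: "\<And>j. j \<in> J \<Longrightarrow> f j \<in> H1 T" and x: "(\<Sum>j\<in>J. \<alpha> j * f j x) \<noteq> 0"
  shows "0 < tree_norm2 (\<lambda>x. \<Sum>j\<in>J. \<alpha> j * f j x)"
proof -
  have "\<exists>j\<in>J. f j x \<noteq> 0"
  proof (rule ccontr)
    assume "\<not> ?thesis"
    then have "(\<Sum>j\<in>J. \<alpha> j * f j x) = 0"
      by (intro sum.neutral) simp
    with x show False by simp
  qed
  then have "x \<in> points T"
    using f by (auto simp: H1_def L2_def tree_fun_def)
  then obtain e s where e: "e \<in> edges T" and s: "s \<in> edge_ivl T e" "x = chart T e s"
    by (auto simp: points_def)
  obtain c d where cd: "c < d" "s \<in> {c..d}" "{c..d} \<subseteq> edge_ivl T e"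
    by (rule edge_ivl_contains[OF e s(1)])
  have "0 < (LINT s|edge_measure T e. (cmod (\<Sum>j\<in>J. \<alpha> j * f j (chart T e s)))\<^sup>2)"
    unfolding edge_measure_eq_gauss_on
  proof (rule integral_gauss_on_pos[OF _ edge_ivl_borel cd(3,1)])
    show "square_integrable (gauss_on (edge_ivl T e)) (\<lambda>s. \<Sum>j\<in>J. \<alpha> j * f j (chart T e s))"
      unfolding edge_measure_eq_gauss_on[symmetric]
      using e f by (intro square_integrable_sum L2_edge H1_L2)
    show "continuous_on {c..d} (\<lambda>s. \<Sum>j\<in>J. \<alpha> j * f j (chart T e s))"
      using e f by (intro continuous_intros continuous_on_subset[OF H1_continuous cd(3)])
  qed (use cd x s in auto)
  also have "\<dots> \<le> tree_norm2 (\<lambda>x. \<Sum>j\<in>J. \<alpha> j * f j x)"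
    unfolding tree_norm2_def using e
    by (intro member_le_sum[where f = "\<lambda>e. LINT s|edge_measure T e. (cmod (\<Sum>j\<in>J. \<alpha> j * f j (chart T e s)))\<^sup>2"])
      (auto simp: finite_edges)
  finally show ?thesis .
qed

text \<open>The form is Hermitian and \<open>c'\<close> is real, so evaluation from either side
  expresses it as both \<open>c\<close> and \<open>c'\<close> times the same inner product.\<close>

lemma form_operator_orthogonal:
  assumes D: "D \<subseteq> H1 T" and f: "f \<in> eigenspace (form_operator T D) (complex_of_real c)"
    and h: "h \<in> eigenspace (form_operator T D) (complex_of_real c')"
  shows "OU_form T f h = complex_of_real c * L2_inner T f h" "c \<noteq> c' \<Longrightarrow> L2_inner T f h = 0"
proof -
  show 1: "OU_form T f h = complex_of_real c * L2_inner T f h"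
    using f h by (simp add: eigenspace_def form_operator_def L2_inner_fscale)
  have "OU_form T h f = complex_of_real c' * L2_inner T h f"
    using f h by (simp add: eigenspace_def form_operator_def L2_inner_fscale)
  then have "cnj (OU_form T h f) = cnj (complex_of_real c' * L2_inner T h f)"
    by simp
  then have "OU_form T f h = complex_of_real c' * L2_inner T f h"
    by (simp flip: OU_form_cnj L2_inner_cnj)
  with 1 show "L2_inner T f h = 0" if "c \<noteq> c'"
    using that by simp
qed

text \<open>\<open>G\<close> is the combination of the chosen derivatives \<open>edge_deriv\<close> of the eigenfunctions, not
  \<open>edge_deriv\<close> of their combination \<open>u\<close>. This avoids the uniqueness of weak derivatives, and
  with it the question whether an eigenspace is closed under addition.\<close>

lemma eigenfunction_combination:
  assumes D: "D \<subseteq> H1 T" and enum: "eigenvalue_enumeration (form_operator T D) lam"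
    and K: "finite K" "card K < n"
  obtains u G where "weak_gradient u G"
    "\<forall>x\<in>K. u x = 0" "\<forall>x. (\<forall>f\<in>D. f x = 0) \<longrightarrow> u x = 0"
    "0 < tree_norm2 u" "tree_energy G \<le> lam n * tree_norm2 u"
proof -
  define E where "E c = eigenspace (form_operator T D) (complex_of_real c)" for c
  have E_D: "E c \<subseteq> D" for c
    by (auto simp: E_def eigenspace_def form_operator_def)
  have level_set: "{i. 1 \<le> i \<and> complex_of_real (lam i) = complex_of_real c} = {i. 1 \<le> i \<and> lam i = c}" for c
    by simp
  have enum': "finite {i. 1 \<le> i \<and> lam i = c}" "\<exists>B. finite B \<and> E c \<subseteq> cfun.span B"
    "card {i. 1 \<le> i \<and> lam i = c} = cfun.dim (E c)" for c
    using enum unfolding eigenvalue_enumeration_def E_def level_set[symmetric] by blast+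
  \<comment> \<open>A basis for every real \<open>c\<close>, empty unless \<open>c\<close> is an
    eigenvalue.\<close>
  have "\<exists>X. finite X \<and> X \<subseteq> E c \<and> cfun.independent X \<and> card X = card {i. 1 \<le> i \<and> lam i = c}" for c
  proof -
    obtain B where "finite B" "E c \<subseteq> cfun.span B" using enum'(2) by blast
    then obtain X where "finite X" "X \<subseteq> E c" "cfun.independent X" "card X = cfun.dim (E c)"
      by (rule finite_dim_basis)
    then show ?thesis using enum'(3) by auto
  qed
  then obtain X where "\<forall>c. finite (X c) \<and> X c \<subseteq> E c \<and> cfun.independent (X c)
      \<and> card (X c) = card {i. 1 \<le> i \<and> lam i = c}"
    using choice[of "\<lambda>c X. finite X \<and> X \<subseteq> E c \<and> cfun.independent X \<and> card X = card {i. 1 \<le> i \<and> lam i = c}"]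
    by blast
  then have X: "\<And>c. finite (X c)" "\<And>c. X c \<subseteq> E c" "\<And>c. cfun.independent (X c)"
    "\<And>c. card (X c) = card {i. 1 \<le> i \<and> lam i = c}"
    by blast+
  \<comment> \<open>The distinct values among the first \<open>n\<close>, each with its full
    multiplicity: \<open>J\<close> may have more than \<open>n\<close> elements, but no value
    exceeds \<open>lam n\<close>.\<close>
  define C where "C = lam ` {1..n}"
  define J where "J = Sigma C X"
  have fin: "finite C" "finite J" using X(1) by (auto simp: C_def J_def)
  have "n = card {1..n}" by simp
  also have "\<dots> \<le> card (\<Union>c\<in>C. {i. 1 \<le> i \<and> lam i = c})"
  proof (rule card_mono)
    show "finite (\<Union>c\<in>C. {i. 1 \<le> i \<and> lam i = c})" using fin enum'(1) by blast
  qed (auto simp: C_def)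
  also have "\<dots> \<le> (\<Sum>c\<in>C. card {i. 1 \<le> i \<and> lam i = c})"
    by (rule card_UN_le[OF fin(1)])
  also have "\<dots> = card J"
    using fin X by (simp add: J_def card_SigmaI)
  finally have "card K < card J" using K by simp
  from homogeneous_system_nontrivial_solution[OF K(1) fin(2) this, of "\<lambda>x j. snd j x"]
  obtain \<alpha> where \<alpha>: "\<exists>j\<in>J. \<alpha> j \<noteq> 0" "\<And>x. x \<in> K \<Longrightarrow> (\<Sum>j\<in>J. \<alpha> j * snd j x) = 0"
    by blast
  have J_E: "snd j \<in> E (fst j)" if "j \<in> J" for j
    using that X(2)[of "fst j"] by (auto simp: J_def)
  have J_D: "snd j \<in> D" and J_H1: "snd j \<in> H1 T" if "j \<in> J" for j
    using J_E[OF that] E_D D by blast+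
  define u where "u = (\<lambda>x. \<Sum>j\<in>J. \<alpha> j * snd j x)"
  define G where "G = (\<lambda>e s. \<Sum>j\<in>J. \<alpha> j * edge_deriv T e (snd j) s)"
  \<comment> \<open>The component of \<open>u\<close> in the eigenspace of \<open>c\<close>; by
    orthogonality the norm and the energy are both sums over these components.\<close>
  define part where "part c = (\<lambda>x. \<Sum>f\<in>X c. \<alpha> (c, f) * f x)" for c
  have X_H1: "f \<in> H1 T" if "f \<in> X c" for f c
    using that X(2) E_D D by blast
  have part_norm: "complex_of_real (tree_norm2 (part c))
      = (\<Sum>f\<in>X c. \<Sum>g\<in>X c. \<alpha> (c, f) * cnj (\<alpha> (c, g)) * L2_inner T f g)" for c
    unfolding part_def
    by (rule tree_norm2_combination[of "X c" "\<lambda>f. f" "\<lambda>f. \<alpha> (c, f)"]) (rule H1_L2[OF X_H1])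
  have orth: "L2_inner T (snd i) (snd j) = 0" if "i \<in> J" "j \<in> J" "fst i \<noteq> fst j" for i j
    using form_operator_orthogonal(2)[OF D] J_E that unfolding E_def by blast
  have form: "OU_form T (snd i) (snd j) = complex_of_real (fst i) * L2_inner T (snd i) (snd j)"
    if "i \<in> J" "j \<in> J" for i j
    using form_operator_orthogonal(1)[OF D] J_E that unfolding E_def by blast
  have "complex_of_real (tree_norm2 u)
      = (\<Sum>i\<in>J. \<Sum>j\<in>J. \<alpha> i * cnj (\<alpha> j) * L2_inner T (snd i) (snd j))"
    unfolding u_def by (rule tree_norm2_combination) (rule H1_L2[OF J_H1])
  also have "\<dots> = (\<Sum>c\<in>C. \<Sum>f\<in>X c. \<Sum>g\<in>X c. \<alpha> (c, f) * cnj (\<alpha> (c, g)) * L2_inner T f g)"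
    unfolding J_def by (subst sum_Sigma_block_diagonal) (use fin X orth in \<open>auto simp: J_def\<close>)
  also have "\<dots> = complex_of_real (\<Sum>c\<in>C. tree_norm2 (part c))"
    by (simp add: part_norm)
  finally have norm: "tree_norm2 u = (\<Sum>c\<in>C. tree_norm2 (part c))"
    by (simp only: of_real_eq_iff)
  have "complex_of_real (tree_energy G)
      = (\<Sum>i\<in>J. \<Sum>j\<in>J. \<alpha> i * cnj (\<alpha> j) * OU_form T (snd i) (snd j))"
    unfolding G_def by (rule tree_energy_combination) (rule J_H1)
  also have "\<dots> = (\<Sum>i\<in>J. \<Sum>j\<in>J. \<alpha> i * cnj (\<alpha> j) * (complex_of_real (fst i) * L2_inner T (snd i) (snd j)))"
    by (intro sum.cong refl) (simp add: form)
  also have "\<dots> = (\<Sum>c\<in>C. \<Sum>f\<in>X c. \<Sum>g\<in>X c. \<alpha> (c, f) * cnj (\<alpha> (c, g)) * (complex_of_real c * L2_inner T f g))"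
    unfolding J_def by (subst sum_Sigma_block_diagonal) (use fin X orth in \<open>auto simp: J_def\<close>)
  also have "\<dots> = complex_of_real (\<Sum>c\<in>C. c * tree_norm2 (part c))"
    by (simp add: part_norm sum_distrib_left mult_ac)
  finally have energy: "tree_energy G = (\<Sum>c\<in>C. c * tree_norm2 (part c))"
    by (simp only: of_real_eq_iff)
  have "c \<le> lam n" if "c \<in> C" for c
    using that enum K(2) unfolding eigenvalue_enumeration_def C_def by auto
  then have "tree_energy G \<le> lam n * tree_norm2 u"
    unfolding energy norm sum_distrib_left
    by (intro sum_mono mult_right_mono tree_norm2_nonneg)
  moreover have "0 < tree_norm2 u"
  proof -
    obtain c f where cf: "c \<in> C" "f \<in> X c" "\<alpha> (c, f) \<noteq> 0"
      using \<alpha>(1) by (auto simp: J_def)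
    \<comment> \<open>Linear independence enters within one eigenspace only; \<open>norm\<close>
      shows that the other components cannot cancel this one.\<close>
    have "(\<Sum>f\<in>X c. fscale (\<alpha> (c, f)) f) \<noteq> 0"
      using cfun.independentD[OF X(3)[of c] X(1)[of c] order_refl, of "\<lambda>f. \<alpha> (c, f)" f] cf by blast
    then obtain x where "(\<Sum>f\<in>X c. \<alpha> (c, f) * f x) \<noteq> 0"
      by (auto simp: fun_eq_iff sum_fun_apply fscale_def)
    then have "0 < tree_norm2 (part c)"
      unfolding part_def by (intro tree_norm2_pos[of "X c" "\<lambda>f. f" "\<lambda>f. \<alpha> (c, f)"] X_H1)
    also have "\<dots> \<le> tree_norm2 u"
      unfolding norm using cf fin by (intro member_le_sum[of c C "\<lambda>c. tree_norm2 (part c)"] tree_norm2_nonneg) auto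
    finally show ?thesis .
  qed
  moreover have "weak_gradient u G"
    unfolding weak_gradient_def
  proof (intro ballI conjI)
    fix e assume e: "e \<in> edges T"
    show "square_integrable (edge_measure T e) (\<lambda>s. u (chart T e s))"
      unfolding u_def using e by (intro square_integrable_sum L2_edge H1_L2 J_H1)
    show "continuous_on (edge_ivl T e) (\<lambda>s. u (chart T e s))"
      unfolding u_def using e by (intro continuous_intros H1_continuous J_H1)
    show "square_integrable (edge_measure T e) (G e)"
      unfolding G_def using e by (intro square_integrable_sum H1_edge_deriv J_H1)
    show "weak_deriv_on (interior (edge_ivl T e)) (\<lambda>s. u (chart T e s)) (G e)"
      unfolding u_def G_def using e by (intro weak_deriv_combination J_H1)
  qed
  moreover have "\<forall>x\<in>K. u x = 0"
    unfolding u_def using \<alpha>(2) by blast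
  moreover have "\<forall>x. (\<forall>f\<in>D. f x = 0) \<longrightarrow> u x = 0"
    unfolding u_def using J_D by (simp add: sum.neutral)
  ultimately show thesis
    by (intro that[of u G])
qed

end

section \<open>The weighted comparison and the eigenvalue bound\<close>

context regular_metric_tree
begin

lemma form_lower_bound:
  assumes grad: "weak_gradient u G"
    and zero: "\<And>e s. e \<in> edges T \<Longrightarrow> s \<in> edge_ivl T e \<Longrightarrow> poly (hermite n) s = 0 \<Longrightarrow> u (chart T e s) = 0"
    and root: "log_slope n 0 = 0 \<or> u (Vert r) = 0"
  shows "real n * tree_norm2 u \<le> real (\<Prod>j=1..N. b j) * tree_energy G"
proof -
  have u: "square_integrable (edge_measure T e) (\<lambda>s. u (chart T e s))"
    and cont: "continuous_on (edge_ivl T e) (\<lambda>s. u (chart T e s))"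
    and G: "square_integrable (edge_measure T e) (G e)"
    and wd: "weak_deriv_on (interior (edge_ivl T e)) (\<lambda>s. u (chart T e s)) (G e)"
    if "e \<in> edges T" for e
    using grad that by (simp_all add: weak_gradient_def)
  \<comment> \<open>\<open>log_slope\<close> is evaluated at the distance alone, so the boundary
    terms of all edges meeting at \<open>v\<close> are values of one vertex function.\<close>
  define P where "P v = (cmod (u (Vert v)))\<^sup>2 * log_slope n (depth T v)" for v
  define w where "w e = real (card (edge_rays e))" for e
  define g2 where "g2 e = (LINT s|edge_measure T e. (cmod (G e s))\<^sup>2)" for e
  define u2 where "u2 e = (LINT s|edge_measure T e. (cmod (u (chart T e s)))\<^sup>2)" for e
  have nn: "0 \<le> g2 e" "0 \<le> u2 e" for e
    by (simp_all add: g2_def u2_def)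
  have w: "1 \<le> w e" "w e \<le> real (\<Prod>j=1..N. b j)" if "e \<in> edges T" for e
    using of_nat_mono[OF card_edge_rays_bounds(1)[OF that], where 'a = real]
      of_nat_mono[OF card_edge_rays_bounds(2)[OF that], where 'a = real] unfolding w_def by simp_all
  have edge: "potential_drop P e \<le> g2 e - 2 * real n * u2 e" if e: "e \<in> edges T" for e
  proof (cases e)
    case [simp]: (Bond x y)
    have xy: "depth T x < depth T y"
      using e depth_arc_less by (auto simp: edges_def)
    have "(cmod (u (chart T e (depth T y))))\<^sup>2 * log_slope n (depth T y)
        - (cmod (u (chart T e (depth T x))))\<^sup>2 * log_slope n (depth T x) \<le> g2 e - 2 * real n * u2 e"
      unfolding g2_def u2_def edge_measure_eq_gauss_on
      by (rule picone_bounded_edge)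
        (use e xy u[OF e] cont[OF e] G[OF e] wd[OF e] zero[OF e] edge_ivl_borel[of e] in \<open>auto simp: edge_measure_eq_gauss_on\<close>)
    then show ?thesis using xy by (simp add: P_def)
  next
    case [simp]: (Ray x i)
    have "- (cmod (u (chart T e (depth T x))))\<^sup>2 * log_slope n (depth T x) \<le> g2 e - 2 * real n * u2 e"
      unfolding g2_def u2_def edge_measure_eq_gauss_on
      by (rule picone_unbounded_edge)
        (use e u[OF e] cont[OF e] G[OF e] wd[OF e] zero[OF e] edge_ivl_borel[of e] in \<open>auto simp: edge_measure_eq_gauss_on\<close>)
    then show ?thesis by (simp add: P_def)
  qed
  have "P r = 0" using root depth_origin by (auto simp: P_def)
  then have "0 = (\<Sum>e\<in>edges T. w e * potential_drop P e)"
    unfolding w_def by (simp add: sum_edge_rays_potential_drop)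
  also have "\<dots> \<le> (\<Sum>e\<in>edges T. w e * (g2 e - 2 * real n * u2 e))"
    using edge w(1) by (intro sum_mono mult_left_mono) force+
  also have "\<dots> = (\<Sum>e\<in>edges T. w e * g2 e) - 2 * real n * (\<Sum>e\<in>edges T. w e * u2 e)"
    by (simp add: right_diff_distrib sum_subtractf sum_distrib_left mult_ac)
  \<comment> \<open>The weights are removed in opposite directions: the upper bound serves the
    energy, the lower bound 1 the subtracted norm.\<close>
  also have "\<dots> \<le> real (\<Prod>j=1..N. b j) * (\<Sum>e\<in>edges T. g2 e) - 2 * real n * (\<Sum>e\<in>edges T. u2 e)"
  proof (rule diff_mono)
    show "(\<Sum>e\<in>edges T. w e * g2 e) \<le> real (\<Prod>j=1..N. b j) * (\<Sum>e\<in>edges T. g2 e)"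
      unfolding sum_distrib_left using w(2) nn by (intro sum_mono mult_right_mono)
    have "(\<Sum>e\<in>edges T. u2 e) \<le> (\<Sum>e\<in>edges T. w e * u2 e)"
    proof (rule sum_mono)
      fix e assume "e \<in> edges T"
      from mult_right_mono[OF w(1)[OF this] nn(2)[of e]] show "u2 e \<le> w e * u2 e" by simp
    qed
    then show "2 * real n * (\<Sum>e\<in>edges T. u2 e) \<le> 2 * real n * (\<Sum>e\<in>edges T. w e * u2 e)"
      by (intro mult_left_mono) auto
  qed
  finally show ?thesis
    by (simp add: tree_norm2_def tree_energy_def g2_def u2_def)
qed

lemma chart_at_depth_0:
  assumes e: "e \<in> edges T" "s \<in> edge_ivl T e" "s \<le> 0"
  shows "s = 0" "chart T e s = Vert r"
proof -
  have start: "v = r \<and> s = depth T v" if "v \<in> verts T" "depth T v \<le> s" for v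
    using depth_nonneg[OF that(1)] depth_pos[OF that(1)] that e(3) depth_origin by force
  have "\<exists>v. v = r \<and> s = depth T v \<and> chart T e s = Vert v"
  proof (cases e)
    case (Bond u v)
    then have "u \<in> verts T" using e arcs_verts by (auto simp: edges_def)
    with Bond e start[of u] show ?thesis by auto
  next
    case (Ray v i)
    then have "v \<in> verts T" using e by (auto simp: edges_def)
    with Ray e start[of v] show ?thesis by auto
  qed
  then show "s = 0" "chart T e s = Vert r" using depth_origin by auto
qed

text \<open>The derivative is odd and vanishes at 0, which removes the boundary term at the root;
  since zeros are simple, 0 is then not a zero.\<close>

lemma hermite_even_at_0:
  assumes "even n"
  shows "log_slope n 0 = 0" "poly (hermite n) 0 \<noteq> 0"
proof -
  have "poly (pderiv (hermite n)) 0 = 0"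
  proof (cases n)
    case (Suc k)
    then have "poly (hermite k) (- 0) = - poly (hermite k) 0"
      using assms unfolding poly_hermite_minus by simp
    then show ?thesis unfolding Suc pderiv_hermite_Suc by simp
  qed simp
  then show "log_slope n 0 = 0" "poly (hermite n) 0 \<noteq> 0"
    using pderiv_hermite_neq_0[of n 0] by (auto simp: log_slope_def)
qed

text \<open>A nonzero combination of eigenfunctions up to \<open>lam n\<close> can be made to
  satisfy fewer than \<open>n\<close> point conditions, and \<open>form_lower_bound\<close> applies
  to it. \<open>Y\<close> leaves room for a condition at the root.\<close>

lemma eigenvalue_lower_bound:
  assumes D: "D \<subseteq> H1 T" and enum: "eigenvalue_enumeration (form_operator T D) lam"
    and Y: "finite Y" "(k div 2) * (\<Prod>j\<le>N. b j) + card Y < n"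
    and root: "even k \<or> Vert r \<in> Y \<or> (\<forall>f\<in>D. f (Vert r) = 0)"
  shows "real k * real (b 0) / real (\<Prod>j\<le>N. b j) \<le> lam n"
proof -
  define Z where "Z = {z. 0 < z \<and> poly (hermite k) z = 0}"
  \<comment> \<open>One condition for each half-line and each positive zero; pairs naming the same
    point only lower the count.\<close>
  define K where "K = (\<lambda>(\<rho>, z). point_on_ray \<rho> z) ` (rays_below r \<times> Z) \<union> Y"
  have Z: "finite Z" "card Z \<le> k div 2"
    unfolding Z_def by (rule card_hermite_pos_zeros)+
  have K_fin: "finite K"
    unfolding K_def using Z(1) Y(1) finite_rays_below by simp
  have "card K \<le> card ((\<lambda>(\<rho>, z). point_on_ray \<rho> z) ` (rays_below r \<times> Z)) + card Y"
    unfolding K_def by (rule card_Un_le)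
  also have "card ((\<lambda>(\<rho>, z). point_on_ray \<rho> z) ` (rays_below r \<times> Z)) \<le> card (rays_below r \<times> Z)"
    by (rule card_image_le) (simp add: Z(1) finite_rays_below)
  also have "card (rays_below r \<times> Z) \<le> (\<Prod>j\<le>N. b j) * (k div 2)"
    unfolding card_cartesian_product by (rule mult_le_mono[OF card_rays_le Z(2)])
  finally have K_card: "card K < n"
    using Y(2) by (simp add: mult.commute)
  obtain u G where grad: "weak_gradient u G" and u_K: "\<forall>x\<in>K. u x = 0"
    and u_D: "\<forall>x. (\<forall>f\<in>D. f x = 0) \<longrightarrow> u x = 0"
    and u_pos: "0 < tree_norm2 u" and u_energy: "tree_energy G \<le> lam n * tree_norm2 u"
    by (rule eigenfunction_combination[OF D enum K_fin K_card])
  have u_root: "even k \<or> u (Vert r) = 0"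
    using root u_K u_D by (auto simp: K_def)
  have "u (chart T e s) = 0" if e: "e \<in> edges T" "s \<in> edge_ivl T e" "poly (hermite k) s = 0" for e s
  proof (cases "s \<le> 0")
    \<comment> \<open>This is the root. It matters for odd \<open>k\<close> only, where
      \<open>u\<close> vanishes there by \<open>u_root\<close>.\<close>
    case True
    then show ?thesis
      using chart_at_depth_0[OF e(1,2)] u_root hermite_even_at_0(2)[of k] e(3) by auto
  next
    case False
    have "edge_rays e \<noteq> {}" if "e \<in> edges T" for e
      using card_edge_rays_bounds(1)[OF that] by auto
    then obtain \<rho> where "\<rho> \<in> rays_below r" "chart T e s = point_on_ray \<rho> s"
      using chart_is_point_on_ray[OF _ e(1,2)] False by auto
    then have "chart T e s \<in> K"
      using False e(3) by (auto simp: K_def Z_def)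
    then show ?thesis using u_K by blast
  qed
  then have "real k * tree_norm2 u \<le> real (\<Prod>j=1..N. b j) * tree_energy G"
    using u_root hermite_even_at_0(1)[of k] by (intro form_lower_bound grad) auto
  also have "\<dots> \<le> real (\<Prod>j=1..N. b j) * (lam n * tree_norm2 u)"
    by (intro mult_left_mono u_energy) (simp add: prod_nonneg)
  finally have "real k * tree_norm2 u \<le> (real (\<Prod>j=1..N. b j) * lam n) * tree_norm2 u"
    by (simp only: mult.assoc)
  then have "real k \<le> real (\<Prod>j=1..N. b j) * lam n"
    using u_pos by (rule mult_right_le_imp_le)
  moreover have "0 < real (\<Prod>j=1..N. b j)" "0 < real (b 0)"
    using b_pos by (auto intro!: prod_pos)
  ultimately show ?thesis
    unfolding prod_b_atMost of_nat_mult by (simp add: divide_le_eq mult.commute mult.left_commute)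
qed

end

section \<open>The constant eigenfunction\<close>

text \<open>The positive and the negative part of \<open>f\<close> are densities of measures that
  agree on all half-lines \<open>{x<..}\<close>, hence coincide; the two parts are then equal almost
  everywhere, which forces both to be 0.\<close>

lemma AE_zero_of_tail_integrals_zero:
  fixes f :: "real \<Rightarrow> real"
  assumes f: "integrable lborel f" and zero: "\<And>x. (LINT s|lborel. indicator {x<..} s * f s) = 0"
  shows "AE s in lborel. f s = 0"
proof -
  have [measurable]: "f \<in> borel_measurable borel" using f by auto
  have emeasure_density: "emeasure (density lborel (\<lambda>s. ennreal (c * f s))) {x<..}
      = ennreal (LINT s|lborel. indicator {x<..} s * max 0 (c * f s))" for c x
  proof -
    have int: "integrable lborel (\<lambda>s. indicator {x<..} s *\<^sub>R max 0 (c * f s))"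
      using f by (intro integrable_mult_indicator integrable_max) auto
    have "emeasure (density lborel (\<lambda>s. ennreal (c * f s))) {x<..}
        = (\<integral>\<^sup>+s. ennreal (indicator {x<..} s *\<^sub>R max 0 (c * f s)) \<partial>lborel)"
      by (subst emeasure_density) (auto intro!: nn_integral_cong simp: indicator_def max_def ennreal_neg)
    also have "\<dots> = ennreal (LINT s|lborel. indicator {x<..} s *\<^sub>R max 0 (c * f s))"
      by (rule nn_integral_eq_integral[OF int]) auto
    finally show ?thesis by simp
  qed
  have "density lborel (\<lambda>s. ennreal (1 * f s)) = density lborel (\<lambda>s. ennreal (- 1 * f s))"
  proof (rule measure_eqI_lessThan)
    fix x
    have int: "integrable lborel (\<lambda>s. indicator {x<..} s *\<^sub>R max 0 (c * f s))" for c
      using f by (intro integrable_mult_indicator integrable_max) auto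
    have "(LINT s|lborel. indicator {x<..} s * max 0 (1 * f s)) - (LINT s|lborel. indicator {x<..} s * max 0 (- 1 * f s))
        = (LINT s|lborel. indicator {x<..} s * max 0 (1 * f s) - indicator {x<..} s * max 0 (- 1 * f s))"
      by (rule Bochner_Integration.integral_diff[symmetric]) (use int[of 1] int[of "-1"] in auto)
    also have "\<dots> = (LINT s|lborel. indicator {x<..} s * f s)"
      by (rule Bochner_Integration.integral_cong) (auto simp: indicator_def max_def)
    finally show "emeasure (density lborel (\<lambda>s. ennreal (1 * f s))) {x<..}
        = emeasure (density lborel (\<lambda>s. ennreal (- 1 * f s))) {x<..}"
      unfolding emeasure_density using zero[of x] by simp
    show "emeasure (density lborel (\<lambda>s. ennreal (1 * f s))) {x<..} < \<infinity>"
      unfolding emeasure_density by simp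
  qed auto
  then have "AE s in lborel. ennreal (1 * f s) = ennreal (- 1 * f s)"
    by (subst (asm) sigma_finite_measure.density_unique_iff[OF sigma_finite_lborel]) auto
  then show ?thesis
  proof eventually_elim
    case (elim s)
    then show ?case
      by (cases "f s" "0 :: real" rule: linorder_cases) (auto simp: ennreal_neg ennreal_eq_0_iff)
  qed
qed

text \<open>\<open>edge_deriv\<close> is merely some chosen weak derivative, so even for a constant
  function its vanishing needs a proof, and holds only almost everywhere.\<close>

lemma primitive_on_const_AE_zero:
  assumes "primitive_on a b (\<lambda>_. c) f"
  shows "AE s in lborel. s \<in> {a..b} \<longrightarrow> f s = 0"
proof (cases "a \<le> b")
  case True
  have f: "integrable lborel (\<lambda>s. indicator {a..b} s * f s)"
    using assms by (simp add: primitive_on_def set_integrable_def)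
  have "(LINT s|lborel. indicator {x<..} s * (indicator {a..b} s * f s)) = 0" for x
  proof (cases "x \<le> b")
    case xb: True
    have int: "set_integrable lborel {max a x..b} f" "integral {max a x..b} f = 0"
      using primitive_on_D[OF assms, of "max a x" b] True xb by auto
    have "(LINT s|lborel. indicator {x<..} s * (indicator {a..b} s * f s)) = (LINT s:{max a x..b}|lborel. f s)"
      unfolding set_lebesgue_integral_def
    proof (rule integral_cong_AE)
      show "(\<lambda>s. indicator {x<..} s * (indicator {a..b} s * f s)) \<in> borel_measurable lborel"
        using borel_measurable_integrable[OF f] by measurable
      show "(\<lambda>s. indicator {max a x..b} s *\<^sub>R f s) \<in> borel_measurable lborel"
        using int(1) unfolding set_integrable_def by (rule borel_measurable_integrable)
      show "AE s in lborel. indicator {x<..} s * (indicator {a..b} s * f s) = indicator {max a x..b} s *\<^sub>R f s"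
        using AE_lborel_singleton[of x] by eventually_elim (auto simp: indicator_def)
    qed
    then show ?thesis using set_borel_integral_eq_integral(2)[OF int(1)] int(2) by simp
  next
    case False
    then show ?thesis
      by (intro integral_eq_zero_AE AE_I2) (auto simp: indicator_def)
  qed
  from AE_zero_of_tail_integrals_zero[OF f this] show ?thesis
    by eventually_elim (auto simp: indicator_def)
qed simp

text \<open>Comparison with a multiple of \<open>exp (- s)\<close>. It puts the constant function
  into \<open>L2 T\<close> in spite of the half-lines.\<close>

lemma set_integrable_gauss_atLeast: "set_integrable lborel {0..} gauss"
proof -
  have "set_integrable lborel {0..} (\<lambda>s::real. exp (- s))"
  proof -
    have "(\<lambda>s::real. exp (- 1 * s)) integrable_on {0..}"
      using has_integral_exp_minus_to_infinity[of 1 0] by (auto simp: integrable_on_def)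
    then have "(\<lambda>s::real. exp (- s)) absolutely_integrable_on {0..}"
      by (intro nonnegative_absolutely_integrable_1) auto
    then show ?thesis
      unfolding set_integrable_def by (subst (asm) integrable_completion) auto
  qed
  then have "set_integrable lborel {0..} (\<lambda>s. 2 / sqrt pi * exp 1 * exp (- s))"
    by (rule set_integrable_mult_right)
  then show ?thesis
  proof (rule set_integrable_bound)
    show "set_borel_measurable lborel {0..} gauss"
      unfolding set_borel_measurable_def by measurable
    show "AE s in lborel. s \<in> {0..} \<longrightarrow> norm (gauss s) \<le> norm (2 / sqrt pi * exp 1 * exp (- s))"
    proof (intro AE_I2 impI)
      fix s :: real assume "s \<in> {0..}"
      then have "- (s\<^sup>2) \<le> 1 - s"
        using zero_le_power2[of "s - 1"] by (simp add: power2_diff)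
      then have "exp (- (s\<^sup>2)) \<le> exp 1 * exp (- s)"
        by (simp flip: exp_add)
      then show "norm (gauss s) \<le> norm (2 / sqrt pi * exp 1 * exp (- s))"
        by (simp add: gauss_def abs_mult divide_right_mono)
    qed
  qed
qed

lemma eigenvalue_enumerated:
  assumes enum: "eigenvalue_enumeration A lam" and f: "f \<in> eigenspace A (complex_of_real c)" "f \<noteq> 0"
  shows "\<exists>i\<ge>1. lam i = c"
proof (rule ccontr)
  assume "\<not> ?thesis"
  then have "{i. 1 \<le> i \<and> complex_of_real (lam i) = complex_of_real c} = {}" by auto
  then have dim: "cfun.dim (eigenspace A (complex_of_real c)) = 0"
    using enum unfolding eigenvalue_enumeration_def by (metis card.empty)
  obtain B where "finite B" "eigenspace A (complex_of_real c) \<subseteq> cfun.span B"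
    using enum unfolding eigenvalue_enumeration_def by blast
  then obtain X where X: "finite X" "eigenspace A (complex_of_real c) \<subseteq> cfun.span X"
    "card X = cfun.dim (eigenspace A (complex_of_real c))"
    by (rule finite_dim_basis)
  with dim have "X = {}" by simp
  with X(2) f show False by auto
qed

context rooted_metric_tree
begin

text \<open>\<open>chart\<close> is total: outside its interval it returns \<open>Inner e s\<close>,
  which represents no point of the tree.\<close>

lemma chart_in_points_iff:
  assumes e: "e \<in> edges T"
  shows "chart T e s \<in> points T \<longleftrightarrow> s \<in> edge_ivl T e"
proof
  assume "chart T e s \<in> points T"
  then obtain e' s' where e': "e' \<in> edges T" "s' \<in> edge_ivl T e'" "chart T e s = chart T e' s'"
    by (auto simp: points_def)
  show "s \<in> edge_ivl T e"
  proof (rule ccontr)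
    assume "s \<notin> edge_ivl T e"
    then have "chart T e s = Inner e s"
      using e depth_arc_less by (cases e) (fastforce simp: edges_def)+
    with e' have "chart T e' s' = Inner e s" by simp
    then have "e' = e \<and> s' = s" by (cases e') (auto split: if_splits)
    with e' \<open>s \<notin> edge_ivl T e\<close> show False by simp
  qed
qed (use e in \<open>auto simp: points_def\<close>)

lemma edge_ivl_subset: "e \<in> edges T \<Longrightarrow> edge_ivl T e \<subseteq> {0..}"
  using depth_nonneg arcs_verts by (cases e) (fastforce simp: edges_def)+

text \<open>The constant function, cut off outside the tree because \<open>tree_fun\<close> demands
  it.\<close>

definition unit_fun :: "'v point \<Rightarrow> complex" where
  "unit_fun x = (if x \<in> points T then 1 else 0)"

lemma unit_fun_chart: "e \<in> edges T \<Longrightarrow> unit_fun (chart T e s) = indicator (edge_ivl T e) s"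
  by (simp add: unit_fun_def chart_in_points_iff indicator_def)

lemma unit_fun_H1: "unit_fun \<in> H1 T"
proof -
  have sq: "square_integrable (edge_measure T e) (\<lambda>s. unit_fun (chart T e s))" if e: "e \<in> edges T" for e
  proof -
    let ?I = "edge_ivl T e"
    have [measurable]: "?I \<in> sets borel" by (rule edge_ivl_borel)
    have "set_integrable lborel ?I gauss"
      by (rule set_integrable_subset[OF set_integrable_gauss_atLeast]) (use edge_ivl_subset[OF e] in auto)
    also have "set_integrable lborel ?I gauss
        \<longleftrightarrow> set_integrable lborel ?I (\<lambda>s. gauss s *\<^sub>R (cmod (indicator ?I s))\<^sup>2)"
      by (rule set_integrable_cong) (auto simp: indicator_def)
    also have "\<dots> \<longleftrightarrow> integrable (gauss_on ?I) (\<lambda>s. (cmod (indicator ?I s))\<^sup>2)"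
      by (rule gauss_on_integral(1)[symmetric]) measurable
    finally show ?thesis
      unfolding unit_fun_chart[OF e] edge_measure_eq_gauss_on square_integrable_def
      by (simp add: gauss_on_def)
  qed
  have "is_edge_deriv T e unit_fun (\<lambda>_. 0)" if e: "e \<in> edges T" for e
    unfolding is_edge_deriv_def
  proof
    show "square_integrable (edge_measure T e) (\<lambda>_. 0)"
      by (simp add: square_integrable_def)
    show "weak_deriv_on (interior (edge_ivl T e)) (unit_fun \<circ> chart T e) (\<lambda>_. 0)"
      unfolding weak_deriv_on_def
    proof
      let ?J = "interior (edge_ivl T e)"
      fix \<phi> assume \<phi>: "\<phi> \<in> test_functions ?J"
      obtain c d where cd: "{c..d} \<subseteq> ?J" "\<And>s. s \<notin> {c..d} \<Longrightarrow> \<phi> s = 0" "\<And>s. s \<notin> {c..d} \<Longrightarrow> deriv \<phi> s = 0"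
        "continuous_on UNIV (deriv \<phi>)" "\<And>s. (\<phi> has_real_derivative deriv \<phi> s) (at s)"
        using test_function_D[OF \<phi> is_interval_interior_edge_ivl] by metis
      \<comment> \<open>\<open>{a..b}\<close> is strictly larger than \<open>{c..d}\<close>, even if
        the latter is empty, so \<open>\<phi>\<close> vanishes at both ends and its derivative
        integrates to 0.\<close>
      define a where "a = min c d - 1"
      define b where "b = max c d + 1"
      have "(LINT s:?J|lborel. deriv \<phi> s *\<^sub>R (unit_fun \<circ> chart T e) s)
          = (LINT s|lborel. complex_of_real (deriv \<phi> s * indicator {a..b} s))"
        unfolding set_lebesgue_integral_def
      proof (rule Bochner_Integration.integral_cong[OF refl])
        fix s
        show "indicator ?J s *\<^sub>R deriv \<phi> s *\<^sub>R (unit_fun \<circ> chart T e) s = complex_of_real (deriv \<phi> s * indicator {a..b} s)"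
        proof (cases "s \<in> {c..d}")
          case True
          then have "s \<in> ?J" "s \<in> edge_ivl T e" "s \<in> {a..b}"
            using cd(1) interior_subset[of "edge_ivl T e"] by (auto simp: a_def b_def)
          then show ?thesis by (simp add: unit_fun_chart[OF e] scaleR_conv_of_real)
        qed (simp add: cd(3))
      qed
      also have "\<dots> = complex_of_real (LINT s|lborel. deriv \<phi> s * indicator {a..b} s)"
        by (rule integral_complex_of_real)
      also have "(LINT s|lborel. deriv \<phi> s * indicator {a..b} s) = \<phi> b - \<phi> a"
        by (rule integral_FTC_Icc_real)
          (use cd(4,5) in \<open>auto simp: a_def b_def continuous_on_eq_continuous_at\<close>)
      also have "\<phi> b - \<phi> a = 0"
      proof -
        have "a \<notin> {c..d}" "b \<notin> {c..d}" by (auto simp: a_def b_def)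
        then show ?thesis using cd(2)[of a] cd(2)[of b] by simp
      qed
      finally show "(LINT s:?J|lborel. deriv \<phi> s *\<^sub>R (unit_fun \<circ> chart T e) s)
          = - (LINT s:?J|lborel. \<phi> s *\<^sub>R 0)"
        by (simp add: set_lebesgue_integral_def)
    qed
  qed
  moreover have "tree_continuous T unit_fun"
    unfolding tree_continuous_def
  proof
    fix e assume e: "e \<in> edges T"
    show "continuous_on (edge_ivl T e) (unit_fun \<circ> chart T e)"
      by (rule continuous_on_eq[of _ "\<lambda>_. 1"]) (auto simp: unit_fun_chart[OF e])
  qed
  moreover have "unit_fun \<in> L2 T"
    using sq by (auto simp: L2_def tree_fun_def unit_fun_def comp_def)
  ultimately show ?thesis unfolding H1_def by blast
qed

lemma unit_fun_edge_deriv: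
  assumes e: "e \<in> edges T"
  shows "AE s in edge_measure T e. edge_deriv T e unit_fun s = 0"
proof -
  let ?I = "edge_ivl T e" and ?G = "edge_deriv T e unit_fun"
  have compact: "AE s in lborel. s \<in> {a..b} \<longrightarrow> ?G s = 0" if ab: "a < b" "{a..b} \<subseteq> ?I" for a b
  proof -
    note prim = weak_deriv_primitive_on[OF H1_edge_deriv(1)[OF unit_fun_H1 e, unfolded edge_measure_eq_gauss_on]
        edge_ivl_borel ab(2,1) H1_continuous[OF unit_fun_H1 e] H1_edge_deriv(2)[OF unit_fun_H1 e]]
    have const: "primitive_on a b (\<lambda>_. c) f" if "primitive_on a b F f" "\<And>s. s \<in> {a..b} \<Longrightarrow> F s = c" for F f c
      using that ab(1) by (auto simp: primitive_on_def)
    have unit: "unit_fun (chart T e s) = 1" if "s \<in> {a..b}" for s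
      using that ab(2) by (auto simp: unit_fun_chart[OF e] indicator_def)
    have "AE s in lborel. s \<in> {a..b} \<longrightarrow> Re (?G s) = 0"
      by (rule primitive_on_const_AE_zero, rule const[OF prim(1), of 1]) (simp add: unit)
    moreover have "AE s in lborel. s \<in> {a..b} \<longrightarrow> Im (?G s) = 0"
      by (rule primitive_on_const_AE_zero, rule const[OF prim(2), of 0]) (simp add: unit)
    ultimately show ?thesis
      by eventually_elim (auto intro: complex_eqI)
  qed
  have "AE s in lborel. s \<in> ?I \<longrightarrow> ?G s = 0"
  proof (cases e)
    case (Bond u v)
    with e depth_arc_less compact[of "depth T u" "depth T v"] show ?thesis
      by (auto simp: edges_def)
  next
    case (Ray v i)
    \<comment> \<open>A half-line is exhausted by countably many compact intervals, so the
      exceptional null sets can be united.\<close>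
    then have "AE s in lborel. s \<in> {depth T v..depth T v + real (Suc n)} \<longrightarrow> ?G s = 0" for n
      by (intro compact) auto
    then have "AE s in lborel. \<forall>n. s \<in> {depth T v..depth T v + real (Suc n)} \<longrightarrow> ?G s = 0"
      by (subst AE_all_countable) blast
    then show ?thesis
    proof eventually_elim
      case (elim s)
      obtain n where "s - depth T v \<le> real n" using real_arch_simple by blast
      with elim[rule_format, of n] Ray show ?case by auto
    qed
  qed
  then show ?thesis
    unfolding edge_measure_eq_gauss_on gauss_on_def using edge_ivl_borel[of e]
    by (subst AE_density) (auto elim!: eventually_mono simp: indicator_def split: if_splits)
qed

lemma unit_fun_eigenspace: "unit_fun \<in> eigenspace (OU_Neumann T) 0"
proof -
  have "OU_form T unit_fun h = 0" for h
  proof -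
    have "(LINT s|edge_measure T e. edge_deriv T e unit_fun s * cnj (edge_deriv T e h s)) = 0"
      if e: "e \<in> edges T" for e
      by (rule integral_eq_zero_AE) (use unit_fun_edge_deriv[OF e] in \<open>eventually_elim, simp\<close>)
    then show ?thesis by (simp add: OU_form_def)
  qed
  moreover have "fscale 0 unit_fun \<in> L2 T"
    by (simp add: L2_def fscale_def tree_fun_def square_integrable_def comp_def)
  ultimately show ?thesis
    by (simp add: eigenspace_def OU_Neumann_def form_operator_def unit_fun_H1 L2_inner_def)
qed

lemma unit_fun_neq_0: "unit_fun \<noteq> 0"
proof -
  obtain v where v: "v \<in> leaves T" using leaves_nonempty by blast
  then have "v \<in> verts T" by (simp add: leaves_def)
  with v have "Ray v 0 \<in> edges T" using rays_pos_iff by (auto simp: edges_def)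
  then have "unit_fun (chart T (Ray v 0) (depth T v)) = 1"
    by (subst unit_fun_chart) auto
  then show ?thesis by (metis zero_fun_apply zero_neq_one)
qed

end

theorem proposition4p13:
  fixes T :: "'v rooted_tree" and N :: nat and t :: "nat \<Rightarrow> real" and b :: "nat \<Rightarrow> nat"
    and m :: nat and lamD lamN :: "nat \<Rightarrow> real"
  assumes regular: "regular_tree T N t b"
    and m: "m = (\<Prod>k\<le>N. b k)"
    and enumD: "eigenvalue_enumeration (OU_Dirichlet T) lamD"
    and enumN: "eigenvalue_enumeration (OU_Neumann T) lamN"
  shows "0 < lamD 1 \<and> 0 = lamN 1 \<and> lamN 1 < lamN 2 \<and>
    (\<forall>q::nat.
      ((\<forall>n. q * m + 1 \<le> n \<and> n < (q + 1) * m \<longrightarrow> lamD (n + 1) \<ge> lamD n) \<and>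
        lamD (q * m + 1) \<ge> (2 * real q + 1) * real (b 0) / real m) \<and>
      lamN (q * m + 1) \<ge> 2 * real q * real (b 0) / real m \<and>
      (m \<noteq> 1 \<longrightarrow>
        (\<forall>n. q * m + 2 \<le> n \<and> n < (q + 1) * m \<longrightarrow> lamN (n + 1) \<ge> lamN n) \<and>
        lamN (q * m + 2) \<ge> (2 * real q + 1) * real (b 0) / real m))"
proof -
  interpret regular_metric_tree T N t b
    using regular by unfold_locales
  \<comment> \<open>Here \<open>(2 * q + 1) div 2 = q\<close>, and all of \<open>H1_0 T\<close>
    vanishes at the root: \<open>q * m\<close> conditions suffice.\<close>
  have D: "lamD (q * m + 1) \<ge> (2 * real q + 1) * real (b 0) / real m" for q
    using eigenvalue_lower_bound[of "H1_0 T" lamD "{}" "2 * q + 1" "q * m + 1"] enumD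
    by (auto simp: m OU_Dirichlet_def H1_0_def add.commute)
  have N1: "lamN (q * m + 1) \<ge> 2 * real q * real (b 0) / real m" for q
    using eigenvalue_lower_bound[of "H1 T" lamN "{}" "2 * q" "q * m + 1"] enumN
    by (auto simp: m OU_Neumann_def)
  \<comment> \<open>An odd degree requires vanishing at the root; this additional condition shifts
    the index to \<open>q * m + 2\<close>.\<close>
  have N2: "lamN (q * m + 2) \<ge> (2 * real q + 1) * real (b 0) / real m" for q
    using eigenvalue_lower_bound[of "H1 T" lamN "{Vert (origin T)}" "2 * q + 1" "q * m + 2"] enumN
    by (auto simp: m OU_Neumann_def add.commute)
  have mono: "lamD i \<le> lamD j" "lamN i \<le> lamN j" if "1 \<le> i" "i \<le> j" for i j
    using enumD enumN that unfolding eigenvalue_enumeration_def by auto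
  have pos: "0 < real (b 0) / real m"
    using b_pos by (auto simp: m intro!: divide_pos_pos prod_pos)
  \<comment> \<open>The constant function contributes the eigenvalue 0, so
    \<open>lamN 1 \<le> 0\<close>; the opposite inequality is \<open>N1\<close> for
    \<open>q = 0\<close>.\<close>
  obtain i where "1 \<le> i" "lamN i = 0"
    using eigenvalue_enumerated[OF enumN, of unit_fun 0] unit_fun_eigenspace unit_fun_neq_0 by auto
  then have "lamN 1 \<le> 0" using mono(2)[of 1 i] by simp
  moreover have "0 \<le> lamN 1" using N1[of 0] by simp
  moreover have "0 < lamD 1" using D[of 0] pos by simp
  moreover have "0 < lamN 2" using N2[of 0] pos by (simp add: numeral_2_eq_2)
  ultimately show ?thesis
    using D N1 N2 mono by auto
qed

end
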